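(* Suppose $G$ is a proper groupoid. Let $(\mathscr{A},G,\alpha)$ be a groupoid dynamical system, and let $A=\Gamma_0(G^{(0)},\mathscr{A})$ be the $C_0(G^{(0)})$-algebra corresponding to $\mathscr{A}$. Then $(\mathscr{A},G,\alpha)$ is proper with respect to the subalgebra $A_0=C_c(G^{(0)})\cdot A$.
   Context: Throughout, $G$ is a second countable locally compact Hausdorff groupoid with unit space $G^{(0)}$, range and source maps $r,s$, and (left) Haar system $\{\lambda^u\}_{u\in G^{(0)}}$; $\lambda_u$ is the image of $\lambda^u$ under inversion. $M(A)$ is the multiplier algebra of $A$. $G$ is proper if its natural action $\gamma\cdot s(\gamma)=r(\gamma)$ on $G^{(0)}$ is proper, i.e. $\gamma\mapsto(r(\gamma),s(\gamma))$ from $G$ to $G^{(0)}\times G^{(0)}$ is a proper map. $C_c(G^{(0)})\cdot A=\{f\cdot a:f\in C_c(G^{(0)}),a\in A\}$, where $(f\cdot a)(u)=f(u)a(u)$. Upper semicontinuous $C^*$-bundle over a locally compact Hausdorff space $X$: a topological space $\mathscr{A}$ with a continuous open surjection $p:\mathscr{A}\to X$ whose fibres $A(x)=p^{-1}(\{x\})$ are $C^*$-algebras, such that $a\mapsto\|a\|$ is upper semicontinuous; addition and multiplication are continuous on $\{(a,b):p(a)=p(b)\}$; scalar multiplication by each fixed scalar and $a\mapsto a^*$ are continuous; and if $p(a_i)\to x$, $\|a_i\|\to0$ then $a_i\to 0_x$. $\Gamma_0(X,\mathscr{A})$ is the $C^*$-algebra of continuous sections vanishing at infinity. An element $d\in M(A)$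 with $A=\Gamma_0(X,\mathscr{A})$ has fibres $d(x)\in M(A(x))$ with $(da)(x)=d(x)a(x)$. Groupoid dynamical system $(\mathscr{A},G,\alpha)$: $\mathscr{A}$ is an upper semicontinuous $C^*$-bundle over $G^{(0)}$ with $A=\Gamma_0(G^{(0)},\mathscr{A})$ separable, and $\alpha=\{\alpha_\gamma\}_{\gamma\in G}$ is a family of $*$-isomorphisms $\alpha_\gamma:A(s(\gamma))\to A(r(\gamma))$ with $\alpha_{\gamma\eta}=\alpha_\gamma\circ\alpha_\eta$ for composable $(\gamma,\eta)$, and $(\gamma,a)\mapsto\alpha_\gamma(a)$ continuous on $\{(\gamma,a):s(\gamma)=p(a)\}$. $\bar\alpha_\gamma$ is the extension of $\alpha_\gamma$ to multiplier algebras. $I$-norm: $\|f\|_I=\max\{\sup_u\int\|f\|\,d\lambda_u,\ \sup_u\int\|f\|\,d\lambda^u\}$; $L^I(G)$ is the completion of $C_c(G)$ in this norm. Proper groupoid dynamical system: $(\mathscr{A},G,\alpha)$ is proper (with respect to $A_0$) if there is a dense $*$-subalgebra $A_0\subset A$ such that: (1) for all $a,b\in A_0$ the function ${}_E\langle a,b\rangle:\gamma\mapsto a(r(\gamma))\alpha_\gamma(b(s(\gamma))^* )$ is integrable, i.e. $\gamma\mapsto\|{}_E\langle a,b\rangle(\gamma)\|$ is in $L^I(G)$ (in particular has finite $I$-norm); (2) with $M(A_0)^\alpha:=\{d\in M(A): A_0d\subset A_0,\ \bar\alpha_\gamma(d(s(\gamma)))=d(r(\gamma))\text{ for all }\gamma\in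 G\}$, for all $a,b\in A_0$ there is a unique element $\langle a,b\rangle_D\in M(A_0)^\alpha$ such that for all $c\in A_0$, $(c\cdot\langle a,b\rangle_D)(u)=\int_G c(r(\gamma))\alpha_\gamma((a^*b)(s(\gamma)))\,d\lambda^u(\gamma)$ for $u\in G^{(0)}$. For upper semicontinuous (possibly discontinuous) norm functions, integrability in (1) is understood as finiteness of the $I$-norm. *)

theory Defs
  imports "HOL-Analysis.Analysis" "HOL-Algebra.Module"
begin

section \<open>Topological preliminaries\<close>

definition borel_of :: "'a topology \<Rightarrow> 'a measure" where
  "borel_of T = sigma (topspace T) {U. openin T U}"

definition Cc :: "'a topology \<Rightarrow> ('a \<Rightarrow> complex) set" where
  "Cc T = {f. continuous_map T euclidean f \<and>
              compactin T (T closure_of {x \<in> topspace T. f x \<noteq> 0})}"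

definition msupport :: "'a topology \<Rightarrow> 'a measure \<Rightarrow> 'a set" where
  "msupport T M = {x \<in> topspace T. \<forall>U. openin T U \<and> x \<in> U \<longrightarrow> emeasure M U > 0}"


section \<open>C*-algebras on a carrier\<close>

text \<open>The fibres of a bundle are distinct C*-algebras living inside one total space, so C*-algebras
  are given on carrier sets. The records of HOL-Algebra are reused for the algebraic operations;
  their field \<open>one\<close> plays no role, since C*-algebras need not be unital.\<close>

record 'a cstar_struct = "(complex, 'a) module" +
  star :: "'a \<Rightarrow> 'a"
  cnorm :: "'a \<Rightarrow> real"

text \<open>The value off the carrier is irrelevant; it makes the function a total metric
  in the sense of \<^locale>\<open>Metric_space\<close>.\<close>

definition cdist :: "'a cstar_struct \<Rightarrow> 'a \<Rightarrow> 'a \<Rightarrow> real" where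
  "cdist A x y = (if x \<in> carrier A \<and> y \<in> carrier A then cnorm A (x \<ominus>\<^bsub>A\<^esub> y) else 0)"

definition norm_topology :: "'a cstar_struct \<Rightarrow> 'a topology" where
  "norm_topology A = Metric_space.mtopology (carrier A) (cdist A)"

locale cstar_algebra = abelian_group A for A :: "'a cstar_struct" (structure) +
  assumes mult_closed: "\<lbrakk>x \<in> carrier A; y \<in> carrier A\<rbrakk> \<Longrightarrow> x \<otimes> y \<in> carrier A"
    and mult_assoc: "\<lbrakk>x \<in> carrier A; y \<in> carrier A; z \<in> carrier A\<rbrakk> \<Longrightarrow> (x \<otimes> y) \<otimes> z = x \<otimes> (y \<otimes> z)"
    and distrib_left: "\<lbrakk>x \<in> carrier A; y \<in> carrier A; z \<in> carrier A\<rbrakk> \<Longrightarrow> x \<otimes> (y \<oplus> z) = (x \<otimes> y) \<oplus> (x \<otimes> z)"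
    and distrib_right: "\<lbrakk>x \<in> carrier A; y \<in> carrier A; z \<in> carrier A\<rbrakk> \<Longrightarrow> (x \<oplus> y) \<otimes> z = (x \<otimes> z) \<oplus> (y \<otimes> z)"
    and smult_closed: "x \<in> carrier A \<Longrightarrow> k \<odot> x \<in> carrier A"
    and smult_add_left: "x \<in> carrier A \<Longrightarrow> (k + l) \<odot> x = (k \<odot> x) \<oplus> (l \<odot> x)"
    and smult_add_right: "\<lbrakk>x \<in> carrier A; y \<in> carrier A\<rbrakk> \<Longrightarrow> k \<odot> (x \<oplus> y) = (k \<odot> x) \<oplus> (k \<odot> y)"
    and smult_smult: "x \<in> carrier A \<Longrightarrow> (k * l) \<odot> x = k \<odot> (l \<odot> x)"
    and smult_one: "x \<in> carrier A \<Longrightarrow> 1 \<odot> x = x"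
    and smult_mult_left: "\<lbrakk>x \<in> carrier A; y \<in> carrier A\<rbrakk> \<Longrightarrow> (k \<odot> x) \<otimes> y = k \<odot> (x \<otimes> y)"
    and smult_mult_right: "\<lbrakk>x \<in> carrier A; y \<in> carrier A\<rbrakk> \<Longrightarrow> x \<otimes> (k \<odot> y) = k \<odot> (x \<otimes> y)"
    and star_closed: "x \<in> carrier A \<Longrightarrow> star A x \<in> carrier A"
    and star_star: "x \<in> carrier A \<Longrightarrow> star A (star A x) = x"
    and star_add: "\<lbrakk>x \<in> carrier A; y \<in> carrier A\<rbrakk> \<Longrightarrow> star A (x \<oplus> y) = star A x \<oplus> star A y"
    and star_smult: "x \<in> carrier A \<Longrightarrow> star A (k \<odot> x) = cnj k \<odot> star A x"
    and star_mult: "\<lbrakk>x \<in> carrier A; y \<in> carrier A\<rbrakk> \<Longrightarrow> star A (x \<otimes> y) = star A y \<otimes> star A x"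
    and cnorm_nonneg: "x \<in> carrier A \<Longrightarrow> 0 \<le> cnorm A x"
    and cnorm_eq_0: "x \<in> carrier A \<Longrightarrow> cnorm A x = 0 \<longleftrightarrow> x = \<zero>"
    and cnorm_add: "\<lbrakk>x \<in> carrier A; y \<in> carrier A\<rbrakk> \<Longrightarrow> cnorm A (x \<oplus> y) \<le> cnorm A x + cnorm A y"
    and cnorm_smult: "x \<in> carrier A \<Longrightarrow> cnorm A (k \<odot> x) = cmod k * cnorm A x"
    and cnorm_mult: "\<lbrakk>x \<in> carrier A; y \<in> carrier A\<rbrakk> \<Longrightarrow> cnorm A (x \<otimes> y) \<le> cnorm A x * cnorm A y"
    and cstar_identity: "x \<in> carrier A \<Longrightarrow> cnorm A (star A x \<otimes> x) = (cnorm A x)\<^sup>2"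
    and complete: "Metric_space.mcomplete (carrier A) (cdist A)"

definition star_subalgebra :: "'a cstar_struct \<Rightarrow> 'a set \<Rightarrow> bool" where
  "star_subalgebra A S \<longleftrightarrow> S \<subseteq> carrier A \<and> \<zero>\<^bsub>A\<^esub> \<in> S \<and>
     (\<forall>x\<in>S. \<forall>y\<in>S. x \<oplus>\<^bsub>A\<^esub> y \<in> S \<and> x \<otimes>\<^bsub>A\<^esub> y \<in> S) \<and>
     (\<forall>x\<in>S. star A x \<in> S \<and> (\<forall>k. k \<odot>\<^bsub>A\<^esub> x \<in> S))"

definition dense_in_cstar :: "'a cstar_struct \<Rightarrow> 'a set \<Rightarrow> bool" where
  "dense_in_cstar A S \<longleftrightarrow> norm_topology A closure_of S = carrier A"

definition star_iso :: "'a cstar_struct \<Rightarrow> 'b cstar_struct \<Rightarrow> ('a \<Rightarrow> 'b) \<Rightarrow> bool" where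
  "star_iso A B \<phi> \<longleftrightarrow> bij_betw \<phi> (carrier A) (carrier B) \<and>
     (\<forall>x\<in>carrier A. \<forall>y\<in>carrier A.
        \<phi> (x \<oplus>\<^bsub>A\<^esub> y) = \<phi> x \<oplus>\<^bsub>B\<^esub> \<phi> y \<and> \<phi> (x \<otimes>\<^bsub>A\<^esub> y) = \<phi> x \<otimes>\<^bsub>B\<^esub> \<phi> y) \<and>
     (\<forall>x\<in>carrier A. \<phi> (star A x) = star B (\<phi> x) \<and> (\<forall>k. \<phi> (k \<odot>\<^bsub>A\<^esub> x) = k \<odot>\<^bsub>B\<^esub> \<phi> x))"


subsection \<open>Multiplier algebra\<close>

text \<open>\<open>M(A)\<close> as the set of double centralizers \<open>d = (L, R)\<close>, with \<open>d a = L a\<close> and \<open>a d = R a\<close>.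
  The maps are extensional, so that equality of multipliers is equality of pairs.\<close>

definition bounded_operator :: "'a cstar_struct \<Rightarrow> ('a \<Rightarrow> 'a) \<Rightarrow> bool" where
  "bounded_operator A T \<longleftrightarrow> T \<in> carrier A \<rightarrow>\<^sub>E carrier A \<and>
     (\<forall>x\<in>carrier A. \<forall>y\<in>carrier A. T (x \<oplus>\<^bsub>A\<^esub> y) = T x \<oplus>\<^bsub>A\<^esub> T y) \<and>
     (\<forall>x\<in>carrier A. \<forall>k. T (k \<odot>\<^bsub>A\<^esub> x) = k \<odot>\<^bsub>A\<^esub> T x) \<and>
     (\<exists>C. \<forall>x\<in>carrier A. cnorm A (T x) \<le> C * cnorm A x)"

type_synonym 'a multiplier = "('a \<Rightarrow> 'a) \<times> ('a \<Rightarrow> 'a)"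

abbreviation mlt_left :: "'a multiplier \<Rightarrow> 'a \<Rightarrow> 'a" where
  "mlt_left d a \<equiv> fst d a"

abbreviation mlt_right :: "'a \<Rightarrow> 'a multiplier \<Rightarrow> 'a" where
  "mlt_right a d \<equiv> snd d a"

definition multipliers :: "'a cstar_struct \<Rightarrow> 'a multiplier set" where
  "multipliers A = {(L, R). bounded_operator A L \<and> bounded_operator A R \<and>
     (\<forall>a\<in>carrier A. \<forall>b\<in>carrier A.
        L (a \<otimes>\<^bsub>A\<^esub> b) = L a \<otimes>\<^bsub>A\<^esub> b \<and>
        R (a \<otimes>\<^bsub>A\<^esub> b) = a \<otimes>\<^bsub>A\<^esub> R b \<and>
        a \<otimes>\<^bsub>A\<^esub> L b = R a \<otimes>\<^bsub>A\<^esub> b)}"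

text \<open>The extension to multipliers of an isomorphism \<open>\<phi> : A \<rightarrow> B\<close>.\<close>

definition mlt_ext ::
  "'a cstar_struct \<Rightarrow> 'b cstar_struct \<Rightarrow> ('a \<Rightarrow> 'b) \<Rightarrow> 'a multiplier \<Rightarrow> 'b multiplier" where
  "mlt_ext A B \<phi> d =
     ((\<lambda>b\<in>carrier B. \<phi> (mlt_left d (inv_into (carrier A) \<phi> b))),
      (\<lambda>b\<in>carrier B. \<phi> (mlt_right (inv_into (carrier A) \<phi> b) d)))"


subsection \<open>Bochner integral in a C*-algebra on a carrier\<close>

text \<open>The carrier version of \<^const>\<open>has_bochner_integral\<close>, whose values must form a type of class
  \<open>real_normed_vector\<close>.\<close>

definition csimple :: "'a cstar_struct \<Rightarrow> 'g measure \<Rightarrow> ('g \<Rightarrow> 'a) \<Rightarrow> bool" where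
  "csimple A M h \<longleftrightarrow> h \<in> space M \<rightarrow> carrier A \<and> finite (h ` space M) \<and>
     (\<forall>y\<in>carrier A. {t \<in> space M. h t = y} \<in> sets M) \<and>
     emeasure M {t \<in> space M. h t \<noteq> \<zero>\<^bsub>A\<^esub>} \<noteq> \<infinity>"

definition csimple_integral :: "'a cstar_struct \<Rightarrow> 'g measure \<Rightarrow> ('g \<Rightarrow> 'a) \<Rightarrow> 'a" where
  "csimple_integral A M h =
     (\<Oplus>\<^bsub>A\<^esub>y\<in>h ` space M. complex_of_real (measure M {t \<in> space M. h t = y}) \<odot>\<^bsub>A\<^esub> y)"

definition has_cstar_integral ::
  "'a cstar_struct \<Rightarrow> 'g measure \<Rightarrow> ('g \<Rightarrow> 'a) \<Rightarrow> 'a \<Rightarrow> bool" where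
  "has_cstar_integral A M f x \<longleftrightarrow>
     f \<in> measurable M (borel_of (norm_topology A)) \<and> x \<in> carrier A \<and>
     (\<exists>h :: nat \<Rightarrow> 'g \<Rightarrow> 'a.
        (\<forall>i. csimple A M (h i)) \<and>
        ((\<lambda>i. \<integral>\<^sup>+ t. ennreal (cnorm A (f t \<ominus>\<^bsub>A\<^esub> h i t)) \<partial>M) \<longlonglongrightarrow> 0) \<and>
        ((\<lambda>i. cnorm A (csimple_integral A M (h i) \<ominus>\<^bsub>A\<^esub> x)) \<longlonglongrightarrow> 0))"


section \<open>Upper semicontinuous C*-bundles\<close>

record ('x, 'e) cbundle =
  total :: "'e topology"
  proj :: "'e \<Rightarrow> 'x"
  fib :: "'x \<Rightarrow> 'e cstar_struct"

text \<open>In the last axiom a net in the total space is represented by a filter on it.\<close>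

locale usc_cstar_bundle =
  fixes X :: "'x topology" and B :: "('x, 'e) cbundle"
  assumes base_lc: "locally_compact_space X"
    and base_Hausdorff: "Hausdorff_space X"
    and proj_continuous: "continuous_map (total B) X (proj B)"
    and proj_open: "open_map (total B) X (proj B)"
    and proj_surj: "proj B ` topspace (total B) = topspace X"
    and fib_cstar: "x \<in> topspace X \<Longrightarrow> cstar_algebra (fib B x)"
    and fib_carrier: "x \<in> topspace X \<Longrightarrow> carrier (fib B x) = {e \<in> topspace (total B). proj B e = x}"
    and norm_usc: "openin (total B) {e \<in> topspace (total B). cnorm (fib B (proj B e)) e < c}"
    and add_continuous:
      "continuous_map (subtopology (prod_topology (total B) (total B)) {(a, b). proj B a = proj B b})
         (total B) (\<lambda>(a, b). a \<oplus>\<^bsub>fib B (proj B a)\<^esub> b)"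
    and mult_continuous:
      "continuous_map (subtopology (prod_topology (total B) (total B)) {(a, b). proj B a = proj B b})
         (total B) (\<lambda>(a, b). a \<otimes>\<^bsub>fib B (proj B a)\<^esub> b)"
    and smult_continuous:
      "continuous_map (total B) (total B) (\<lambda>a. k \<odot>\<^bsub>fib B (proj B a)\<^esub> a)"
    and star_continuous:
      "continuous_map (total B) (total B) (\<lambda>a. star (fib B (proj B a)) a)"
    and zero_limit:
      "\<lbrakk>eventually (\<lambda>a. a \<in> topspace (total B)) \<Phi>; limitin X (proj B) x \<Phi>;
        ((\<lambda>a. cnorm (fib B (proj B a)) a) \<longlongrightarrow> 0) \<Phi>\<rbrakk>
       \<Longrightarrow> limitin (total B) (\<lambda>a. a) \<zero>\<^bsub>fib B x\<^esub> \<Phi>"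

definition Gamma0 :: "'x topology \<Rightarrow> ('x, 'e) cbundle \<Rightarrow> ('x \<Rightarrow> 'e) set" where
  "Gamma0 X B = {a. a \<in> extensional (topspace X) \<and> continuous_map X (total B) a \<and>
     (\<forall>x\<in>topspace X. proj B (a x) = x) \<and>
     (\<forall>\<epsilon>>0. compactin X {x \<in> topspace X. \<epsilon> \<le> cnorm (fib B x) (a x)})}"

text \<open>Inserting \<open>0\<close> only matters for the empty base space.\<close>

definition section_algebra :: "'x topology \<Rightarrow> ('x, 'e) cbundle \<Rightarrow> ('x \<Rightarrow> 'e) cstar_struct" where
  "section_algebra X B =
     \<lparr>carrier = Gamma0 X B,
      mult = (\<lambda>a b. \<lambda>x\<in>topspace X. a x \<otimes>\<^bsub>fib B x\<^esub> b x),
      one = undefined,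
      zero = (\<lambda>x\<in>topspace X. \<zero>\<^bsub>fib B x\<^esub>),
      add = (\<lambda>a b. \<lambda>x\<in>topspace X. a x \<oplus>\<^bsub>fib B x\<^esub> b x),
      smult = (\<lambda>k a. \<lambda>x\<in>topspace X. k \<odot>\<^bsub>fib B x\<^esub> a x),
      star = (\<lambda>a. \<lambda>x\<in>topspace X. star (fib B x) (a x)),
      cnorm = (\<lambda>a. Sup (insert 0 ((\<lambda>x. cnorm (fib B x) (a x)) ` topspace X)))\<rparr>"

definition Cc_sections :: "'x topology \<Rightarrow> ('x, 'e) cbundle \<Rightarrow> ('x \<Rightarrow> 'e) set" where
  "Cc_sections X B =
     {\<lambda>x\<in>topspace X. f x \<odot>\<^bsub>fib B x\<^esub> a x | f a. f \<in> Cc X \<and> a \<in> carrier (section_algebra X B)}"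

text \<open>\<open>D x\<close> is the fibre \<open>d(x) \<in> M(A(x))\<close> of \<open>d \<in> M(A)\<close> for each \<open>x\<close>. The family \<open>D\<close> is determined
  by \<open>d\<close> on the base space, because every point of the total space lies on a section in \<open>A\<close>.\<close>

definition fibres_of_multiplier ::
  "'x topology \<Rightarrow> ('x, 'e) cbundle \<Rightarrow> ('x \<Rightarrow> 'e) multiplier \<Rightarrow> ('x \<Rightarrow> 'e multiplier) \<Rightarrow> bool" where
  "fibres_of_multiplier X B d D \<longleftrightarrow>
     (\<forall>x\<in>topspace X. D x \<in> multipliers (fib B x) \<and>
        (\<forall>a\<in>carrier (section_algebra X B). mlt_left d a x = mlt_left (D x) (a x)))"


section \<open>Groupoids with Haar systems\<close>

record 'g groupoid =
  gtop :: "'g topology"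
  rng :: "'g \<Rightarrow> 'g"
  src :: "'g \<Rightarrow> 'g"
  gcomp :: "'g \<Rightarrow> 'g \<Rightarrow> 'g"
  ginv :: "'g \<Rightarrow> 'g"

abbreviation arrows :: "'g groupoid \<Rightarrow> 'g set" where
  "arrows G \<equiv> topspace (gtop G)"

text \<open>Units are identified with the identity arrows.\<close>

definition unit_space :: "'g groupoid \<Rightarrow> 'g topology" where
  "unit_space G = subtopology (gtop G) (rng G ` arrows G)"

abbreviation units :: "'g groupoid \<Rightarrow> 'g set" where
  "units G \<equiv> topspace (unit_space G)"

definition range_fibre :: "'g groupoid \<Rightarrow> 'g \<Rightarrow> 'g set" where
  "range_fibre G u = {\<gamma> \<in> arrows G. rng G \<gamma> = u}"

locale lch_groupoid =
  fixes G :: "'g groupoid"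
  assumes second_countable: "second_countable (gtop G)"
    and locally_compact: "locally_compact_space (gtop G)"
    and Hausdorff: "Hausdorff_space (gtop G)"
    and rng_closed: "x \<in> arrows G \<Longrightarrow> rng G x \<in> arrows G"
    and src_closed: "x \<in> arrows G \<Longrightarrow> src G x \<in> arrows G"
    and unit_ends:
      "x \<in> arrows G \<Longrightarrow> rng G (rng G x) = rng G x \<and> src G (rng G x) = rng G x \<and>
                        rng G (src G x) = src G x \<and> src G (src G x) = src G x"
    and comp_closed: "\<lbrakk>x \<in> arrows G; y \<in> arrows G; src G x = rng G y\<rbrakk> \<Longrightarrow> gcomp G x y \<in> arrows G"
    and comp_ends: "\<lbrakk>x \<in> arrows G; y \<in> arrows G; src G x = rng G y\<rbrakk> \<Longrightarrow>
                    rng G (gcomp G x y) = rng G x \<and> src G (gcomp G x y) = src G y"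
    and comp_assoc: "\<lbrakk>x \<in> arrows G; y \<in> arrows G; z \<in> arrows G; src G x = rng G y; src G y = rng G z\<rbrakk>
                     \<Longrightarrow> gcomp G (gcomp G x y) z = gcomp G x (gcomp G y z)"
    and comp_unit: "x \<in> arrows G \<Longrightarrow> gcomp G (rng G x) x = x \<and> gcomp G x (src G x) = x"
    and inv_closed: "x \<in> arrows G \<Longrightarrow> ginv G x \<in> arrows G"
    and inv_ends: "x \<in> arrows G \<Longrightarrow> rng G (ginv G x) = src G x \<and> src G (ginv G x) = rng G x"
    and comp_inv: "x \<in> arrows G \<Longrightarrow> gcomp G x (ginv G x) = rng G x \<and> gcomp G (ginv G x) x = src G x"
    and comp_continuous:
      "continuous_map (subtopology (prod_topology (gtop G) (gtop G)) {(x, y). src G x = rng G y})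
         (gtop G) (\<lambda>(x, y). gcomp G x y)"
    and inv_continuous: "continuous_map (gtop G) (gtop G) (ginv G)"

definition proper_groupoid :: "'g groupoid \<Rightarrow> bool" where
  "proper_groupoid G \<longleftrightarrow>
     proper_map (gtop G) (prod_topology (unit_space G) (unit_space G)) (\<lambda>\<gamma>. (rng G \<gamma>, src G \<gamma>))"

text \<open>On a second countable locally compact Hausdorff space a Radon measure is the same as a Borel
  measure that is finite on compact sets.\<close>

locale haar_system =
  fixes G :: "'g groupoid" and lam :: "'g \<Rightarrow> 'g measure"
  assumes sets_lam: "u \<in> units G \<Longrightarrow> sets (lam u) = sets (borel_of (gtop G))"
    and lam_compact: "\<lbrakk>u \<in> units G; compactin (gtop G) K\<rbrakk> \<Longrightarrow> emeasure (lam u) K < \<infinity>"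
    and lam_support: "u \<in> units G \<Longrightarrow> msupport (gtop G) (lam u) = range_fibre G u"
    and lam_continuous: "f \<in> Cc (gtop G) \<Longrightarrow>
          continuous_map (unit_space G) euclidean (\<lambda>u. LINT \<gamma>|lam u. f \<gamma>)"
    and lam_left_invariant: "\<lbrakk>f \<in> Cc (gtop G); \<gamma> \<in> arrows G\<rbrakk> \<Longrightarrow>
          (LINT \<eta>:range_fibre G (src G \<gamma>)|lam (src G \<gamma>). f (gcomp G \<gamma> \<eta>))
            = (LINT \<eta>:range_fibre G (rng G \<gamma>)|lam (rng G \<gamma>). f \<eta>)"

text \<open>\<open>\<lambda>\<^sub>u\<close>, the image of \<open>\<lambda>\<^sup>u\<close> under inversion.\<close>

definition lam_inv :: "'g groupoid \<Rightarrow> ('g \<Rightarrow> 'g measure) \<Rightarrow> 'g \<Rightarrow> 'g measure" where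
  "lam_inv G lam u = distr (lam u) (borel_of (gtop G)) (ginv G)"

text \<open>The \<open>I\<close>-norm of a function whose pointwise norm is \<open>n\<close>.\<close>

definition I_norm :: "'g groupoid \<Rightarrow> ('g \<Rightarrow> 'g measure) \<Rightarrow> ('g \<Rightarrow> real) \<Rightarrow> ennreal" where
  "I_norm G lam n =
     max (SUP u\<in>units G. \<integral>\<^sup>+ \<gamma>. ennreal (n \<gamma>) \<partial>lam_inv G lam u)
         (SUP u\<in>units G. \<integral>\<^sup>+ \<gamma>. ennreal (n \<gamma>) \<partial>lam u)"

definition I_integrable :: "'g groupoid \<Rightarrow> ('g \<Rightarrow> 'g measure) \<Rightarrow> ('g \<Rightarrow> real) \<Rightarrow> bool" where
  "I_integrable G lam n \<longleftrightarrow> n \<in> borel_measurable (borel_of (gtop G)) \<and> I_norm G lam n < \<infinity>"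


section \<open>Groupoid dynamical systems\<close>

locale groupoid_dynamical_system = usc_cstar_bundle "unit_space G" B
  for G :: "'g groupoid" and B :: "('g, 'e) cbundle" +
  fixes \<alpha> :: "'g \<Rightarrow> 'e \<Rightarrow> 'e"
  assumes separable: "separable_space (norm_topology (section_algebra (unit_space G) B))"
    and action_iso: "\<gamma> \<in> arrows G \<Longrightarrow> star_iso (fib B (src G \<gamma>)) (fib B (rng G \<gamma>)) (\<alpha> \<gamma>)"
    and action_comp: "\<lbrakk>\<gamma> \<in> arrows G; \<eta> \<in> arrows G; src G \<gamma> = rng G \<eta>; a \<in> carrier (fib B (src G \<eta>))\<rbrakk>
          \<Longrightarrow> \<alpha> (gcomp G \<gamma> \<eta>) a = \<alpha> \<gamma> (\<alpha> \<eta> a)"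
    and action_continuous:
      "continuous_map (subtopology (prod_topology (gtop G) (total B)) {(\<gamma>, a). src G \<gamma> = proj B a})
         (total B) (\<lambda>(\<gamma>, a). \<alpha> \<gamma> a)"

definition E_inner ::
  "'g groupoid \<Rightarrow> ('g, 'e) cbundle \<Rightarrow> ('g \<Rightarrow> 'e \<Rightarrow> 'e) \<Rightarrow> ('g \<Rightarrow> 'e) \<Rightarrow> ('g \<Rightarrow> 'e) \<Rightarrow> 'g \<Rightarrow> 'e" where
  "E_inner G B \<alpha> a b \<gamma> =
     a (rng G \<gamma>) \<otimes>\<^bsub>fib B (rng G \<gamma>)\<^esub> \<alpha> \<gamma> (star (fib B (src G \<gamma>)) (b (src G \<gamma>)))"

definition invariant_multipliers ::
  "'g groupoid \<Rightarrow> ('g, 'e) cbundle \<Rightarrow> ('g \<Rightarrow> 'e \<Rightarrow> 'e) \<Rightarrow> ('g \<Rightarrow> 'e) set \<Rightarrow> ('g \<Rightarrow> 'e) multiplier set" where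
  "invariant_multipliers G B \<alpha> A0 =
     {d \<in> multipliers (section_algebra (unit_space G) B).
        (\<forall>a\<in>A0. mlt_right a d \<in> A0) \<and>
        (\<exists>D. fibres_of_multiplier (unit_space G) B d D \<and>
           (\<forall>\<gamma>\<in>arrows G. mlt_ext (fib B (src G \<gamma>)) (fib B (rng G \<gamma>)) (\<alpha> \<gamma>) (D (src G \<gamma>)) = D (rng G \<gamma>)))}"

definition is_D_inner ::
  "'g groupoid \<Rightarrow> ('g \<Rightarrow> 'g measure) \<Rightarrow> ('g, 'e) cbundle \<Rightarrow> ('g \<Rightarrow> 'e \<Rightarrow> 'e) \<Rightarrow> ('g \<Rightarrow> 'e) set \<Rightarrow>
     ('g \<Rightarrow> 'e) \<Rightarrow> ('g \<Rightarrow> 'e) \<Rightarrow> ('g \<Rightarrow> 'e) multiplier \<Rightarrow> bool" where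
  "is_D_inner G lam B \<alpha> A0 a b d \<longleftrightarrow> (let A = section_algebra (unit_space G) B in
     \<forall>c\<in>A0. \<forall>u\<in>units G.
       has_cstar_integral (fib B u) (restrict_space (lam u) (range_fibre G u))
         (\<lambda>\<gamma>. c (rng G \<gamma>) \<otimes>\<^bsub>fib B (rng G \<gamma>)\<^esub> \<alpha> \<gamma> ((star A a \<otimes>\<^bsub>A\<^esub> b) (src G \<gamma>)))
         (mlt_right c d u))"

definition proper_dynamical_system ::
  "'g groupoid \<Rightarrow> ('g \<Rightarrow> 'g measure) \<Rightarrow> ('g, 'e) cbundle \<Rightarrow> ('g \<Rightarrow> 'e \<Rightarrow> 'e) \<Rightarrow> ('g \<Rightarrow> 'e) set \<Rightarrow> bool" where
  "proper_dynamical_system G lam B \<alpha> A0 \<longleftrightarrow>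
     groupoid_dynamical_system G B \<alpha> \<and>
     star_subalgebra (section_algebra (unit_space G) B) A0 \<and>
     dense_in_cstar (section_algebra (unit_space G) B) A0 \<and>
     (\<forall>a\<in>A0. \<forall>b\<in>A0.
        I_integrable G lam (\<lambda>\<gamma>. cnorm (fib B (rng G \<gamma>)) (E_inner G B \<alpha> a b \<gamma>))) \<and>
     (\<forall>a\<in>A0. \<forall>b\<in>A0.
        \<exists>!d. d \<in> invariant_multipliers G B \<alpha> A0 \<and> is_D_inner G lam B \<alpha> A0 a b d)"

end

theory Submission
  imports Defs
begin

text \<open>For \<open>a, b\<close> in \<open>A\<^sub>0 = C\<^sub>c(G\<^sup>0) \<cdot> A\<close> put \<open>m = a\<^sup>* b\<close>. By properness, \<open>\<gamma> \<mapsto> \<alpha>\<^sub>\<gamma>(m(s(\<gamma>)))\<close> is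
  compactly supported on each range fibre, so it has an integral \<open>I(u) \<in> A(u)\<close> over \<open>\<lambda>\<^sup>u\<close>, and
  multiplication by the section \<open>I\<close> is the required multiplier. Everything about \<open>I\<close> comes from Riemann
  sums \<open>\<Sum>j. (\<integral> \<phi>\<^sub>j d\<lambda>\<^sup>u) F(\<gamma>\<^sub>j)\<close> for a partition of unity \<open>\<phi>\<^sub>j\<close> on \<open>G\<close> and tags \<open>\<gamma>\<^sub>j\<close> in the range fibre of
  \<open>u\<close>. Since \<open>r\<close> is open, the tags can follow \<open>u\<close>, which gives continuity of \<open>I\<close> without knowing that the
  bundle has enough continuous sections. Left invariance of the Haar system on the scalar coefficients gives
  \<open>\<alpha>\<^sub>\<gamma>(I(s(\<gamma>))) = I(r(\<gamma>))\<close>. Each \<open>\<alpha>\<^sub>\<gamma>\<close> is contractive, so invariance bounds \<open>I\<close> on every orbit by its values on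
  the compact support of \<open>m\<close>. Uniqueness holds because a multiplier is determined by its right action on \<open>A\<^sub>0\<close>.\<close>

section \<open>Norms and integrals in a C*-algebra on a carrier\<close>

text \<open>The bundle norm is only upper semicontinuous, and values over different units cannot be
  subtracted. The estimates therefore use only conditions of the form "some norm is
  \<open>< c\<close>", which are open. Every neighbourhood of a zero element contains a tube
  \<open>proj B e \<in> U\<close>, \<open>bnorm e < \<epsilon>\<close>, and oscillation is measured
  only between arrows with the same range. Two facts must be derived before invariance can be used.
  The Haar axioms concern scalar functions in \<open>Cc\<close>, so vector-valued invariance has to
  pass through sums with scalar weights. And \<open>star_iso\<close> is purely algebraic, so a bound
  on \<open>\<alpha> \<gamma>\<close> is read off from continuity of the action at zero and then
  improved to 1. The dominating bump \<open>\<psi>\<close> is fixed before the mesh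
  \<open>\<epsilon>\<close>, so a Riemann sum misses the integral by at most
  \<open>\<epsilon>\<close> times the integral of \<open>\<psi>\<close>. Boundedness rests on
  invariance because the arrows from \<open>L\<close> to \<open>u\<close> may leave every compact
  set as \<open>u\<close> moves off to infinity, so no single bump dominates the integrands over all
  units.\<close>

lemma space_borel_of [simp]: "space (borel_of T) = topspace T"
  by (simp add: borel_of_def space_measure_of_conv)

lemma sets_borel_of: "sets (borel_of T) = sigma_sets (topspace T) {U. openin T U}"
  unfolding borel_of_def by (intro sets_measure_of) (auto dest: openin_subset)

lemma sets_borel_of_openin: "openin T U \<Longrightarrow> U \<in> sets (borel_of T)"
  by (simp add: sets_borel_of sigma_sets.Basic)

section \<open>Arithmetic of the operations, the norm and the adjoint\<close>

context cstar_algebra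
begin

lemma cnorm_zero [simp]: "cnorm A \<zero> = 0"
  using cnorm_eq_0[of \<zero>] by simp

text \<open>Null products are recognised by definiteness of the norm: the norm of the left side is
  \<open>cmod k * 0\<close>.\<close>

lemma smult_zero_right [simp]: "k \<odot> \<zero> = \<zero>"
  using cnorm_eq_0[of "k \<odot> \<zero>"] by (simp add: smult_closed cnorm_smult)

lemma smult_zero_left [simp]: "x \<in> carrier A \<Longrightarrow> 0 \<odot> x = \<zero>"
  using cnorm_eq_0[of "0 \<odot> x"] by (simp add: smult_closed cnorm_smult)

text \<open>Reduces subtraction to addition and scalar multiplication, so that linearity,
  distributivity and the bundle axioms, none of which mentions differences, apply to them.\<close>

lemma uminus_eq_smult: "x \<in> carrier A \<Longrightarrow> \<ominus> x = (- 1) \<odot> x"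
proof -
  assume x: "x \<in> carrier A"
  have "(- 1) \<odot> x \<oplus> x = (- 1 + 1) \<odot> x"
    using x by (simp only: smult_add_left smult_one)
  then have "(- 1) \<odot> x \<oplus> x = \<zero>" using x by simp
  then show ?thesis using x by (intro minus_equality smult_closed)
qed

lemma cnorm_uminus [simp]: "x \<in> carrier A \<Longrightarrow> cnorm A (\<ominus> x) = cnorm A x"
  by (simp add: uminus_eq_smult cnorm_smult)

lemma uminus_diff: "\<lbrakk>x \<in> carrier A; y \<in> carrier A\<rbrakk> \<Longrightarrow> \<ominus> (x \<ominus> y) = y \<ominus> x"
  by (simp add: a_minus_def minus_add a_ac)

lemma cnorm_diff_commute:
  "\<lbrakk>x \<in> carrier A; y \<in> carrier A\<rbrakk> \<Longrightarrow> cnorm A (x \<ominus> y) = cnorm A (y \<ominus> x)"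
  by (metis cnorm_uminus minus_closed uminus_diff)

lemma diff_add_diff:
  "\<lbrakk>x \<in> carrier A; y \<in> carrier A; z \<in> carrier A\<rbrakk> \<Longrightarrow> (x \<ominus> y) \<oplus> (y \<ominus> z) = x \<ominus> z"
proof -
  assume c: "x \<in> carrier A" "y \<in> carrier A" "z \<in> carrier A"
  have "(x \<ominus> y) \<oplus> (y \<ominus> z) = x \<oplus> (\<ominus> y \<oplus> (y \<oplus> \<ominus> z))"
    using c by (simp add: a_minus_def a_assoc)
  also have "\<ominus> y \<oplus> (y \<oplus> \<ominus> z) = \<ominus> z" using c by (simp add: r_neg1)
  finally show ?thesis by (simp add: a_minus_def)
qed

lemma add_diff_cancel: "\<lbrakk>x \<in> carrier A; y \<in> carrier A\<rbrakk> \<Longrightarrow> y \<oplus> (x \<ominus> y) = x"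
  by (metis a_minus_def a_comm a_inv_closed a_assoc l_neg r_zero)

lemma add_diff_add:
  "\<lbrakk>a \<in> carrier A; b \<in> carrier A; c \<in> carrier A; d \<in> carrier A\<rbrakk>
    \<Longrightarrow> (a \<oplus> b) \<ominus> (c \<oplus> d) = (a \<ominus> c) \<oplus> (b \<ominus> d)"
  by (simp add: a_minus_def minus_add a_ac)

lemma diff_self [simp]: "x \<in> carrier A \<Longrightarrow> x \<ominus> x = \<zero>"
  by (simp add: a_minus_def r_neg)

lemma diff_zero [simp]: "x \<in> carrier A \<Longrightarrow> x \<ominus> \<zero> = x"
  by (simp add: a_minus_def)

lemma diff_eq_zero: "\<lbrakk>x \<in> carrier A; y \<in> carrier A; x \<ominus> y = \<zero>\<rbrakk> \<Longrightarrow> x = y"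
  by (metis add_diff_cancel r_zero)

lemma cnorm_triangle:
  "\<lbrakk>x \<in> carrier A; y \<in> carrier A; z \<in> carrier A\<rbrakk>
    \<Longrightarrow> cnorm A (x \<ominus> z) \<le> cnorm A (x \<ominus> y) + cnorm A (y \<ominus> z)"
  using cnorm_add[of "x \<ominus> y" "y \<ominus> z"] by (simp add: diff_add_diff)

lemma cnorm_le_diff:
  "\<lbrakk>x \<in> carrier A; y \<in> carrier A\<rbrakk> \<Longrightarrow> cnorm A x \<le> cnorm A (x \<ominus> y) + cnorm A y"
  using cnorm_triangle[of x y \<zero>] by simp

lemma smult_diff_right:
  "\<lbrakk>x \<in> carrier A; y \<in> carrier A\<rbrakk> \<Longrightarrow> k \<odot> (x \<ominus> y) = k \<odot> x \<ominus> k \<odot> y"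
  by (simp add: a_minus_def uminus_eq_smult smult_add_right smult_closed flip: smult_smult)

lemma smult_diff_left: "x \<in> carrier A \<Longrightarrow> (k - l) \<odot> x = k \<odot> x \<ominus> l \<odot> x"
  using smult_add_left[of x k "- l"]
  by (simp add: a_minus_def uminus_eq_smult smult_closed flip: smult_smult)

lemma mult_zero_left: "x \<in> carrier A \<Longrightarrow> \<zero> \<otimes> x = \<zero>"
  using cnorm_mult[of \<zero> x] cnorm_nonneg[of "\<zero> \<otimes> x"] cnorm_eq_0[of "\<zero> \<otimes> x"]
  by (simp add: mult_closed)

lemma mult_zero_right: "x \<in> carrier A \<Longrightarrow> x \<otimes> \<zero> = \<zero>"
  using cnorm_mult[of x \<zero>] cnorm_nonneg[of "x \<otimes> \<zero>"] cnorm_eq_0[of "x \<otimes> \<zero>"]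
  by (simp add: mult_closed)

lemma mult_diff_right:
  "\<lbrakk>x \<in> carrier A; y \<in> carrier A; z \<in> carrier A\<rbrakk> \<Longrightarrow> x \<otimes> (y \<ominus> z) = x \<otimes> y \<ominus> x \<otimes> z"
  by (simp add: a_minus_def uminus_eq_smult distrib_left smult_closed mult_closed smult_mult_right)

lemma mult_diff_left:
  "\<lbrakk>x \<in> carrier A; y \<in> carrier A; z \<in> carrier A\<rbrakk> \<Longrightarrow> (y \<ominus> z) \<otimes> x = y \<otimes> x \<ominus> z \<otimes> x"
  by (simp add: a_minus_def uminus_eq_smult distrib_right smult_closed mult_closed smult_mult_left)

lemma star_zero [simp]: "star A \<zero> = \<zero>"
  using star_smult[of \<zero> 0] by (simp add: star_closed)

text \<open>The C*-identity and submultiplicativity give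
  \<open>(cnorm A x)\<^sup>2 \<le> cnorm A (star A x) * cnorm A x\<close>; cancel one factor.
  Applied to \<open>star A x\<close> as well, this makes the involution isometric.\<close>

lemma cnorm_le_star: "x \<in> carrier A \<Longrightarrow> cnorm A x \<le> cnorm A (star A x)"
proof -
  assume x: "x \<in> carrier A"
  have "(cnorm A x)\<^sup>2 \<le> cnorm A (star A x) * cnorm A x"
    using cnorm_mult[OF star_closed[OF x] x] by (simp add: cstar_identity x)
  then show ?thesis
    using cnorm_nonneg[OF x] cnorm_nonneg[OF star_closed[OF x]]
    by (cases "cnorm A x = 0") (auto simp: power2_eq_square)
qed

lemma cnorm_star: "x \<in> carrier A \<Longrightarrow> cnorm A (star A x) = cnorm A x"
  using cnorm_le_star[of x] cnorm_le_star[of "star A x"] by (simp add: star_closed star_star)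

text \<open>Testing an element against its own adjoint detects zero, by the C*-identity. Uniqueness
  of multipliers rests on this.\<close>

lemma star_mult_self_eq_zero:
  "\<lbrakk>x \<in> carrier A; star A x \<otimes> x = \<zero>\<rbrakk> \<Longrightarrow> x = \<zero>"
  using cstar_identity[of x] cnorm_eq_0[of x] by simp

lemma mult_star_self_eq_zero:
  "\<lbrakk>x \<in> carrier A; x \<otimes> star A x = \<zero>\<rbrakk> \<Longrightarrow> x = \<zero>"
  using star_mult_self_eq_zero[of "star A x"] by (metis star_closed star_star star_zero)

lemma cnorm_finsum:
  "\<lbrakk>finite I; f \<in> I \<rightarrow> carrier A\<rbrakk> \<Longrightarrow> cnorm A (\<Oplus>i\<in>I. f i) \<le> (\<Sum>i\<in>I. cnorm A (f i))"
proof (induction I rule: finite_induct)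
  case (insert i I)
  then have "cnorm A (f i \<oplus> (\<Oplus>i\<in>I. f i)) \<le> cnorm A (f i) + cnorm A (\<Oplus>i\<in>I. f i)"
    by (intro cnorm_add finsum_closed) auto
  with insert show ?case by (simp add: finsum_insert Pi_iff)
qed (simp add: finsum_empty)

lemma finsum_diff:
  "\<lbrakk>finite I; f \<in> I \<rightarrow> carrier A; g \<in> I \<rightarrow> carrier A\<rbrakk>
    \<Longrightarrow> (\<Oplus>i\<in>I. f i) \<ominus> (\<Oplus>i\<in>I. g i) = (\<Oplus>i\<in>I. f i \<ominus> g i)"
proof (induction I rule: finite_induct)
  case (insert i I)
  then show ?case by (simp add: finsum_insert Pi_iff add_diff_add finsum_closed)
qed (simp add: finsum_empty)

lemma finsum_smult_left:
  "\<lbrakk>finite I; x \<in> carrier A\<rbrakk> \<Longrightarrow> (\<Oplus>i\<in>I. c i \<odot> x) = (\<Sum>i\<in>I. c i) \<odot> x"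
  by (induction I rule: finite_induct) (simp_all add: finsum_insert finsum_empty smult_closed smult_add_left)

sublocale metric: Metric_space "carrier A" "cdist A"
proof
  fix x y z
  show "0 \<le> cdist A x y" by (simp add: cdist_def cnorm_nonneg)
  show "cdist A x y = cdist A y x" by (simp add: cdist_def cnorm_diff_commute)
  show "cdist A x y = 0 \<longleftrightarrow> x = y" if "x \<in> carrier A" "y \<in> carrier A"
    using that diff_eq_zero by (auto simp: cdist_def cnorm_eq_0)
  show "cdist A x z \<le> cdist A x y + cdist A y z"
    if "x \<in> carrier A" "y \<in> carrier A" "z \<in> carrier A"
    using that by (simp add: cdist_def cnorm_triangle)
qed

lemma topspace_norm_topology [simp]: "topspace (norm_topology A) = carrier A"
  by (simp add: norm_topology_def)

lemma openin_norm_topology: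
  "openin (norm_topology A) U \<longleftrightarrow>
    U \<subseteq> carrier A \<and> (\<forall>x\<in>U. \<exists>r>0. \<forall>y\<in>carrier A. cnorm A (y \<ominus> x) < r \<longrightarrow> y \<in> U)"
proof -
  have "metric.mball x r \<subseteq> U \<longleftrightarrow> (\<forall>y\<in>carrier A. cnorm A (y \<ominus> x) < r \<longrightarrow> y \<in> U)"
    if "x \<in> carrier A" for x r
    using that by (auto simp: metric.mball_def cdist_def cnorm_diff_commute)
  then show ?thesis
    unfolding norm_topology_def metric.openin_mtopology by blast
qed

end

subsection \<open>Integrals of simple functions\<close>

context cstar_algebra
begin

text \<open>Applying \<open>v\<close> may merge level sets of \<open>k\<close>, while
  \<open>csimple_integral\<close> sums over distinct values. Additivity of the measure reconciles
  the two sums. With \<open>k\<close> a pair of simple functions this is the common refinement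
  behind additivity of the integral.\<close>

lemma csimple_comp:
  assumes fin: "finite (k ` space M)"
    and lev: "\<And>z. z \<in> k ` space M \<Longrightarrow> {t \<in> space M. k t = z} \<in> sets M"
    and v: "v \<in> k ` space M \<rightarrow> carrier A"
    and supp: "emeasure M {t \<in> space M. v (k t) \<noteq> \<zero>} \<noteq> \<infinity>"
  shows "csimple A M (\<lambda>t. v (k t))"
    and "csimple_integral A M (\<lambda>t. v (k t)) =
      (\<Oplus>z\<in>k ` space M. complex_of_real (measure M {t \<in> space M. k t = z}) \<odot> v z)"
proof -
  let ?Z = "k ` space M"
  have vl: "{t \<in> space M. v (k t) = y} = (\<Union>z\<in>{z \<in> ?Z. v z = y}. {t \<in> space M. k t = z})" for y
    by auto
  have vm: "{t \<in> space M. v (k t) = y} \<in> sets M" for y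
    unfolding vl using fin lev by (intro sets.finite_UN) auto
  show "csimple A M (\<lambda>t. v (k t))"
    using fin v supp vm unfolding csimple_def
    by (auto simp: image_image[of v k, symmetric] Pi_iff)
  \<comment> \<open>Nonzero \<open>y\<close> only: the level set of \<open>\<zero>\<close> may have
    infinite measure, where \<open>measure\<close> is not additive. That value contributes nothing
    to either sum.\<close>
  have meas: "measure M {t \<in> space M. v (k t) = y} =
      (\<Sum>z\<in>{z \<in> ?Z. v z = y}. measure M {t \<in> space M. k t = z})" if "y \<noteq> \<zero>" for y
  proof -
    have sm: "{t \<in> space M. v (k t) \<noteq> \<zero>} \<in> sets M"
    proof -
      have "{t \<in> space M. v (k t) \<noteq> \<zero>} = space M - {t \<in> space M. v (k t) = \<zero>}" by auto
      then show ?thesis using vm by simp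
    qed
    have "emeasure M {t \<in> space M. k t = z} \<noteq> \<infinity>" if "z \<in> ?Z" "v z = y" for z
    proof -
      have "emeasure M {t \<in> space M. k t = z} \<le> emeasure M {t \<in> space M. v (k t) \<noteq> \<zero>}"
        using that \<open>y \<noteq> \<zero>\<close> by (intro emeasure_mono sm) auto
      then show ?thesis using supp by (auto simp: top_unique)
    qed
    then show ?thesis unfolding vl
      using fin lev by (intro measure_finite_Union) (auto simp: disjoint_family_on_def)
  qed
  have "(\<Oplus>z\<in>?Z. complex_of_real (measure M {t \<in> space M. k t = z}) \<odot> v z) =
      (\<Oplus>z\<in>(\<Union>y\<in>v ` ?Z. {z \<in> ?Z. v z = y}). complex_of_real (measure M {t \<in> space M. k t = z}) \<odot> v z)"
    by (rule arg_cong2[where f="finsum A"]) auto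
  also have "\<dots> = (\<Oplus>y\<in>v ` ?Z. \<Oplus>z\<in>{z \<in> ?Z. v z = y}. complex_of_real (measure M {t \<in> space M. k t = z}) \<odot> v z)"
    using fin v by (intro add.finprod_UN_disjoint) (auto simp: pairwise_def disjnt_def intro!: smult_closed)
  also have "\<dots> = (\<Oplus>y\<in>v ` ?Z. complex_of_real (measure M {t \<in> space M. v (k t) = y}) \<odot> y)"
  proof (intro finsum_cong' refl)
    fix y assume y: "y \<in> v ` ?Z"
    then have yc: "y \<in> carrier A" using v by auto
    have "(\<Oplus>z\<in>{z \<in> ?Z. v z = y}. complex_of_real (measure M {t \<in> space M. k t = z}) \<odot> v z) =
        (\<Oplus>z\<in>{z \<in> ?Z. v z = y}. complex_of_real (measure M {t \<in> space M. k t = z}) \<odot> y)"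
      using yc by (intro finsum_cong' refl) (auto intro!: smult_closed)
    also have "\<dots> = (\<Sum>z\<in>{z \<in> ?Z. v z = y}. complex_of_real (measure M {t \<in> space M. k t = z})) \<odot> y"
      using fin yc by (intro finsum_smult_left) auto
    also have "\<dots> = complex_of_real (measure M {t \<in> space M. v (k t) = y}) \<odot> y"
      using yc meas[of y] by (cases "y = \<zero>") simp_all
    finally show "(\<Oplus>z\<in>{z \<in> ?Z. v z = y}. complex_of_real (measure M {t \<in> space M. k t = z}) \<odot> v z) =
      complex_of_real (measure M {t \<in> space M. v (k t) = y}) \<odot> y" .
  qed (use v in \<open>auto intro!: smult_closed\<close>)
  finally show "csimple_integral A M (\<lambda>t. v (k t)) =
      (\<Oplus>z\<in>?Z. complex_of_real (measure M {t \<in> space M. k t = z}) \<odot> v z)"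
    unfolding csimple_integral_def by (simp add: image_image)
qed

lemma csimple_supp_sets: "csimple A M h \<Longrightarrow> {t \<in> space M. h t \<noteq> \<zero>} \<in> sets M"
proof -
  assume "csimple A M h"
  then have "{t \<in> space M. h t = \<zero>} \<in> sets M" by (simp add: csimple_def)
  moreover have "{t \<in> space M. h t \<noteq> \<zero>} = space M - {t \<in> space M. h t = \<zero>}" by auto
  ultimately show ?thesis by simp
qed

lemma csimple_integral_closed: "csimple A M h \<Longrightarrow> csimple_integral A M h \<in> carrier A"
  unfolding csimple_def csimple_integral_def by (intro finsum_closed) (auto intro!: smult_closed)

lemma csimple_add:
  assumes f: "csimple A M f" and g: "csimple A M g"
  shows "csimple A M (\<lambda>t. f t \<oplus> g t)"
    and "csimple_integral A M (\<lambda>t. f t \<oplus> g t) = csimple_integral A M f \<oplus> csimple_integral A M g"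
proof -
  \<comment> \<open>Both functions and their sum are functions of the pair, so
    \<open>csimple_comp\<close> evaluates all three integrals over the same level sets.\<close>
  define k where "k t = (f t, g t)" for t
  have fin: "finite (k ` space M)"
    using f g by (intro finite_subset[of "k ` space M" "f ` space M \<times> g ` space M"])
      (auto simp: k_def csimple_def)
  have lev: "{t \<in> space M. k t = z} \<in> sets M" if "z \<in> k ` space M" for z
  proof -
    have "{t \<in> space M. k t = z} = {t \<in> space M. f t = fst z} \<inter> {t \<in> space M. g t = snd z}"
      by (auto simp: k_def)
    then show ?thesis using f g that by (auto simp: csimple_def k_def Pi_iff intro!: sets.Int)
  qed
  have c: "fst \<in> k ` space M \<rightarrow> carrier A" "snd \<in> k ` space M \<rightarrow> carrier A"
    using f g by (auto simp: csimple_def k_def)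
  have s: "emeasure M {t \<in> space M. fst (k t) \<noteq> \<zero>} \<noteq> \<infinity>" "emeasure M {t \<in> space M. snd (k t) \<noteq> \<zero>} \<noteq> \<infinity>"
    using f g by (auto simp: csimple_def k_def)
  have "emeasure M {t \<in> space M. f t \<oplus> g t \<noteq> \<zero>} \<le>
      emeasure M ({t \<in> space M. f t \<noteq> \<zero>} \<union> {t \<in> space M. g t \<noteq> \<zero>})"
    using f g by (intro emeasure_mono sets.Un csimple_supp_sets) auto
  also have "\<dots> \<le> emeasure M {t \<in> space M. f t \<noteq> \<zero>} + emeasure M {t \<in> space M. g t \<noteq> \<zero>}"
    using f g by (intro emeasure_subadditive csimple_supp_sets)
  also have "\<dots> < \<infinity>"
    using f g by (auto simp: csimple_def top.not_eq_extremum)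
  finally have sa: "emeasure M {t \<in> space M. fst (k t) \<oplus> snd (k t) \<noteq> \<zero>} \<noteq> \<infinity>"
    by (simp add: k_def)
  have ca: "(\<lambda>z. fst z \<oplus> snd z) \<in> k ` space M \<rightarrow> carrier A" using c by (auto simp: Pi_iff)
  note K = csimple_comp[OF fin lev]
  show "csimple A M (\<lambda>t. f t \<oplus> g t)"
    using K(1)[where v="\<lambda>z. fst z \<oplus> snd z"] ca sa by (simp add: k_def)
  have "csimple_integral A M (\<lambda>t. f t \<oplus> g t) =
      (\<Oplus>z\<in>k ` space M. complex_of_real (measure M {t \<in> space M. k t = z}) \<odot> (fst z \<oplus> snd z))"
    using K(2)[where v="\<lambda>z. fst z \<oplus> snd z"] ca sa by (simp add: k_def)
  also have "\<dots> = (\<Oplus>z\<in>k ` space M. complex_of_real (measure M {t \<in> space M. k t = z}) \<odot> fst z \<oplus>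
      complex_of_real (measure M {t \<in> space M. k t = z}) \<odot> snd z)"
    using c by (intro finsum_cong' refl) (auto simp: Pi_iff smult_add_right intro!: smult_closed)
  also have "\<dots> = (\<Oplus>z\<in>k ` space M. complex_of_real (measure M {t \<in> space M. k t = z}) \<odot> fst z) \<oplus>
      (\<Oplus>z\<in>k ` space M. complex_of_real (measure M {t \<in> space M. k t = z}) \<odot> snd z)"
    using c by (intro finsum_addf) (auto simp: Pi_iff intro!: smult_closed)
  also have "\<dots> = csimple_integral A M f \<oplus> csimple_integral A M g"
    using K(2)[where v=fst] K(2)[where v=snd] c s by (simp add: k_def)
  finally show "csimple_integral A M (\<lambda>t. f t \<oplus> g t) = csimple_integral A M f \<oplus> csimple_integral A M g" .
qed

text \<open>Weighting the indicators of the level sets by \<open>cnorm A y\<close> reproduces the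
  norm function of \<open>h\<close>, whose integral dominates the norm of the integral by the
  triangle inequality.\<close>

lemma cnorm_csimple_integral:
  assumes h: "csimple A M h" and \<psi>: "integrable M \<psi>"
    and le: "\<And>t. t \<in> space M \<Longrightarrow> cnorm A (h t) \<le> \<psi> t"
  shows "cnorm A (csimple_integral A M h) \<le> (\<integral>t. \<psi> t \<partial>M)"
proof -
  let ?Y = "h ` space M" and ?E = "\<lambda>y. {t \<in> space M. h t = y}"
  have fin: "finite ?Y" and car: "y \<in> ?Y \<Longrightarrow> y \<in> carrier A" and lev: "y \<in> ?Y \<Longrightarrow> ?E y \<in> sets M" for y
    using h by (auto simp: csimple_def)
  \<comment> \<open>Level sets of nonzero values have finite measure; for \<open>\<zero>\<close> the
    function vanishes identically, whatever the measure of its level set.\<close>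
  have int: "integrable M (\<lambda>t. cnorm A y * indicator (?E y) t)" if y: "y \<in> ?Y" for y
  proof (cases "y = \<zero>")
    case False
    have "emeasure M (?E y) \<le> emeasure M {t \<in> space M. h t \<noteq> \<zero>}"
      using False by (intro emeasure_mono csimple_supp_sets[OF h]) auto
    also have "\<dots> < \<infinity>" using h by (auto simp: csimple_def top.not_eq_extremum)
    finally show ?thesis using lev[OF y]
      by (intro integrable_mult_right) (auto simp: integrable_indicator_iff)
  qed simp
  have "cnorm A (csimple_integral A M h) \<le> (\<Sum>y\<in>?Y. cnorm A (complex_of_real (measure M (?E y)) \<odot> y))"
    unfolding csimple_integral_def using fin car by (intro cnorm_finsum) (auto intro!: smult_closed)
  also have "\<dots> = (\<Sum>y\<in>?Y. \<integral>t. cnorm A y * indicator (?E y) t \<partial>M)"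
    using car lev by (intro sum.cong refl) (auto simp: cnorm_smult sets.Int_space_eq2 mult.commute)
  also have "\<dots> = (\<integral>t. (\<Sum>y\<in>?Y. cnorm A y * indicator (?E y) t) \<partial>M)"
    using int by (intro Bochner_Integration.integral_sum[symmetric])
  also have "\<dots> \<le> (\<integral>t. \<psi> t \<partial>M)"
  proof (intro integral_mono Bochner_Integration.integrable_sum int \<psi>)
    fix t assume t: "t \<in> space M"
    have "(\<Sum>y\<in>?Y. cnorm A y * indicator (?E y) t) = (\<Sum>y\<in>?Y. if y = h t then cnorm A y else 0)"
      using t by (intro sum.cong) (auto simp: indicator_def)
    then show "(\<Sum>y\<in>?Y. cnorm A y * indicator (?E y) t) \<le> \<psi> t"
      using fin t le[OF t] by (simp add: sum.delta)
  qed
  finally show ?thesis .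
qed

end

section \<open>Linear maps between C*-algebras and integrals of simple functions\<close>

definition cstar_linear :: "'a cstar_struct \<Rightarrow> 'b cstar_struct \<Rightarrow> ('a \<Rightarrow> 'b) \<Rightarrow> bool" where
  "cstar_linear A B T \<longleftrightarrow> T \<in> carrier A \<rightarrow> carrier B \<and>
     (\<forall>x\<in>carrier A. \<forall>y\<in>carrier A. T (x \<oplus>\<^bsub>A\<^esub> y) = T x \<oplus>\<^bsub>B\<^esub> T y) \<and>
     (\<forall>x\<in>carrier A. \<forall>k. T (k \<odot>\<^bsub>A\<^esub> x) = k \<odot>\<^bsub>B\<^esub> T x)"

lemma
  assumes A: "cstar_algebra A" and B: "cstar_algebra B" and T: "cstar_linear A B T"
  shows cstar_linear_zero: "T \<zero>\<^bsub>A\<^esub> = \<zero>\<^bsub>B\<^esub>"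
    and cstar_linear_diff:
      "\<lbrakk>x \<in> carrier A; y \<in> carrier A\<rbrakk> \<Longrightarrow> T (x \<ominus>\<^bsub>A\<^esub> y) = T x \<ominus>\<^bsub>B\<^esub> T y"
    and cstar_linear_finsum:
      "\<lbrakk>finite I; f \<in> I \<rightarrow> carrier A\<rbrakk> \<Longrightarrow> T (\<Oplus>\<^bsub>A\<^esub>i\<in>I. f i) = (\<Oplus>\<^bsub>B\<^esub>i\<in>I. T (f i))"
proof -
  interpret A: cstar_algebra A by fact
  interpret B: cstar_algebra B by fact
  note Tl = T[unfolded cstar_linear_def]
  have "T (0 \<odot>\<^bsub>A\<^esub> \<zero>\<^bsub>A\<^esub>) = 0 \<odot>\<^bsub>B\<^esub> T \<zero>\<^bsub>A\<^esub>" using Tl by blast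
  then show z: "T \<zero>\<^bsub>A\<^esub> = \<zero>\<^bsub>B\<^esub>" using Tl by (simp add: Pi_iff)
  show "T (x \<ominus>\<^bsub>A\<^esub> y) = T x \<ominus>\<^bsub>B\<^esub> T y" if "x \<in> carrier A" "y \<in> carrier A"
    using that Tl by (auto simp: a_minus_def A.uminus_eq_smult B.uminus_eq_smult A.smult_closed Pi_iff)
  show "T (\<Oplus>\<^bsub>A\<^esub>i\<in>I. f i) = (\<Oplus>\<^bsub>B\<^esub>i\<in>I. T (f i))" if "finite I" "f \<in> I \<rightarrow> carrier A"
    using that
  proof (induction I rule: finite_induct)
    case (insert i I)
    then have "(\<Oplus>\<^bsub>A\<^esub>i\<in>I. f i) \<in> carrier A" by (intro A.finsum_closed) auto
    moreover have "(\<lambda>i. T (f i)) \<in> I \<rightarrow> carrier B" "T (f i) \<in> carrier B"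
      using insert Tl by auto
    ultimately show ?case using insert Tl by (simp add: A.finsum_insert B.finsum_insert Pi_iff)
  qed (simp add: A.finsum_empty B.finsum_empty z)
qed

text \<open>\<open>T\<close> may identify several values of \<open>h\<close>;
  \<open>csimple_comp\<close> therefore works with the level sets of \<open>h\<close> instead of
  those of the image function.\<close>

lemma csimple_linear:
  assumes A: "cstar_algebra A" and B: "cstar_algebra B" and T: "cstar_linear A B T" and h: "csimple A M h"
  shows "csimple B M (\<lambda>t. T (h t))"
    and "csimple_integral B M (\<lambda>t. T (h t)) = T (csimple_integral A M h)"
proof -
  interpret A: cstar_algebra A by fact
  interpret B: cstar_algebra B by fact
  note Tl = T[unfolded cstar_linear_def]
  have fin: "finite (h ` space M)" and car: "h \<in> space M \<rightarrow> carrier A"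
    and lev: "y \<in> h ` space M \<Longrightarrow> {t \<in> space M. h t = y} \<in> sets M" for y
    using h by (auto simp: csimple_def)
  have Tc: "T \<in> h ` space M \<rightarrow> carrier B" using car Tl by auto
  have "emeasure M {t \<in> space M. T (h t) \<noteq> \<zero>\<^bsub>B\<^esub>} \<le> emeasure M {t \<in> space M. h t \<noteq> \<zero>\<^bsub>A\<^esub>}"
    using cstar_linear_zero[OF A B T] by (intro emeasure_mono A.csimple_supp_sets[OF h]) auto
  also have "\<dots> < \<infinity>" using h by (auto simp: csimple_def top.not_eq_extremum)
  finally have s: "emeasure M {t \<in> space M. T (h t) \<noteq> \<zero>\<^bsub>B\<^esub>} \<noteq> \<infinity>" by simp
  show "csimple B M (\<lambda>t. T (h t))" by (rule B.csimple_comp(1)[OF fin lev Tc s])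
  have "csimple_integral B M (\<lambda>t. T (h t)) =
      (\<Oplus>\<^bsub>B\<^esub>z\<in>h ` space M. complex_of_real (measure M {t \<in> space M. h t = z}) \<odot>\<^bsub>B\<^esub> T z)"
    by (rule B.csimple_comp(2)[OF fin lev Tc s])
  also have "\<dots> = (\<Oplus>\<^bsub>B\<^esub>z\<in>h ` space M. T (complex_of_real (measure M {t \<in> space M. h t = z}) \<odot>\<^bsub>A\<^esub> z))"
    using Tl car Tc by (intro B.finsum_cong' refl) (auto simp: Pi_iff A.smult_closed B.smult_closed)
  also have "\<dots> = T (csimple_integral A M h)"
    unfolding csimple_integral_def using fin car
    by (intro cstar_linear_finsum[OF A B T, symmetric]) (auto simp: Pi_iff A.smult_closed)
  finally show "csimple_integral B M (\<lambda>t. T (h t)) = T (csimple_integral A M h)" .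
qed

subsection \<open>Integrals with an integrable error bound\<close>

text \<open>Unlike in \<^const>\<open>has_cstar_integral\<close>, the integrand need not be measurable: the approximation
  error is controlled by an integrable majorant. Sums and limits are thus available without separability
  of \<open>A\<close>, where measurable functions need not be closed under addition.\<close>

definition has_dominated_integral ::
  "'a cstar_struct \<Rightarrow> 'g measure \<Rightarrow> ('g \<Rightarrow> 'a) \<Rightarrow> 'a \<Rightarrow> bool" where
  "has_dominated_integral A M f x \<longleftrightarrow> f \<in> space M \<rightarrow> carrier A \<and> x \<in> carrier A \<and>
     (\<forall>\<epsilon>>0. \<exists>h \<psi>. csimple A M h \<and> integrable M \<psi> \<and>
        (\<forall>t\<in>space M. cnorm A (f t \<ominus>\<^bsub>A\<^esub> h t) \<le> \<psi> t) \<and>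
        (\<integral>t. \<psi> t \<partial>M) < \<epsilon> \<and> cnorm A (csimple_integral A M h \<ominus>\<^bsub>A\<^esub> x) < \<epsilon>)"

lemma has_dominated_integralE:
  assumes "has_dominated_integral A M f x" "0 < (\<epsilon>::real)"
  obtains h \<psi> where "csimple A M h" "integrable M \<psi>"
    "\<And>t. t \<in> space M \<Longrightarrow> cnorm A (f t \<ominus>\<^bsub>A\<^esub> h t) \<le> \<psi> t" "(\<integral>t. \<psi> t \<partial>M) < \<epsilon>"
    "cnorm A (csimple_integral A M h \<ominus>\<^bsub>A\<^esub> x) < \<epsilon>"
  using assms unfolding has_dominated_integral_def by blast

lemma has_dominated_integral_cong:
  assumes "\<And>t. t \<in> space M \<Longrightarrow> f t = g t"
  shows "has_dominated_integral A M f x \<longleftrightarrow> has_dominated_integral A M g x"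
  using assms unfolding has_dominated_integral_def by (simp add: Pi_iff cong: conj_cong)

context cstar_algebra
begin

lemma has_dominated_integral_add:
  assumes f: "has_dominated_integral A M f x" and g: "has_dominated_integral A M g y"
  shows "has_dominated_integral A M (\<lambda>t. f t \<oplus> g t) (x \<oplus> y)"
  unfolding has_dominated_integral_def
proof (intro conjI allI impI)
  have c: "f \<in> space M \<rightarrow> carrier A" "x \<in> carrier A" "g \<in> space M \<rightarrow> carrier A" "y \<in> carrier A"
    using f g by (auto simp: has_dominated_integral_def)
  then show "(\<lambda>t. f t \<oplus> g t) \<in> space M \<rightarrow> carrier A" "x \<oplus> y \<in> carrier A" by auto
  fix \<epsilon> :: real assume "0 < \<epsilon>"
  then have e: "0 < \<epsilon> / 2" by simp
  obtain h \<psi> where h: "csimple A M h" "integrable M \<psi>"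
    "\<And>t. t \<in> space M \<Longrightarrow> cnorm A (f t \<ominus> h t) \<le> \<psi> t" "(\<integral>t. \<psi> t \<partial>M) < \<epsilon> / 2"
    "cnorm A (csimple_integral A M h \<ominus> x) < \<epsilon> / 2"
    using has_dominated_integralE[OF f e] by blast
  obtain k \<phi> where k: "csimple A M k" "integrable M \<phi>"
    "\<And>t. t \<in> space M \<Longrightarrow> cnorm A (g t \<ominus> k t) \<le> \<phi> t" "(\<integral>t. \<phi> t \<partial>M) < \<epsilon> / 2"
    "cnorm A (csimple_integral A M k \<ominus> y) < \<epsilon> / 2"
    using has_dominated_integralE[OF g e] by blast
  have hk: "h \<in> space M \<rightarrow> carrier A" "k \<in> space M \<rightarrow> carrier A"
    using h(1) k(1) by (auto simp: csimple_def)
  note ic = csimple_integral_closed[OF h(1)] csimple_integral_closed[OF k(1)]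
  have "cnorm A ((f t \<oplus> g t) \<ominus> (h t \<oplus> k t)) \<le> \<psi> t + \<phi> t" if t: "t \<in> space M" for t
  proof -
    have tc: "f t \<in> carrier A" "g t \<in> carrier A" "h t \<in> carrier A" "k t \<in> carrier A"
      using c hk t by auto
    then have "cnorm A ((f t \<ominus> h t) \<oplus> (g t \<ominus> k t)) \<le> \<psi> t + \<phi> t"
      using cnorm_add[of "f t \<ominus> h t" "g t \<ominus> k t"] h(3)[OF t] k(3)[OF t] by simp
    then show ?thesis using tc by (simp add: add_diff_add)
  qed
  moreover have "cnorm A (csimple_integral A M (\<lambda>t. h t \<oplus> k t) \<ominus> (x \<oplus> y)) < \<epsilon>"
  proof -
    have "cnorm A ((csimple_integral A M h \<ominus> x) \<oplus> (csimple_integral A M k \<ominus> y)) < \<epsilon>"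
      using cnorm_add[of "csimple_integral A M h \<ominus> x" "csimple_integral A M k \<ominus> y"] h(5) k(5) c ic
      by simp
    then show ?thesis using c ic by (simp add: csimple_add(2)[OF h(1) k(1)] add_diff_add)
  qed
  ultimately show "\<exists>h \<psi>. csimple A M h \<and> integrable M \<psi> \<and>
        (\<forall>t\<in>space M. cnorm A ((f t \<oplus> g t) \<ominus> h t) \<le> \<psi> t) \<and>
        (\<integral>t. \<psi> t \<partial>M) < \<epsilon> \<and> cnorm A (csimple_integral A M h \<ominus> (x \<oplus> y)) < \<epsilon>"
    using csimple_add(1)[OF h(1) k(1)] h k
    by (intro exI[of _ "\<lambda>t. h t \<oplus> k t"] exI[of _ "\<lambda>t. \<psi> t + \<phi> t"]) auto
qed

text \<open>An approximant \<open>h\<close> is dominated by its error against \<open>f\<close> plus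
  \<open>\<psi>\<close>, so the bound for simple functions passes to the limit. The majorant
  \<open>\<psi>\<close> stands in for the norm function of \<open>f\<close>, about whose
  measurability nothing is known.\<close>

lemma cnorm_dominated_integral:
  assumes f: "has_dominated_integral A M f x" and \<psi>: "integrable M \<psi>"
    and le: "\<And>t. t \<in> space M \<Longrightarrow> cnorm A (f t) \<le> \<psi> t"
  shows "cnorm A x \<le> (\<integral>t. \<psi> t \<partial>M)"
proof (rule field_le_epsilon)
  fix e :: real assume "0 < e"
  then have e: "0 < e / 2" by simp
  have c: "f \<in> space M \<rightarrow> carrier A" "x \<in> carrier A"
    using f by (auto simp: has_dominated_integral_def)
  obtain h \<phi> where h: "csimple A M h" "integrable M \<phi>"
    "\<And>t. t \<in> space M \<Longrightarrow> cnorm A (f t \<ominus> h t) \<le> \<phi> t" "(\<integral>t. \<phi> t \<partial>M) < e / 2"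
    "cnorm A (csimple_integral A M h \<ominus> x) < e / 2"
    using has_dominated_integralE[OF f e] by blast
  have "cnorm A (csimple_integral A M h) \<le> (\<integral>t. \<phi> t + \<psi> t \<partial>M)"
  proof (intro cnorm_csimple_integral h \<psi> Bochner_Integration.integrable_add)
    fix t assume t: "t \<in> space M"
    have tc: "f t \<in> carrier A" "h t \<in> carrier A"
      using c h(1) t by (auto simp: csimple_def)
    show "cnorm A (h t) \<le> \<phi> t + \<psi> t"
      using cnorm_le_diff[of "h t" "f t"] h(3)[OF t] le[OF t] cnorm_diff_commute tc by fastforce
  qed
  moreover have "cnorm A x \<le> cnorm A (csimple_integral A M h \<ominus> x) + cnorm A (csimple_integral A M h)"
    using cnorm_le_diff[of x "csimple_integral A M h"] csimple_integral_closed[OF h(1)] c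
    by (simp add: cnorm_diff_commute)
  ultimately show "cnorm A x \<le> (\<integral>t. \<psi> t \<partial>M) + e"
    using h \<psi> by simp
qed

end

lemma has_dominated_integral_linear:
  assumes A: "cstar_algebra A" and B: "cstar_algebra B" and T: "cstar_linear A B T"
    and bd: "\<And>x. x \<in> carrier A \<Longrightarrow> cnorm B (T x) \<le> C * cnorm A x"
    and f: "has_dominated_integral A M f x"
  shows "has_dominated_integral B M (\<lambda>t. T (f t)) (T x)"
  unfolding has_dominated_integral_def
proof (intro conjI allI impI)
  interpret A: cstar_algebra A by fact
  interpret B: cstar_algebra B by fact
  note Tl = T[unfolded cstar_linear_def]
  have c: "f \<in> space M \<rightarrow> carrier A" "x \<in> carrier A"
    using f by (auto simp: has_dominated_integral_def)
  then show "(\<lambda>t. T (f t)) \<in> space M \<rightarrow> carrier B" "T x \<in> carrier B" using Tl by auto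
  fix \<epsilon> :: real assume \<epsilon>: "0 < \<epsilon>"
  \<comment> \<open>A given \<open>C\<close> may be zero or negative; \<open>D\<close> can be
    divided by.\<close>
  define D where "D = max C 1"
  have D: "D \<ge> 1" "C \<le> D" by (auto simp: D_def)
  then have e: "0 < \<epsilon> / D" using \<epsilon> by simp
  have bd': "cnorm B (T x \<ominus>\<^bsub>B\<^esub> T y) \<le> D * cnorm A (x \<ominus>\<^bsub>A\<^esub> y)" if "x \<in> carrier A" "y \<in> carrier A" for x y
  proof -
    have "C * cnorm A (x \<ominus>\<^bsub>A\<^esub> y) \<le> D * cnorm A (x \<ominus>\<^bsub>A\<^esub> y)"
      using D that by (intro mult_right_mono A.cnorm_nonneg) auto
    then show ?thesis
      using bd[of "x \<ominus>\<^bsub>A\<^esub> y"] that by (simp add: cstar_linear_diff[OF A B T])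
  qed
  obtain h \<psi> where h: "csimple A M h" "integrable M \<psi>"
    "\<And>t. t \<in> space M \<Longrightarrow> cnorm A (f t \<ominus>\<^bsub>A\<^esub> h t) \<le> \<psi> t" "(\<integral>t. \<psi> t \<partial>M) < \<epsilon> / D"
    "cnorm A (csimple_integral A M h \<ominus>\<^bsub>A\<^esub> x) < \<epsilon> / D"
    using has_dominated_integralE[OF f e] by blast
  note hT = csimple_linear[OF A B T h(1)]
  have "cnorm B (T (f t) \<ominus>\<^bsub>B\<^esub> T (h t)) \<le> D * \<psi> t" if t: "t \<in> space M" for t
  proof -
    have "f t \<in> carrier A" "h t \<in> carrier A"
      using c h(1) t by (auto simp: csimple_def)
    from order_trans[OF bd'[OF this] mult_left_mono[OF h(3)[OF t], of D]] show ?thesis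
      using D by simp
  qed
  moreover have "(\<integral>t. D * \<psi> t \<partial>M) < \<epsilon>"
    using h(4) D by (simp add: field_simps)
  moreover have "cnorm B (T (csimple_integral A M h) \<ominus>\<^bsub>B\<^esub> T x) < \<epsilon>"
  proof -
    have "D * cnorm A (csimple_integral A M h \<ominus>\<^bsub>A\<^esub> x) < \<epsilon>" using h(5) D by (simp add: field_simps)
    then show ?thesis using bd'[OF A.csimple_integral_closed[OF h(1)] c(2)] by simp
  qed
  ultimately show "\<exists>h \<psi>. csimple B M h \<and> integrable M \<psi> \<and>
        (\<forall>t\<in>space M. cnorm B (T (f t) \<ominus>\<^bsub>B\<^esub> h t) \<le> \<psi> t) \<and>
        (\<integral>t. \<psi> t \<partial>M) < \<epsilon> \<and> cnorm B (csimple_integral B M h \<ominus>\<^bsub>B\<^esub> T x) < \<epsilon>"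
    using hT h(2) by (intro exI[of _ "\<lambda>t. T (h t)"] exI[of _ "\<lambda>t. D * \<psi> t"]) auto
qed

context cstar_algebra
begin

lemma has_dominated_integral_zero: "has_dominated_integral A M (\<lambda>t. \<zero>) \<zero>"
proof -
  have s: "csimple A M (\<lambda>t. \<zero>)"
    by (cases "space M = {}") (auto simp: csimple_def image_constant_conv)
  have "csimple_integral A M (\<lambda>t. \<zero>) = \<zero>"
    using cnorm_csimple_integral[OF s, of "\<lambda>t. 0"] cnorm_eq_0[OF csimple_integral_closed[OF s]]
      cnorm_nonneg[OF csimple_integral_closed[OF s]] by simp
  then show ?thesis
    using s unfolding has_dominated_integral_def
    by (auto intro!: exI[of _ "\<lambda>t. \<zero>"] exI[of _ "\<lambda>t. 0"])
qed

lemma has_dominated_integral_diff: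
  assumes f: "has_dominated_integral A M f x" and g: "has_dominated_integral A M g y"
  shows "has_dominated_integral A M (\<lambda>t. f t \<ominus> g t) (x \<ominus> y)"
proof -
  have A: "cstar_algebra A" by unfold_locales
  have T: "cstar_linear A A (\<lambda>x. \<ominus> x)"
    by (auto simp: cstar_linear_def uminus_eq_smult smult_closed smult_add_right simp flip: smult_smult)
  have "has_dominated_integral A M (\<lambda>t. \<ominus> g t) (\<ominus> y)"
    by (rule has_dominated_integral_linear[OF A A T _ g, of 1]) simp
  from has_dominated_integral_add[OF f this] show ?thesis by (simp add: a_minus_def)
qed

text \<open>The difference of the two values is an integral of \<open>f t \<ominus> f t\<close>,
  which is majorised by 0.\<close>

lemma has_dominated_integral_unique:
  assumes f: "has_dominated_integral A M f x" and g: "has_dominated_integral A M f y"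
  shows "x = y"
proof -
  have c: "f \<in> space M \<rightarrow> carrier A" "x \<in> carrier A" "y \<in> carrier A"
    using f g by (auto simp: has_dominated_integral_def)
  have "cnorm A (x \<ominus> y) \<le> (\<integral>t. 0 \<partial>M)"
    using c by (intro cnorm_dominated_integral[OF has_dominated_integral_diff[OF f g]]) (auto simp: Pi_iff)
  then have "cnorm A (x \<ominus> y) = 0" using cnorm_nonneg[of "x \<ominus> y"] c by simp
  then show ?thesis using c cnorm_eq_0 diff_eq_zero by simp
qed

lemma has_dominated_integral_finsum:
  assumes "finite I" "\<And>i. i \<in> I \<Longrightarrow> has_dominated_integral A M (f i) (x i)"
  shows "has_dominated_integral A M (\<lambda>t. \<Oplus>i\<in>I. f i t) (\<Oplus>i\<in>I. x i)"
  using assms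
proof (induction I rule: finite_induct)
  case (insert i I)
  have c: "f j \<in> space M \<rightarrow> carrier A" "x j \<in> carrier A" if "j \<in> insert i I" for j
    using insert.prems[OF that] by (auto simp: has_dominated_integral_def)
  have "has_dominated_integral A M (\<lambda>t. f i t \<oplus> (\<Oplus>i\<in>I. f i t)) (x i \<oplus> (\<Oplus>i\<in>I. x i))"
    using insert by (intro has_dominated_integral_add) auto
  moreover have "f i t \<oplus> (\<Oplus>i\<in>I. f i t) = (\<Oplus>i\<in>insert i I. f i t)" if "t \<in> space M" for t
    using insert c that by (intro finsum_insert[symmetric]) (auto simp: Pi_iff)
  moreover have "x i \<oplus> (\<Oplus>i\<in>I. x i) = (\<Oplus>i\<in>insert i I. x i)"
    using insert c by (intro finsum_insert[symmetric]) auto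
  ultimately show ?case by (metis (no_types, lifting) has_dominated_integral_cong)
qed (simp add: finsum_empty has_dominated_integral_zero)

text \<open>Scalar simple functions approximating \<open>\<phi>\<close> become simple functions in
  \<open>A\<close> after multiplication by \<open>y\<close>; errors and integrals scale by
  \<open>cnorm A y\<close>. These are the terms of the Riemann sums.\<close>

lemma has_dominated_integral_smult_const:
  fixes \<phi> :: "'g \<Rightarrow> real"
  assumes \<phi>: "integrable M \<phi>" and y: "y \<in> carrier A"
  shows "has_dominated_integral A M (\<lambda>t. complex_of_real (\<phi> t) \<odot> y) (complex_of_real (\<integral>t. \<phi> t \<partial>M) \<odot> y)"
  unfolding has_dominated_integral_def
proof (intro conjI allI impI)
  show "(\<lambda>t. complex_of_real (\<phi> t) \<odot> y) \<in> space M \<rightarrow> carrier A" "complex_of_real (\<integral>t. \<phi> t \<partial>M) \<odot> y \<in> carrier A"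
    using y by (auto intro: smult_closed)
  fix \<epsilon> :: real assume \<epsilon>: "0 < \<epsilon>"
  \<comment> \<open>The summand 1 keeps the divisor positive when \<open>y\<close> is zero.\<close>
  define D where "D = cnorm A y + 1"
  have D: "D > 0" "cnorm A y \<le> D" using cnorm_nonneg[OF y] by (auto simp: D_def)
  have "has_bochner_integral M \<phi> (\<integral>t. \<phi> t \<partial>M)" using \<phi> by (rule has_bochner_integral_integrable)
  then obtain s where bm: "\<phi> \<in> borel_measurable M"
    and s: "\<And>i. Bochner_Integration.simple_bochner_integrable M (s i)"
    and lim: "(\<lambda>i. \<integral>\<^sup>+ t. ennreal (norm (\<phi> t - s i t)) \<partial>M) \<longlonglongrightarrow> 0"
      "(\<lambda>i. Bochner_Integration.simple_bochner_integral M (s i)) \<longlonglongrightarrow> (\<integral>t. \<phi> t \<partial>M)"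
    by (cases rule: has_bochner_integral.cases) auto
  have e: "0 < \<epsilon> / D" using \<epsilon> D by simp
  have "\<forall>\<^sub>F i in sequentially. (\<integral>\<^sup>+ t. ennreal (norm (\<phi> t - s i t)) \<partial>M) < ennreal (\<epsilon> / D)"
    using order_tendstoD(2)[OF lim(1)] e by simp
  moreover have "\<forall>\<^sub>F i in sequentially. dist (Bochner_Integration.simple_bochner_integral M (s i)) (\<integral>t. \<phi> t \<partial>M) < \<epsilon> / D"
    using tendstoD[OF lim(2) e] .
  ultimately have "\<forall>\<^sub>F i in sequentially. (\<integral>\<^sup>+ t. ennreal (norm (\<phi> t - s i t)) \<partial>M) < ennreal (\<epsilon> / D) \<and>
      dist (Bochner_Integration.simple_bochner_integral M (s i)) (\<integral>t. \<phi> t \<partial>M) < \<epsilon> / D" by eventually_elim simp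
  then obtain i where i: "(\<integral>\<^sup>+ t. ennreal (norm (\<phi> t - s i t)) \<partial>M) < ennreal (\<epsilon> / D)"
      "dist (Bochner_Integration.simple_bochner_integral M (s i)) (\<integral>t. \<phi> t \<partial>M) < \<epsilon> / D"
    using eventually_happens'[OF sequentially_bot] by blast
  note si = s[of i, unfolded Bochner_Integration.simple_bochner_integrable.simps]
  have sfin: "finite (s i ` space M)" and slev: "{t \<in> space M. s i t = z} \<in> sets M" for z
    using si by (auto simp: simple_functionD)
  have smeas: "s i \<in> borel_measurable M" using si by (auto intro: borel_measurable_simple_function)
  let ?v = "\<lambda>z. complex_of_real z \<odot> y"
  have vc: "?v \<in> s i ` space M \<rightarrow> carrier A" using y by (auto intro: smult_closed)
  have "emeasure M {t \<in> space M. ?v (s i t) \<noteq> \<zero>} \<le> emeasure M {t \<in> space M. s i t \<noteq> 0}"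
    using y smeas by (intro emeasure_mono) auto
  also have "\<dots> < \<infinity>" using si by (auto simp: top.not_eq_extremum)
  finally have vs: "emeasure M {t \<in> space M. ?v (s i t) \<noteq> \<zero>} \<noteq> \<infinity>" by simp
  note cs = csimple_comp[OF sfin slev vc vs]
  have "csimple_integral A M (\<lambda>t. ?v (s i t)) = (\<Oplus>z\<in>s i ` space M. complex_of_real (measure M {t \<in> space M. s i t = z} * z) \<odot> y)"
    unfolding cs(2) using y by (intro finsum_cong' refl) (auto simp: smult_smult intro!: smult_closed)
  also have "\<dots> = (\<Sum>z\<in>s i ` space M. complex_of_real (measure M {t \<in> space M. s i t = z} * z)) \<odot> y"
    by (rule finsum_smult_left[OF sfin y])
  also have "(\<Sum>z\<in>s i ` space M. complex_of_real (measure M {t \<in> space M. s i t = z} * z)) =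
      complex_of_real (Bochner_Integration.simple_bochner_integral M (s i))"
    by (simp add: Bochner_Integration.simple_bochner_integral_def)
  finally have ci: "csimple_integral A M (\<lambda>t. ?v (s i t)) = complex_of_real (Bochner_Integration.simple_bochner_integral M (s i)) \<odot> y" .
  have d: "complex_of_real a \<odot> y \<ominus> complex_of_real b \<odot> y = complex_of_real (a - b) \<odot> y" for a b
    using y by (simp add: smult_diff_left)
  have iint: "integrable M (\<lambda>t. norm (\<phi> t - s i t))"
    using i(1) bm smeas by (intro integrableI_bounded) (auto simp: top.extremum_strict less_trans)
  have "ennreal (\<integral>t. norm (\<phi> t - s i t) \<partial>M) < ennreal (\<epsilon> / D)"
    using i(1) iint by (subst nn_integral_eq_integral[symmetric]) auto
  then have "(\<integral>t. norm (\<phi> t - s i t) \<partial>M) < \<epsilon> / D"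
    using e by (simp add: ennreal_less_iff)
  then have "(\<integral>t. D * norm (\<phi> t - s i t) \<partial>M) < \<epsilon>" using D by (simp add: field_simps)
  moreover have "cnorm A (complex_of_real (\<phi> t) \<odot> y \<ominus> ?v (s i t)) \<le> D * norm (\<phi> t - s i t)" for t
    using D y mult_left_mono[OF D(2), of "\<bar>\<phi> t - s i t\<bar>"]
    by (simp add: d cnorm_smult mult.commute del: of_real_diff)
  moreover have "cnorm A (csimple_integral A M (\<lambda>t. ?v (s i t)) \<ominus> complex_of_real (\<integral>t. \<phi> t \<partial>M) \<odot> y) < \<epsilon>"
  proof -
    have "cmod (complex_of_real (Bochner_Integration.simple_bochner_integral M (s i) - (\<integral>t. \<phi> t \<partial>M))) * cnorm A y \<le>
        dist (Bochner_Integration.simple_bochner_integral M (s i)) (\<integral>t. \<phi> t \<partial>M) * D"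
      using D(2) cnorm_nonneg[OF y] by (intro mult_mono) (auto simp: dist_real_def simp del: of_real_diff)
    also have "\<dots> < \<epsilon>" using i(2) D by (simp add: field_simps)
    finally show ?thesis using y by (simp add: ci d cnorm_smult del: of_real_diff)
  qed
  ultimately show "\<exists>h \<psi>. csimple A M h \<and> integrable M \<psi> \<and>
        (\<forall>t\<in>space M. cnorm A (complex_of_real (\<phi> t) \<odot> y \<ominus> h t) \<le> \<psi> t) \<and>
        (\<integral>t. \<psi> t \<partial>M) < \<epsilon> \<and> cnorm A (csimple_integral A M h \<ominus> complex_of_real (\<integral>t. \<phi> t \<partial>M) \<odot> y) < \<epsilon>"
    using cs(1) iint by (intro exI[of _ "\<lambda>t. ?v (s i t)"] exI[of _ "\<lambda>t. D * norm (\<phi> t - s i t)"]) auto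
qed

text \<open>Completeness of \<open>A\<close> enters here. Integrals of two approximants differ by at
  most the sum of their majorant integrals, since both approximants are compared with
  \<open>f\<close>. They form a Cauchy sequence whose limit is the integral.\<close>

lemma has_dominated_integral_limit:
  assumes f: "f \<in> space M \<rightarrow> carrier A"
    and approx: "\<And>\<epsilon>::real. 0 < \<epsilon> \<Longrightarrow> \<exists>g y \<psi>. has_dominated_integral A M g y \<and> integrable M \<psi> \<and>
      (\<forall>t\<in>space M. cnorm A (f t \<ominus> g t) \<le> \<psi> t) \<and> (\<integral>t. \<psi> t \<partial>M) < \<epsilon>"
  shows "\<exists>x. has_dominated_integral A M f x"
proof -
  have "\<forall>n. \<exists>g y \<psi>. has_dominated_integral A M g y \<and> integrable M \<psi> \<and>
      (\<forall>t\<in>space M. cnorm A (f t \<ominus> g t) \<le> \<psi> t) \<and> (\<integral>t. \<psi> t \<partial>M) < 1 / real (Suc n)"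
    using approx by simp
  then obtain g y \<psi> where g: "\<And>n. has_dominated_integral A M (g n) (y n)"
    and \<psi>: "\<And>n. integrable M (\<psi> n)" "\<And>n t. t \<in> space M \<Longrightarrow> cnorm A (f t \<ominus> g n t) \<le> \<psi> n t"
      "\<And>n. (\<integral>t. \<psi> n t \<partial>M) < 1 / real (Suc n)"
    by metis
  have yc: "y n \<in> carrier A" and gc: "t \<in> space M \<Longrightarrow> g n t \<in> carrier A" for n t
    using g[of n] by (auto simp: has_dominated_integral_def)
  have yd: "cnorm A (y n \<ominus> y m) \<le> 1 / real (Suc n) + 1 / real (Suc m)" for n m
  proof -
    have "cnorm A (y n \<ominus> y m) \<le> (\<integral>t. \<psi> n t + \<psi> m t \<partial>M)"
    proof (intro cnorm_dominated_integral[OF has_dominated_integral_diff[OF g g]]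
        Bochner_Integration.integrable_add \<psi>)
      fix t assume t: "t \<in> space M"
      show "cnorm A (g n t \<ominus> g m t) \<le> \<psi> n t + \<psi> m t"
        using cnorm_triangle[of "g n t" "f t" "g m t"] \<psi>(2)[OF t, of n] \<psi>(2)[OF t, of m]
          f gc[OF t] t cnorm_diff_commute[of "g n t" "f t"] by fastforce
    qed
    also have "\<dots> = (\<integral>t. \<psi> n t \<partial>M) + (\<integral>t. \<psi> m t \<partial>M)"
      using \<psi>(1) by simp
    finally show ?thesis using \<psi>(3)[of n] \<psi>(3)[of m] by linarith
  qed
  have "metric.MCauchy y"
    unfolding metric.MCauchy_def
  proof (intro conjI allI impI)
    show "range y \<subseteq> carrier A" using yc by auto
    fix \<epsilon> :: real assume "0 < \<epsilon>"
    then obtain N where N: "1 / real (Suc N) < \<epsilon> / 2"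
      using nat_approx_posE[of "\<epsilon> / 2"] by auto
    have "cdist A (y n) (y n') < \<epsilon>" if "N \<le> n" "N \<le> n'" for n n'
    proof -
      have "1 / real (Suc n) \<le> 1 / real (Suc N)" "1 / real (Suc n') \<le> 1 / real (Suc N)"
        using that by (auto simp: field_simps)
      then show ?thesis using N yd[of n n'] yc by (simp add: cdist_def)
    qed
    then show "\<exists>N. \<forall>n n'. N \<le> n \<longrightarrow> N \<le> n' \<longrightarrow> cdist A (y n) (y n') < \<epsilon>" by blast
  qed
  then obtain x where x: "limitin metric.mtopology y x sequentially"
    using complete unfolding metric.mcomplete_def by blast
  then have xc: "x \<in> carrier A"
    and xl: "\<And>\<epsilon>. 0 < \<epsilon> \<Longrightarrow> \<exists>N. \<forall>n\<ge>N. cnorm A (y n \<ominus> x) < \<epsilon>"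
    using yc by (auto simp: metric.limit_metric_sequentially cdist_def)
  have "has_dominated_integral A M f x"
    unfolding has_dominated_integral_def
  proof (intro conjI allI impI f xc)
    fix \<epsilon> :: real assume \<epsilon>: "0 < \<epsilon>"
    obtain N where N: "1 / real (Suc N) < \<epsilon> / 2"
      using nat_approx_posE[of "\<epsilon> / 2"] \<epsilon> by auto
    obtain N' where N': "\<And>n. n \<ge> N' \<Longrightarrow> cnorm A (y n \<ominus> x) < \<epsilon> / 2"
      using xl[of "\<epsilon> / 2"] \<epsilon> by auto
    define n where "n = max N N'"
    have "1 / real (Suc n) \<le> 1 / real (Suc N)" by (auto simp: field_simps n_def)
    then have n: "1 / real (Suc n) < \<epsilon> / 2" "cnorm A (y n \<ominus> x) < \<epsilon> / 2"
      using N N'[of n] by (auto simp: n_def)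
    have e: "0 < \<epsilon> / 2" using \<epsilon> by simp
    obtain h \<phi> where h: "csimple A M h" "integrable M \<phi>"
      "\<And>t. t \<in> space M \<Longrightarrow> cnorm A (g n t \<ominus> h t) \<le> \<phi> t" "(\<integral>t. \<phi> t \<partial>M) < \<epsilon> / 2"
      "cnorm A (csimple_integral A M h \<ominus> y n) < \<epsilon> / 2"
      using has_dominated_integralE[OF g e, of n] by blast
    have "cnorm A (f t \<ominus> h t) \<le> \<psi> n t + \<phi> t" if t: "t \<in> space M" for t
    proof -
      have "h t \<in> carrier A" "f t \<in> carrier A" using h(1) f t by (auto simp: csimple_def)
      then show ?thesis
        using cnorm_triangle[of "f t" "g n t" "h t"] h(3)[OF t] \<psi>(2)[OF t, of n] gc[OF t, of n] by simp
    qed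
    moreover have "(\<integral>t. \<psi> n t + \<phi> t \<partial>M) < \<epsilon>"
      using \<psi>(1)[of n] h(2) \<psi>(3)[of n] n(1) h(4) by simp
    moreover have "cnorm A (csimple_integral A M h \<ominus> x) < \<epsilon>"
      using cnorm_triangle[OF csimple_integral_closed[OF h(1)] yc[of n] xc] h(5) n(2) by simp
    ultimately show "\<exists>h \<psi>. csimple A M h \<and> integrable M \<psi> \<and>
        (\<forall>t\<in>space M. cnorm A (f t \<ominus> h t) \<le> \<psi> t) \<and>
        (\<integral>t. \<psi> t \<partial>M) < \<epsilon> \<and> cnorm A (csimple_integral A M h \<ominus> x) < \<epsilon>"
      using h(1,2) \<psi>(1)[of n] by (intro exI[of _ h] exI[of _ "\<lambda>t. \<psi> n t + \<phi> t"]) auto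
  qed
  then show ?thesis ..
qed

text \<open>Majorants with integral below \<open>1 / real (Suc n)\<close> turn the formulation with
  \<open>\<epsilon>\<close> into the sequence of simple functions that
  \<open>has_cstar_integral\<close> demands.\<close>

lemma has_dominated_integral_imp_has_cstar_integral:
  assumes f: "has_dominated_integral A M f x" and m: "f \<in> measurable M (borel_of (norm_topology A))"
  shows "has_cstar_integral A M f x"
proof -
  have "\<forall>n. \<exists>h \<psi>. csimple A M h \<and> integrable M \<psi> \<and>
        (\<forall>t\<in>space M. cnorm A (f t \<ominus> h t) \<le> \<psi> t) \<and>
        (\<integral>t. \<psi> t \<partial>M) < 1 / real (Suc n) \<and> cnorm A (csimple_integral A M h \<ominus> x) < 1 / real (Suc n)"
    using f unfolding has_dominated_integral_def by simp
  then obtain h \<psi> where h: "\<And>n. csimple A M (h n)" "\<And>n. integrable M (\<psi> n)"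
      "\<And>n t. t \<in> space M \<Longrightarrow> cnorm A (f t \<ominus> h n t) \<le> \<psi> n t"
      "\<And>n. (\<integral>t. \<psi> n t \<partial>M) < 1 / real (Suc n)"
      "\<And>n. cnorm A (csimple_integral A M (h n) \<ominus> x) < 1 / real (Suc n)"
    by metis
  have c: "f \<in> space M \<rightarrow> carrier A" "x \<in> carrier A"
    using f by (auto simp: has_dominated_integral_def)
  have inv0: "(\<lambda>n. 1 / real (Suc n)) \<longlonglongrightarrow> 0"
    using LIMSEQ_inverse_real_of_nat by (simp add: inverse_eq_divide)
  have "(\<lambda>n. \<integral>\<^sup>+ t. ennreal (cnorm A (f t \<ominus> h n t)) \<partial>M) \<longlonglongrightarrow> 0"
  proof (rule tendsto_sandwich[where f="\<lambda>_. 0" and h="\<lambda>n. ennreal (1 / real (Suc n))"])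
    show "(\<lambda>n. ennreal (1 / real (Suc n))) \<longlonglongrightarrow> 0"
      using tendsto_ennrealI[OF inv0] by simp
    have "(\<integral>\<^sup>+ t. ennreal (cnorm A (f t \<ominus> h n t)) \<partial>M) \<le> ennreal (1 / real (Suc n))" for n
    proof -
      \<comment> \<open>A majorant of norms is nonnegative, so its Bochner integral agrees with its
        nonnegative integral.\<close>
      have pos: "0 \<le> \<psi> n t" if t: "t \<in> space M" for t
      proof -
        have "f t \<ominus> h n t \<in> carrier A" using h(1)[of n] c t by (auto simp: csimple_def Pi_iff)
        then show ?thesis using cnorm_nonneg h(3)[OF t, of n] by fastforce
      qed
      have "(\<integral>\<^sup>+ t. ennreal (cnorm A (f t \<ominus> h n t)) \<partial>M) \<le> (\<integral>\<^sup>+ t. ennreal (\<psi> n t) \<partial>M)"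
        by (intro nn_integral_mono ennreal_leI h(3))
      also have "\<dots> = ennreal (\<integral>t. \<psi> n t \<partial>M)"
        using pos by (intro nn_integral_eq_integral h(2)) auto
      also have "\<dots> \<le> ennreal (1 / real (Suc n))" using h(4)[of n] by (intro ennreal_leI) simp
      finally show ?thesis .
    qed
    then show "\<forall>\<^sub>F n in sequentially. (\<integral>\<^sup>+ t. ennreal (cnorm A (f t \<ominus> h n t)) \<partial>M) \<le> ennreal (1 / real (Suc n))"
      by simp
  qed auto
  moreover have "(\<lambda>n. cnorm A (csimple_integral A M (h n) \<ominus> x)) \<longlonglongrightarrow> 0"
  proof (rule tendsto_sandwich[OF _ _ tendsto_const inv0])
    show "\<forall>\<^sub>F n in sequentially. 0 \<le> cnorm A (csimple_integral A M (h n) \<ominus> x)"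
      by (intro always_eventually allI cnorm_nonneg minus_closed csimple_integral_closed h(1) c)
    show "\<forall>\<^sub>F n in sequentially. cnorm A (csimple_integral A M (h n) \<ominus> x) \<le> 1 / real (Suc n)"
      by (intro always_eventually allI less_imp_le h(5))
  qed
  ultimately show ?thesis using m h(1) c unfolding has_cstar_integral_def by blast
qed

text \<open>Here the norm of the error serves as its own majorant. It is measurable because
  \<open>h i\<close> takes finitely many values and on each level set the error is the distance of
  \<open>f t\<close> from a fixed point.\<close>

lemma has_cstar_integral_imp_has_dominated_integral:
  assumes f: "has_cstar_integral A M f x"
  shows "has_dominated_integral A M f x"
proof -
  obtain h where m: "f \<in> measurable M (borel_of (norm_topology A))" and xc: "x \<in> carrier A"
    and h: "\<And>i. csimple A M (h i)"
    and lim: "(\<lambda>i. \<integral>\<^sup>+ t. ennreal (cnorm A (f t \<ominus> h i t)) \<partial>M) \<longlonglongrightarrow> 0"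
      "(\<lambda>i. cnorm A (csimple_integral A M (h i) \<ominus> x)) \<longlonglongrightarrow> 0"
    using f unfolding has_cstar_integral_def by blast
  have fc: "f t \<in> carrier A" if "t \<in> space M" for t
    using measurable_space[OF m that] by simp
  have ball: "{x \<in> carrier A. cnorm A (x \<ominus> y) < c} \<in> sets (borel_of (norm_topology A))" if y: "y \<in> carrier A" for y c
  proof -
    have "\<exists>r>0. \<forall>z\<in>carrier A. cnorm A (z \<ominus> x) < r \<longrightarrow> cnorm A (z \<ominus> y) < c"
      if "x \<in> carrier A" "cnorm A (x \<ominus> y) < c" for x
    proof -
      have "cnorm A (z \<ominus> y) < c" if "z \<in> carrier A" "cnorm A (z \<ominus> x) < c - cnorm A (x \<ominus> y)" for z
        using that \<open>x \<in> carrier A\<close> y cnorm_triangle[of z x y] by simp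
      then show ?thesis using that(2) by (intro exI[of _ "c - cnorm A (x \<ominus> y)"]) auto
    qed
    then have "openin (norm_topology A) {x \<in> carrier A. cnorm A (x \<ominus> y) < c}"
      by (auto simp: openin_norm_topology)
    then show ?thesis by (rule sets_borel_of_openin)
  qed
  have meas: "(\<lambda>t. cnorm A (f t \<ominus> h i t)) \<in> borel_measurable M" for i
    unfolding borel_measurable_iff_less
  proof
    fix c
    have "{t \<in> space M. cnorm A (f t \<ominus> h i t) < c} =
        (\<Union>y\<in>h i ` space M. {t \<in> space M. h i t = y} \<inter> (f -` {x \<in> carrier A. cnorm A (x \<ominus> y) < c} \<inter> space M))"
      using fc by auto
    moreover have "\<dots> \<in> sets M"
      using h[of i] by (intro sets.finite_UN sets.Int measurable_sets[OF m] ball) (auto simp: csimple_def)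
    ultimately show "{t \<in> space M. cnorm A (f t \<ominus> h i t) < c} \<in> sets M" by simp
  qed
  show ?thesis
    unfolding has_dominated_integral_def
  proof (intro conjI allI impI xc)
    show "f \<in> space M \<rightarrow> carrier A" using fc by blast
    fix \<epsilon> :: real assume \<epsilon>: "0 < \<epsilon>"
    have "\<forall>\<^sub>F i in sequentially. (\<integral>\<^sup>+ t. ennreal (cnorm A (f t \<ominus> h i t)) \<partial>M) < ennreal \<epsilon>"
      using order_tendstoD(2)[OF lim(1)] \<epsilon> by simp
    moreover have "\<forall>\<^sub>F i in sequentially. cnorm A (csimple_integral A M (h i) \<ominus> x) < \<epsilon>"
      using order_tendstoD(2)[OF lim(2)] \<epsilon> by simp
    ultimately have "\<forall>\<^sub>F i in sequentially. (\<integral>\<^sup>+ t. ennreal (cnorm A (f t \<ominus> h i t)) \<partial>M) < ennreal \<epsilon> \<and>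
        cnorm A (csimple_integral A M (h i) \<ominus> x) < \<epsilon>" by eventually_elim simp
    then obtain i where i: "(\<integral>\<^sup>+ t. ennreal (cnorm A (f t \<ominus> h i t)) \<partial>M) < ennreal \<epsilon>"
        "cnorm A (csimple_integral A M (h i) \<ominus> x) < \<epsilon>"
      using eventually_happens'[OF sequentially_bot] by blast
    have hc: "h i t \<in> carrier A" if "t \<in> space M" for t
      using h[of i] that by (auto simp: csimple_def)
    then have pos: "0 \<le> cnorm A (f t \<ominus> h i t)" if "t \<in> space M" for t
      using that fc by (intro cnorm_nonneg minus_closed) auto
    have int: "integrable M (\<lambda>t. cnorm A (f t \<ominus> h i t))"
      using i(1) pos by (intro integrableI_nonneg meas) (auto intro: less_trans)
    have "ennreal (\<integral>t. cnorm A (f t \<ominus> h i t) \<partial>M) < ennreal \<epsilon>"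
      using i(1) pos by (subst nn_integral_eq_integral[OF int, symmetric]) auto
    then have "(\<integral>t. cnorm A (f t \<ominus> h i t) \<partial>M) < \<epsilon>" by (meson ennreal_leI not_less)
    then show "\<exists>h \<psi>. csimple A M h \<and> integrable M \<psi> \<and>
        (\<forall>t\<in>space M. cnorm A (f t \<ominus> h t) \<le> \<psi> t) \<and>
        (\<integral>t. \<psi> t \<partial>M) < \<epsilon> \<and> cnorm A (csimple_integral A M h \<ominus> x) < \<epsilon>"
      using h int i by (intro exI[of _ "h i"] exI[of _ "\<lambda>t. cnorm A (f t \<ominus> h i t)"]) auto
  qed
qed

end

section \<open>Compactly supported functions\<close>

text \<open>Real values in the unit interval make these functions usable both as weights and as
  majorants; \<open>bump_Cc\<close> passes to the complex functions for which the Haar axioms are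
  stated.\<close>

definition bump :: "'a topology \<Rightarrow> ('a \<Rightarrow> real) \<Rightarrow> bool" where
  "bump T f \<longleftrightarrow> continuous_map T euclideanreal f \<and>
     (\<forall>x\<in>topspace T. 0 \<le> f x \<and> f x \<le> 1) \<and>
     compactin T (T closure_of {x \<in> topspace T. f x \<noteq> 0})"

lemma bump_Cc: "bump T f \<Longrightarrow> (\<lambda>x. complex_of_real (f x)) \<in> Cc T"
proof -
  assume f: "bump T f"
  have "continuous_map T euclidean (complex_of_real \<circ> f)"
    using f by (intro continuous_map_compose[where X'=euclideanreal])
      (auto simp: bump_def continuous_on_of_real)
  then show ?thesis using f by (simp add: bump_def Cc_def o_def)
qed

lemma bump_compact_support:
  assumes "bump T f"
  obtains K where "compactin T K" "\<And>x. \<lbrakk>x \<in> topspace T; x \<notin> K\<rbrakk> \<Longrightarrow> f x = 0"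
  using assms closure_of_subset[of "{x \<in> topspace T. f x \<noteq> 0}" T]
  by (auto simp: bump_def intro!: that[of "T closure_of {x \<in> topspace T. f x \<noteq> 0}"])

lemma Cc_compact_support:
  assumes "f \<in> Cc T"
  obtains K where "compactin T K" "\<And>x. \<lbrakk>x \<in> topspace T; x \<notin> K\<rbrakk> \<Longrightarrow> f x = 0"
  using assms closure_of_subset[of "{x \<in> topspace T. f x \<noteq> 0}" T]
  by (auto simp: Cc_def intro!: that[of "T closure_of {x \<in> topspace T. f x \<noteq> 0}"])

lemma compactin_closure_of_subset:
  assumes "Hausdorff_space T" "compactin T K" "S \<subseteq> K"
  shows "compactin T (T closure_of S)"
proof (rule closed_compactin[OF assms(2)])
  show "T closure_of S \<subseteq> K"
    using assms by (intro closure_of_minimal compactin_imp_closedin)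
qed simp

text \<open>Urysohn's lemma yields the value 1 only on \<open>K\<close>. Cutting off
  \<open>2 * g x\<close> at height 1 enlarges this to the open set where \<open>g\<close> exceeds
  one half, which is what later makes partition sums equal to 1 near a compact set.\<close>

lemma bump_neighbourhood:
  assumes lc: "locally_compact_space T" and H: "Hausdorff_space T"
    and K: "compactin T K" and N: "openin T N" and KN: "K \<subseteq> N"
  obtains f V where "bump T f" "openin T V" "K \<subseteq> V" "\<And>x. x \<in> V \<Longrightarrow> f x = 1"
    "\<And>x. \<lbrakk>x \<in> topspace T; f x \<noteq> 0\<rbrakk> \<Longrightarrow> x \<in> N"
proof -
  have cr: "completely_regular_space T"
    using lc H by (intro locally_compact_regular_imp_completely_regular_space) auto
  \<comment> \<open>The relatively compact \<open>U\<close> confines the support, since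
    \<open>g\<close> is made to vanish off \<open>U \<inter> N\<close>.\<close>
  obtain U L where U: "openin T U" and L: "compactin T L" and UL: "K \<subseteq> U" "U \<subseteq> L"
    using lc K locally_compact_space_compact_closed_compact[OF disjI1[OF H]] by blast
  have "closedin T (topspace T - U \<inter> N)" using U N by (intro closedin_diff) auto
  moreover have "disjnt K (topspace T - U \<inter> N)" using UL KN by (auto simp: disjnt_def)
  ultimately obtain g where g: "continuous_map T (top_of_set {0..1::real}) g"
    "g ` (topspace T - U \<inter> N) \<subseteq> {0}" "g ` K \<subseteq> {1}"
    using Urysohn_completely_regular_compact_closed[OF zero_le_one cr K, of "topspace T - U \<inter> N"] by metis
  have gc: "continuous_map T euclideanreal g" and g01: "\<And>x. x \<in> topspace T \<Longrightarrow> 0 \<le> g x \<and> g x \<le> 1"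
    using g(1) by (auto simp: continuous_map_in_subtopology Pi_iff)
  have g0: "g x = 0" if "x \<in> topspace T" "x \<notin> U \<inter> N" for x using g(2) that by auto
  define f where "f x = min 1 (2 * g x)" for x
  have f0: "x \<in> U \<inter> N" if "x \<in> topspace T" "f x \<noteq> 0" for x
    using g0[of x] that by (cases "x \<in> U \<inter> N") (simp_all add: f_def)
  define V where "V = {x \<in> topspace T. g x \<in> {1/2<..}}"
  show thesis
  proof
    show "openin T V" unfolding V_def by (rule openin_continuous_map_preimage[OF gc]) simp
    show "K \<subseteq> V" using g(3) compactin_subset_topspace[OF K] by (auto simp: V_def)
    show "f x = 1" if "x \<in> V" for x using that by (auto simp: V_def f_def)
    show "x \<in> N" if "x \<in> topspace T" "f x \<noteq> 0" for x
      using f0[OF that] by simp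
    show "bump T f" unfolding bump_def
    proof (intro conjI ballI)
      show "continuous_map T euclideanreal f" unfolding f_def
        using gc by (intro continuous_map_real_min continuous_map_real_mult) auto
      show "0 \<le> f x" "f x \<le> 1" if "x \<in> topspace T" for x using g01[OF that] by (auto simp: f_def)
      show "compactin T (T closure_of {x \<in> topspace T. f x \<noteq> 0})"
        using UL f0 by (intro compactin_closure_of_subset[OF H L]) blast
    qed
  qed
qed

lemma bump_mult_one_minus:
  assumes H: "Hausdorff_space T" and f: "bump T f" and g: "bump T g"
  shows "bump T (\<lambda>x. f x * (1 - g x))"
proof -
  have "compactin T (T closure_of {x \<in> topspace T. f x * (1 - g x) \<noteq> 0})"
  proof (rule compactin_closure_of_subset[OF H])
    show "compactin T (T closure_of {x \<in> topspace T. f x \<noteq> 0})" using f by (simp add: bump_def)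
    show "{x \<in> topspace T. f x * (1 - g x) \<noteq> 0} \<subseteq> T closure_of {x \<in> topspace T. f x \<noteq> 0}"
      by (rule subset_trans[OF _ closure_of_subset]) auto
  qed
  moreover have "continuous_map T euclideanreal (\<lambda>x. f x * (1 - g x))"
    using f g unfolding bump_def by (intro continuous_map_real_mult continuous_map_diff) auto
  moreover have "0 \<le> f x * (1 - g x)" "f x * (1 - g x) \<le> 1" if "x \<in> topspace T" for x
    using f g that unfolding bump_def by (auto intro!: mult_le_one)
  ultimately show ?thesis unfolding bump_def by blast
qed

text \<open>The \<open>i\<close>-th function of a finite family is multiplied by \<open>1 - f j\<close> for all earlier \<open>j\<close>, so that
  the sum telescopes to \<open>1 - (\<Prod>i. 1 - f i)\<close>.\<close>

lemma telescoped_bumps: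
  assumes H: "Hausdorff_space T" and J: "finite J" and f: "\<And>j. j \<in> J \<Longrightarrow> bump T (f j)"
  shows "\<exists>\<phi>. (\<forall>j\<in>J. bump T (\<phi> j) \<and> (\<forall>x\<in>topspace T. \<phi> j x \<noteq> 0 \<longrightarrow> f j x \<noteq> 0)) \<and>
     (\<forall>x\<in>topspace T. (\<Sum>j\<in>J. \<phi> j x) = 1 - (\<Prod>j\<in>J. 1 - f j x))"
  using J f
proof (induction J rule: finite_induct)
  case (insert i J)
  have "\<exists>\<phi>. (\<forall>j\<in>J. bump T (\<phi> j) \<and> (\<forall>x\<in>topspace T. \<phi> j x \<noteq> 0 \<longrightarrow> f j x \<noteq> 0)) \<and>
     (\<forall>x\<in>topspace T. (\<Sum>j\<in>J. \<phi> j x) = 1 - (\<Prod>j\<in>J. 1 - f j x))"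
    by (rule insert.IH) (rule insert.prems, simp)
  then obtain \<phi> where \<phi>: "\<forall>j\<in>J. bump T (\<phi> j) \<and> (\<forall>x\<in>topspace T. \<phi> j x \<noteq> 0 \<longrightarrow> f j x \<noteq> 0)"
     "\<forall>x\<in>topspace T. (\<Sum>j\<in>J. \<phi> j x) = 1 - (\<Prod>j\<in>J. 1 - f j x)" by blast
  \<comment> \<open>The inserted function keeps its full weight and all previous ones are damped by
    \<open>1 - f i\<close>, so it takes the first place in the telescoping order.\<close>
  define \<phi>' where "\<phi>' j = (if j = i then f i else (\<lambda>x. \<phi> j x * (1 - f i x)))" for j
  have "bump T (\<phi>' j) \<and> (\<forall>x\<in>topspace T. \<phi>' j x \<noteq> 0 \<longrightarrow> f j x \<noteq> 0)" if "j \<in> insert i J" for j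
  proof (cases "j = i")
    case True
    then show ?thesis using insert.prems by (simp add: \<phi>'_def)
  next
    case False
    then have "j \<in> J" using that by simp
    then show ?thesis
      using False \<phi>(1) insert.prems bump_mult_one_minus[OF H, of "\<phi> j" "f i"] by (simp add: \<phi>'_def)
  qed
  moreover have "(\<Sum>j\<in>insert i J. \<phi>' j x) = 1 - (\<Prod>j\<in>insert i J. 1 - f j x)" if "x \<in> topspace T" for x
  proof -
    have "(\<Sum>j\<in>J. \<phi>' j x) = (\<Sum>j\<in>J. \<phi> j x) * (1 - f i x)"
      unfolding sum_distrib_right using insert.hyps by (intro sum.cong) (auto simp: \<phi>'_def)
    also have "\<dots> = (1 - (\<Prod>j\<in>J. 1 - f j x)) * (1 - f i x)"
      using \<phi>(2) that by simp
    finally have "f i x + (\<Sum>j\<in>J. \<phi>' j x) = 1 - (1 - f i x) * (\<Prod>j\<in>J. 1 - f j x)"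
      by (simp add: algebra_simps)
    moreover have "\<phi>' i = f i" by (simp add: \<phi>'_def)
    ultimately show ?thesis using insert.hyps by simp
  qed
  ultimately show ?case by (intro exI[of _ \<phi>'] conjI ballI) blast+
qed simp

text \<open>Indexing by points of \<open>K\<close> provides the tags for Riemann sums. The sum
  equals 1 as soon as one factor \<open>1 - f j\<close> of the telescoped product vanishes, so no
  normalising division occurs.\<close>

lemma partition_of_unity:
  assumes lc: "locally_compact_space T" and H: "Hausdorff_space T" and K: "compactin T K"
    and N: "\<And>x. x \<in> K \<Longrightarrow> openin T (N x) \<and> x \<in> N x"
  obtains J \<phi> V where "finite J" "J \<subseteq> K" "openin T V" "K \<subseteq> V" "\<And>j. j \<in> J \<Longrightarrow> bump T (\<phi> j)"
    "\<And>j x. \<lbrakk>j \<in> J; x \<in> topspace T; \<phi> j x \<noteq> 0\<rbrakk> \<Longrightarrow> x \<in> N j"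
    "\<And>x. x \<in> topspace T \<Longrightarrow> (\<Sum>j\<in>J. \<phi> j x) \<le> 1" "\<And>x. x \<in> V \<Longrightarrow> (\<Sum>j\<in>J. \<phi> j x) = 1"
proof -
  have "\<forall>x\<in>K. \<exists>f W. bump T f \<and> openin T W \<and> x \<in> W \<and> (\<forall>y\<in>W. f y = 1) \<and>
      (\<forall>y\<in>topspace T. f y \<noteq> 0 \<longrightarrow> y \<in> N x)"
  proof
    fix x assume x: "x \<in> K"
    then have c: "compactin T {x}" using compactin_subset_topspace[OF K] by auto
    obtain f V where "bump T f" "openin T V" "{x} \<subseteq> V" "\<And>y. y \<in> V \<Longrightarrow> f y = 1"
      "\<And>y. \<lbrakk>y \<in> topspace T; f y \<noteq> 0\<rbrakk> \<Longrightarrow> y \<in> N x"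
      by (rule bump_neighbourhood[OF lc H c, of "N x"]; use N[OF x] in blast)
    then show "\<exists>f W. bump T f \<and> openin T W \<and> x \<in> W \<and> (\<forall>y\<in>W. f y = 1) \<and>
      (\<forall>y\<in>topspace T. f y \<noteq> 0 \<longrightarrow> y \<in> N x)"
      by (intro exI[of _ f] exI[of _ V]) auto
  qed
  from bchoice[OF this] obtain f where "\<forall>x\<in>K. \<exists>W. bump T (f x) \<and> openin T W \<and> x \<in> W \<and> (\<forall>y\<in>W. f x y = 1) \<and>
      (\<forall>y\<in>topspace T. f x y \<noteq> 0 \<longrightarrow> y \<in> N x)" by blast
  from bchoice[OF this] obtain W where "\<forall>x\<in>K. bump T (f x) \<and> openin T (W x) \<and> x \<in> W x \<and> (\<forall>y\<in>W x. f x y = 1) \<and>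
      (\<forall>y\<in>topspace T. f x y \<noteq> 0 \<longrightarrow> y \<in> N x)" by blast
  then have f: "\<And>x. x \<in> K \<Longrightarrow> bump T (f x)" "\<And>x y. \<lbrakk>x \<in> K; y \<in> topspace T; f x y \<noteq> 0\<rbrakk> \<Longrightarrow> y \<in> N x"
    and W: "\<And>x. x \<in> K \<Longrightarrow> openin T (W x) \<and> x \<in> W x" "\<And>x y. \<lbrakk>x \<in> K; y \<in> W x\<rbrakk> \<Longrightarrow> f x y = 1"
    by blast+
  have "\<exists>\<F>. finite \<F> \<and> \<F> \<subseteq> W ` K \<and> K \<subseteq> \<Union>\<F>"
    by (rule compactinD[OF K]) (use W(1) in auto)
  then obtain \<F> where F: "finite \<F>" "\<F> \<subseteq> W ` K" "K \<subseteq> \<Union>\<F>" by blast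
  obtain J where J: "finite J" "J \<subseteq> K" "K \<subseteq> \<Union>(W ` J)"
    using finite_subset_image[OF F(1,2)] F(3) by blast
  have fJ: "bump T (f j)" if "j \<in> J" for j using f(1) J(2) that by blast
  obtain \<phi> where \<phi>: "\<forall>j\<in>J. bump T (\<phi> j) \<and> (\<forall>x\<in>topspace T. \<phi> j x \<noteq> 0 \<longrightarrow> f j x \<noteq> 0)"
     "\<forall>x\<in>topspace T. (\<Sum>j\<in>J. \<phi> j x) = 1 - (\<Prod>j\<in>J. 1 - f j x)"
    using telescoped_bumps[OF H J(1), of f, OF fJ] by blast
  show thesis
  proof
    show "finite J" "J \<subseteq> K" "K \<subseteq> \<Union>(W ` J)" by fact+
    show "openin T (\<Union>(W ` J))" using J W by (intro openin_Union) auto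
    show "bump T (\<phi> j)" if "j \<in> J" for j using \<phi> that by blast
    show "x \<in> N j" if "j \<in> J" "x \<in> topspace T" "\<phi> j x \<noteq> 0" for j x
      using \<phi>(1) that f(2) J(2) by blast
    show "(\<Sum>j\<in>J. \<phi> j x) \<le> 1" if "x \<in> topspace T" for x
    proof -
      have "0 \<le> (\<Prod>j\<in>J. 1 - f j x)"
        using f(1) J(2) that by (intro prod_nonneg) (auto simp: bump_def)
      then show ?thesis using \<phi>(2) that by simp
    qed
    show "(\<Sum>j\<in>J. \<phi> j x) = 1" if x: "x \<in> \<Union>(W ` J)" for x
    proof -
      obtain j where j: "j \<in> J" "x \<in> W j" using x by blast
      have "j \<in> K" using j J(2) by blast
      with j W openin_subset[of T "W j"] have "x \<in> topspace T" "1 - f j x = 0" by auto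
      then have "(\<Prod>j\<in>J. 1 - f j x) = 0" using J(1) j(1) by (intro prod_zero) auto
      then show ?thesis using \<phi>(2) \<open>x \<in> topspace T\<close> by simp
    qed
  qed
qed

section \<open>Sections of upper semicontinuous C*-bundles\<close>

lemma continuous_map_localI:
  assumes "\<And>x. x \<in> topspace X \<Longrightarrow> f x \<in> topspace Y"
    and "\<And>x W. \<lbrakk>x \<in> topspace X; openin Y W; f x \<in> W\<rbrakk> \<Longrightarrow> \<exists>U. openin X U \<and> x \<in> U \<and> (\<forall>y\<in>U. f y \<in> W)"
  shows "continuous_map X Y f"
  unfolding continuous_map_def
proof (intro conjI allI impI)
  show "f \<in> topspace X \<rightarrow> topspace Y" using assms(1) by blast
  fix W assume W: "openin Y W"
  show "openin X {x \<in> topspace X. f x \<in> W}"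
  proof (subst openin_subopen, intro ballI)
    fix x assume "x \<in> {x \<in> topspace X. f x \<in> W}"
    then obtain U where "openin X U" "x \<in> U" "\<forall>y\<in>U. f y \<in> W" using assms(2)[OF _ W] by blast
    then show "\<exists>U. openin X U \<and> x \<in> U \<and> U \<subseteq> {x \<in> topspace X. f x \<in> W}"
      using openin_subset by blast
  qed
qed

section \<open>Neighbourhoods in the total space and continuity of fibrewise operations\<close>

context usc_cstar_bundle
begin

abbreviation bnorm :: "'e \<Rightarrow> real" where
  "bnorm e \<equiv> cnorm (fib B (proj B e)) e"

lemma proj_in: "e \<in> topspace (total B) \<Longrightarrow> proj B e \<in> topspace X"
  using continuous_map_funspace[OF proj_continuous] by auto

lemma carrier_fib: "x \<in> topspace X \<Longrightarrow> e \<in> carrier (fib B x) \<longleftrightarrow> e \<in> topspace (total B) \<and> proj B e = x"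
  using fib_carrier by auto

lemma in_fib_proj: "e \<in> topspace (total B) \<Longrightarrow> e \<in> carrier (fib B (proj B e))"
  by (simp add: carrier_fib proj_in)

text \<open>The axiom \<open>zero_limit\<close> is applied to the filter generated by the tubes over
  neighbourhoods of \<open>x\<close> with small norm. Along it projections converge to
  \<open>x\<close> and norms to 0, so some tube lies in \<open>W\<close>.\<close>

lemma zero_neighbourhood:
  assumes x: "x \<in> topspace X" and W: "openin (total B) W" and 0: "\<zero>\<^bsub>fib B x\<^esub> \<in> W"
  obtains U \<epsilon> where "openin X U" "x \<in> U" "(0::real) < \<epsilon>"
    "\<And>e. \<lbrakk>e \<in> topspace (total B); proj B e \<in> U; bnorm e < \<epsilon>\<rbrakk> \<Longrightarrow> e \<in> W"
proof -
  define P where "P = {(U, \<epsilon>::real). openin X U \<and> x \<in> U \<and> 0 < \<epsilon>}"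
  define S where "S p = {e \<in> topspace (total B). proj B e \<in> fst p \<and> bnorm e < snd p}" for p
  define \<Phi> where "\<Phi> = (INF p\<in>P. principal (S p))"
  have ev: "eventually Q \<Phi> \<longleftrightarrow> (\<exists>p\<in>P. \<forall>e\<in>S p. Q e)" for Q
    unfolding \<Phi>_def
  proof (subst eventually_INF_base)
    show "P \<noteq> {}" using x by (auto simp: P_def intro!: exI[of _ "topspace X"] exI[of _ 1])
    fix p q assume "p \<in> P" "q \<in> P"
    then show "\<exists>r\<in>P. principal (S r) \<le> inf (principal (S p)) (principal (S q))"
      by (intro bexI[of _ "(fst p \<inter> fst q, min (snd p) (snd q))"]) (auto simp: P_def S_def)
  qed (simp add: eventually_principal)
  have "limitin (total B) (\<lambda>a. a) \<zero>\<^bsub>fib B x\<^esub> \<Phi>"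
  proof (rule zero_limit)
    show "eventually (\<lambda>a. a \<in> topspace (total B)) \<Phi>"
      unfolding ev using x by (intro bexI[of _ "(topspace X, 1)"]) (auto simp: P_def S_def)
    show "limitin X (proj B) x \<Phi>"
      unfolding limitin_def ev
    proof (intro conjI allI impI x)
      fix U assume "openin X U \<and> x \<in> U"
      then show "\<exists>p\<in>P. \<forall>e\<in>S p. proj B e \<in> U"
        by (intro bexI[of _ "(U, 1)"]) (auto simp: P_def S_def)
    qed
    show "(bnorm \<longlongrightarrow> 0) \<Phi>"
    proof (rule tendstoI)
      fix \<epsilon> :: real assume "0 < \<epsilon>"
      moreover have "0 \<le> bnorm e" if "e \<in> topspace (total B)" for e
        using cstar_algebra.cnorm_nonneg[OF fib_cstar] proj_in[OF that] in_fib_proj[OF that] by blast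
      ultimately show "\<forall>\<^sub>F e in \<Phi>. dist (bnorm e) 0 < \<epsilon>"
        unfolding ev using x by (intro bexI[of _ "(topspace X, \<epsilon>)"]) (auto simp: P_def S_def)
    qed
  qed
  then have "eventually (\<lambda>a. a \<in> W) \<Phi>" using W 0 by (auto simp: limitin_def)
  then show thesis unfolding ev using that by (auto simp: P_def S_def)
qed

text \<open>Continuity of addition at the pair of \<open>e\<close> and the zero of its fibre,
  combined with tubes around that zero. The total space carries no metric; absorbing small fibre
  elements uniformly over \<open>V\<close> replaces the triangle inequality.\<close>

lemma perturbation:
  assumes W: "openin (total B) W" and e: "e \<in> W"
  obtains V \<epsilon> where "openin (total B) V" "e \<in> V" "(0::real) < \<epsilon>"
    "\<And>e' z. \<lbrakk>e' \<in> V; z \<in> carrier (fib B (proj B e')); cnorm (fib B (proj B e')) z < \<epsilon>\<rbrakk>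
      \<Longrightarrow> e' \<oplus>\<^bsub>fib B (proj B e')\<^esub> z \<in> W"
proof -
  have et: "e \<in> topspace (total B)" using openin_subset[OF W] e by auto
  note x = proj_in[OF et]
  interpret F: cstar_algebra "fib B (proj B e)" using fib_cstar x .
  let ?z = "\<zero>\<^bsub>fib B (proj B e)\<^esub>"
  have z: "?z \<in> topspace (total B)" "proj B ?z = proj B e"
    using F.zero_closed carrier_fib[OF x] by auto
  let ?D = "subtopology (prod_topology (total B) (total B)) {(a, b). proj B a = proj B b}"
  have "openin ?D {p \<in> topspace ?D. (\<lambda>(a, b). a \<oplus>\<^bsub>fib B (proj B a)\<^esub> b) p \<in> W}"
    by (rule openin_continuous_map_preimage[OF add_continuous W])
  then obtain T where T: "openin (prod_topology (total B) (total B)) T"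
    "{p \<in> topspace ?D. (\<lambda>(a, b). a \<oplus>\<^bsub>fib B (proj B a)\<^esub> b) p \<in> W} = T \<inter> {(a, b). proj B a = proj B b}"
    unfolding openin_subtopology by blast
  have "(e, ?z) \<in> {p \<in> topspace ?D. (\<lambda>(a, b). a \<oplus>\<^bsub>fib B (proj B a)\<^esub> b) p \<in> W}"
    using et z e in_fib_proj[OF et] by simp
  then have "(e, ?z) \<in> T" unfolding T(2) by (rule IntD1)
  from openin_prod_topology_alt[THEN iffD1, rule_format, OF T(1) this] obtain V1 V0 where V: "openin (total B) V1" "openin (total B) V0" "e \<in> V1" "?z \<in> V0" "V1 \<times> V0 \<subseteq> T"
    by (elim exE conjE) (rule that)
  obtain U \<epsilon> where U: "openin X U" "proj B e \<in> U" "0 < \<epsilon>"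
    "\<And>e. \<lbrakk>e \<in> topspace (total B); proj B e \<in> U; bnorm e < \<epsilon>\<rbrakk> \<Longrightarrow> e \<in> V0"
    by (rule zero_neighbourhood[OF x V(2) V(4)]) (rule that)
  show thesis
  proof
    show "openin (total B) (V1 \<inter> {e \<in> topspace (total B). proj B e \<in> U})"
      by (intro openin_Int V openin_continuous_map_preimage[OF proj_continuous] U)
    show "e \<in> V1 \<inter> {e \<in> topspace (total B). proj B e \<in> U}" using V U et by simp
    show "0 < \<epsilon>" by fact
    fix e' z
    assume e': "e' \<in> V1 \<inter> {e \<in> topspace (total B). proj B e \<in> U}"
      and z: "z \<in> carrier (fib B (proj B e'))" "cnorm (fib B (proj B e')) z < \<epsilon>"
    then have x': "proj B e' \<in> topspace X" using proj_in by blast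
    have zz: "z \<in> topspace (total B)" "proj B z = proj B e'" using z carrier_fib[OF x'] by auto
    then have "z \<in> V0" using U(4)[of z] e' z by simp
    then have "(e', z) \<in> T \<inter> {(a, b). proj B a = proj B b}" using V(5) e' zz by auto
    then show "e' \<oplus>\<^bsub>fib B (proj B e')\<^esub> z \<in> W" unfolding T(2)[symmetric] using zz by simp
  qed
qed

lemma continuous_map_fibre_pair:
  assumes "continuous_map T (total B) f" "continuous_map T (total B) g"
    and "\<And>t. t \<in> topspace T \<Longrightarrow> proj B (f t) = proj B (g t)"
  shows "continuous_map T (subtopology (prod_topology (total B) (total B)) {(a, b). proj B a = proj B b})
    (\<lambda>t. (f t, g t))"
  using assms by (auto simp: continuous_map_in_subtopology continuous_map_paired)

lemma continuous_map_add:
  assumes "continuous_map T (total B) f" "continuous_map T (total B) g"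
    and "\<And>t. t \<in> topspace T \<Longrightarrow> proj B (f t) = proj B (g t)"
  shows "continuous_map T (total B) (\<lambda>t. f t \<oplus>\<^bsub>fib B (proj B (f t))\<^esub> g t)"
  using continuous_map_compose[OF continuous_map_fibre_pair[OF assms] add_continuous] by (simp add: o_def)

lemma continuous_map_mult:
  assumes "continuous_map T (total B) f" "continuous_map T (total B) g"
    and "\<And>t. t \<in> topspace T \<Longrightarrow> proj B (f t) = proj B (g t)"
  shows "continuous_map T (total B) (\<lambda>t. f t \<otimes>\<^bsub>fib B (proj B (f t))\<^esub> g t)"
  using continuous_map_compose[OF continuous_map_fibre_pair[OF assms] mult_continuous] by (simp add: o_def)

lemma continuous_map_smult_const:
  "continuous_map T (total B) f \<Longrightarrow> continuous_map T (total B) (\<lambda>t. k \<odot>\<^bsub>fib B (proj B (f t))\<^esub> f t)"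
  using continuous_map_compose[OF _ smult_continuous, of T f] by (simp add: o_def)

lemma continuous_map_star:
  "continuous_map T (total B) f \<Longrightarrow> continuous_map T (total B) (\<lambda>t. star (fib B (proj B (f t))) (f t))"
  using continuous_map_compose[OF _ star_continuous, of T f] by (simp add: o_def)

lemma openin_bnorm_less:
  assumes f: "continuous_map T (total B) f"
  shows "openin T {t \<in> topspace T. bnorm (f t) < c}"
proof -
  have "openin T {t \<in> topspace T. f t \<in> {e \<in> topspace (total B). bnorm e < c}}"
    by (rule openin_continuous_map_preimage[OF f norm_usc])
  moreover have "{t \<in> topspace T. f t \<in> {e \<in> topspace (total B). bnorm e < c}} = {t \<in> topspace T. bnorm (f t) < c}"
    using continuous_map_funspace[OF f] by auto
  ultimately show ?thesis by simp
qed

text \<open>Upper semicontinuity suffices for an upper bound: the open sets where the norm is below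
  \<open>real n\<close> cover \<open>K\<close>.\<close>

lemma bnorm_bounded_on_compact:
  assumes f: "continuous_map T (total B) f" and K: "compactin T K"
  obtains C where "0 < C" "\<And>t. t \<in> K \<Longrightarrow> bnorm (f t) \<le> C"
proof -
  define U where "U n = {t \<in> topspace T. bnorm (f t) < real n}" for n
  have "K \<subseteq> \<Union>(range U)"
    using compactin_subset_topspace[OF K] reals_Archimedean2 by (fastforce simp: U_def)
  moreover have "\<And>V. V \<in> range U \<Longrightarrow> openin T V" using openin_bnorm_less[OF f] by (auto simp: U_def)
  ultimately obtain \<F> where F: "finite \<F>" "\<F> \<subseteq> range U" "K \<subseteq> \<Union>\<F>" using compactinD[OF K] by meson
  obtain J where J: "finite J" "\<F> = U ` J" using finite_subset_image[OF F(1,2)] by blast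
  obtain N where N: "\<forall>n\<in>J. n \<le> N" using J(1) finite_nat_set_iff_bounded_le by blast
  show thesis
  proof
    show "0 < real (Suc N)" by (rule of_nat_0_less_iff[THEN iffD2]) simp
    fix t assume "t \<in> K"
    then obtain n where n: "n \<in> J" "t \<in> U n" using F(3) J(2) by blast
    then show "bnorm (f t) \<le> real (Suc N)" using N n(2) by (force simp: U_def)
  qed
qed

text \<open>The bundle axioms only provide continuity for a fixed scalar.\<close>

lemma continuous_map_smult:
  assumes f: "continuous_map T euclidean f" and a: "continuous_map T (total B) a"
  shows "continuous_map T (total B) (\<lambda>t. f t \<odot>\<^bsub>fib B (proj B (a t))\<^esub> a t)"
proof (rule continuous_map_localI)
  have ac: "a t \<in> topspace (total B)" if "t \<in> topspace T" for t
    using continuous_map_funspace[OF a] that by auto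
  have sc: "k \<odot>\<^bsub>fib B (proj B (a t))\<^esub> a t \<in> carrier (fib B (proj B (a t)))" if "t \<in> topspace T" for t k
    using ac[OF that] by (simp add: cstar_algebra.smult_closed fib_cstar proj_in in_fib_proj)
  have st: "k \<odot>\<^bsub>fib B (proj B (a t))\<^esub> a t \<in> topspace (total B) \<and>
      proj B (k \<odot>\<^bsub>fib B (proj B (a t))\<^esub> a t) = proj B (a t)" if "t \<in> topspace T" for t k
    using sc[OF that] carrier_fib[OF proj_in[OF ac[OF that]]] by blast
  then show "f t \<odot>\<^bsub>fib B (proj B (a t))\<^esub> a t \<in> topspace (total B)" if "t \<in> topspace T" for t
    using that by blast
  fix t0 W
  assume t0: "t0 \<in> topspace T" and W: "openin (total B) W" and W0: "f t0 \<odot>\<^bsub>fib B (proj B (a t0))\<^esub> a t0 \<in> W"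
  obtain V \<epsilon> where V: "openin (total B) V" "f t0 \<odot>\<^bsub>fib B (proj B (a t0))\<^esub> a t0 \<in> V" "0 < \<epsilon>"
    "\<And>e' z. \<lbrakk>e' \<in> V; z \<in> carrier (fib B (proj B e')); cnorm (fib B (proj B e')) z < \<epsilon>\<rbrakk>
      \<Longrightarrow> e' \<oplus>\<^bsub>fib B (proj B e')\<^esub> z \<in> W"
    by (rule perturbation[OF W W0]) (rule that)
  \<comment> \<open>By upper semicontinuity this strict bound on the norm at \<open>t0\<close>
    persists nearby, and it limits the effect of changing the scalar.\<close>
  define C where "C = bnorm (a t0) + 1"
  have C: "0 < C"
    using cstar_algebra.cnorm_nonneg[OF fib_cstar[OF proj_in[OF ac[OF t0]]] in_fib_proj[OF ac[OF t0]]]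
    by (simp add: C_def)
  define U1 where "U1 = {t \<in> topspace T. f t0 \<odot>\<^bsub>fib B (proj B (a t))\<^esub> a t \<in> V}"
  define U2 where "U2 = {t \<in> topspace T. bnorm (a t) < C}"
  define U3 where "U3 = {t \<in> topspace T. f t \<in> ball (f t0) (\<epsilon> / C)}"
  have o: "openin T (U1 \<inter> U2 \<inter> U3)"
  proof (intro openin_Int)
    show "openin T U1" unfolding U1_def
      by (rule openin_continuous_map_preimage[OF continuous_map_smult_const[OF a] V(1)])
    show "openin T U2" unfolding U2_def by (rule openin_bnorm_less[OF a])
    show "openin T U3" unfolding U3_def by (rule openin_continuous_map_preimage[OF f]) simp
  qed
  have "f t \<odot>\<^bsub>fib B (proj B (a t))\<^esub> a t \<in> W" if t: "t \<in> U1 \<inter> U2 \<inter> U3" for t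
  proof -
    have tT: "t \<in> topspace T" using t by (simp add: U1_def)
    interpret F: cstar_algebra "fib B (proj B (a t))" using fib_cstar proj_in ac[OF tT] by blast
    \<comment> \<open>The scalar is frozen at \<open>f t0\<close>, where continuity is an axiom; the
      remainder \<open>?z\<close> is small and is absorbed by \<open>perturbation\<close>.\<close>
    let ?e = "f t0 \<odot>\<^bsub>fib B (proj B (a t))\<^esub> a t" and ?z = "(f t - f t0) \<odot>\<^bsub>fib B (proj B (a t))\<^esub> a t"
    have at: "a t \<in> carrier (fib B (proj B (a t)))" using in_fib_proj ac[OF tT] by blast
    have pe: "proj B ?e = proj B (a t)" using st[OF tT] by blast
    have "cmod (f t - f t0) < \<epsilon> / C" using t by (auto simp: U3_def dist_norm norm_minus_commute)
    then have "cmod (f t - f t0) * C < \<epsilon>" using C by (simp add: field_simps)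
    moreover have "cmod (f t - f t0) * bnorm (a t) \<le> cmod (f t - f t0) * C"
      using t by (intro mult_left_mono) (auto simp: U2_def)
    ultimately have "cnorm (fib B (proj B (a t))) ?z < \<epsilon>"
      using at by (simp add: F.cnorm_smult)
    then have "?e \<oplus>\<^bsub>fib B (proj B (a t))\<^esub> ?z \<in> W"
      using V(4)[of ?e ?z] t pe at by (simp add: U1_def F.smult_closed)
    moreover have "?e \<oplus>\<^bsub>fib B (proj B (a t))\<^esub> ?z = f t \<odot>\<^bsub>fib B (proj B (a t))\<^esub> a t"
      using at by (simp flip: F.smult_add_left)
    ultimately show ?thesis by simp
  qed
  moreover have "t0 \<in> U1 \<inter> U2 \<inter> U3" using t0 V C \<open>0 < \<epsilon>\<close> by (auto simp: U1_def U2_def U3_def C_def)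
  ultimately show "\<exists>U. openin T U \<and> t0 \<in> U \<and> (\<forall>t\<in>U. f t \<odot>\<^bsub>fib B (proj B (a t))\<^esub> a t \<in> W)"
    using o by blast
qed

text \<open>Approximation up to \<open>\<epsilon>\<close> in the fibres by elements that converge in the total space suffices for
  continuity; neither the approximants nor a local section through \<open>e\<^sub>0\<close> need to be continuous.\<close>

lemma continuous_section_criterion:
  assumes \<sigma>: "\<And>x. x \<in> topspace X \<Longrightarrow> \<sigma> x \<in> carrier (fib B x)"
    and approx: "\<And>x0 \<epsilon>. \<lbrakk>x0 \<in> topspace X; (0::real) < \<epsilon>\<rbrakk> \<Longrightarrow>
      \<exists>e0\<in>carrier (fib B x0). cnorm (fib B x0) (\<sigma> x0 \<ominus>\<^bsub>fib B x0\<^esub> e0) < \<epsilon> \<and>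
        (\<forall>V. openin (total B) V \<and> e0 \<in> V \<longrightarrow>
          (\<exists>U. openin X U \<and> x0 \<in> U \<and>
            (\<forall>u\<in>U. \<exists>e\<in>V. proj B e = u \<and> cnorm (fib B u) (\<sigma> u \<ominus>\<^bsub>fib B u\<^esub> e) < \<epsilon>)))"
  shows "continuous_map X (total B) \<sigma>"
proof (rule continuous_map_localI)
  show "\<sigma> x \<in> topspace (total B)" if "x \<in> topspace X" for x
    using \<sigma>[OF that] carrier_fib[OF that] by blast
  fix x0 W assume x0: "x0 \<in> topspace X" and W: "openin (total B) W" and \<sigma>W: "\<sigma> x0 \<in> W"
  have p0: "proj B (\<sigma> x0) = x0" using \<sigma>[OF x0] carrier_fib[OF x0] by blast
  interpret F0: cstar_algebra "fib B x0" using fib_cstar[OF x0] .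
  obtain V1 \<epsilon>1 where V1: "openin (total B) V1" "\<sigma> x0 \<in> V1" "0 < \<epsilon>1"
    "\<And>e' z. \<lbrakk>e' \<in> V1; z \<in> carrier (fib B (proj B e')); cnorm (fib B (proj B e')) z < \<epsilon>1\<rbrakk>
      \<Longrightarrow> e' \<oplus>\<^bsub>fib B (proj B e')\<^esub> z \<in> W"
    by (rule perturbation[OF W \<sigma>W]) (rule that)
  \<comment> \<open>Two nested neighbourhoods: closeness at \<open>x0\<close> moves
    \<open>e0\<close> into \<open>V1\<close>, and closeness at \<open>u\<close> moves
    \<open>\<sigma> u\<close> from a point of \<open>V1\<close> into \<open>W\<close>.\<close>
  obtain V2 \<epsilon>2 where V2: "\<sigma> x0 \<in> V2" "0 < \<epsilon>2"
    "\<And>e' z. \<lbrakk>e' \<in> V2; z \<in> carrier (fib B (proj B e')); cnorm (fib B (proj B e')) z < \<epsilon>2\<rbrakk>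
      \<Longrightarrow> e' \<oplus>\<^bsub>fib B (proj B e')\<^esub> z \<in> V1"
    by (rule perturbation[OF V1(1,2)]) (rule that)
  have "0 < min \<epsilon>1 \<epsilon>2" using V1 V2 by simp
  from approx[OF x0 this] obtain e0
    where e0: "e0 \<in> carrier (fib B x0)" "cnorm (fib B x0) (\<sigma> x0 \<ominus>\<^bsub>fib B x0\<^esub> e0) < min \<epsilon>1 \<epsilon>2"
      and U: "\<forall>V. openin (total B) V \<and> e0 \<in> V \<longrightarrow> (\<exists>U. openin X U \<and> x0 \<in> U \<and>
            (\<forall>u\<in>U. \<exists>e\<in>V. proj B e = u \<and> cnorm (fib B u) (\<sigma> u \<ominus>\<^bsub>fib B u\<^esub> e) < min \<epsilon>1 \<epsilon>2))"
    by blast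
  have "cnorm (fib B x0) (e0 \<ominus>\<^bsub>fib B x0\<^esub> \<sigma> x0) < \<epsilon>2"
    using e0 \<sigma>[OF x0] by (simp add: F0.cnorm_diff_commute)
  then have "\<sigma> x0 \<oplus>\<^bsub>fib B x0\<^esub> (e0 \<ominus>\<^bsub>fib B x0\<^esub> \<sigma> x0) \<in> V1"
    using V2(3)[OF V2(1), of "e0 \<ominus>\<^bsub>fib B x0\<^esub> \<sigma> x0"] e0 \<sigma>[OF x0] by (simp add: p0)
  then have "e0 \<in> V1" using e0 \<sigma>[OF x0] by (simp add: F0.add_diff_cancel)
  with U V1(1) obtain U where U: "openin X U" "x0 \<in> U"
    "\<forall>u\<in>U. \<exists>e\<in>V1. proj B e = u \<and> cnorm (fib B u) (\<sigma> u \<ominus>\<^bsub>fib B u\<^esub> e) < min \<epsilon>1 \<epsilon>2" by blast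
  have "\<sigma> u \<in> W" if u: "u \<in> U" for u
  proof -
    have uX: "u \<in> topspace X" using openin_subset[OF U(1)] u by blast
    interpret F: cstar_algebra "fib B u" using fib_cstar[OF uX] .
    obtain e where e: "e \<in> V1" "proj B e = u" "cnorm (fib B u) (\<sigma> u \<ominus>\<^bsub>fib B u\<^esub> e) < min \<epsilon>1 \<epsilon>2"
      using U(3) u by blast
    have ec: "e \<in> carrier (fib B u)" using openin_subset[OF V1(1)] e carrier_fib[OF uX] by blast
    have "e \<oplus>\<^bsub>fib B u\<^esub> (\<sigma> u \<ominus>\<^bsub>fib B u\<^esub> e) \<in> W"
      using V1(4)[OF e(1), of "\<sigma> u \<ominus>\<^bsub>fib B u\<^esub> e"] e ec \<sigma>[OF uX] by simp
    then show ?thesis using ec \<sigma>[OF uX] by (simp add: F.add_diff_cancel)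
  qed
  then show "\<exists>U. openin X U \<and> x0 \<in> U \<and> (\<forall>y\<in>U. \<sigma> y \<in> W)" using U by blast
qed

subsection \<open>The algebra of sections\<close>

text \<open>A zero element has norm 0 and hence lies in every tube over a neighbourhood of its base
  point.\<close>

lemma continuous_map_zero_section: "continuous_map X (total B) (\<lambda>x. \<zero>\<^bsub>fib B x\<^esub>)"
proof (rule continuous_map_localI)
  have z: "\<zero>\<^bsub>fib B x\<^esub> \<in> topspace (total B)" "proj B \<zero>\<^bsub>fib B x\<^esub> = x" "bnorm \<zero>\<^bsub>fib B x\<^esub> = 0" if "x \<in> topspace X" for x
  proof -
    interpret F: cstar_algebra "fib B x" using fib_cstar[OF that] .
    show "\<zero>\<^bsub>fib B x\<^esub> \<in> topspace (total B)" "proj B \<zero>\<^bsub>fib B x\<^esub> = x"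
      using F.zero_closed carrier_fib[OF that] by auto
    then show "bnorm \<zero>\<^bsub>fib B x\<^esub> = 0" by simp
  qed
  then show "\<zero>\<^bsub>fib B x\<^esub> \<in> topspace (total B)" if "x \<in> topspace X" for x using that by blast
  fix x W assume x: "x \<in> topspace X" and W: "openin (total B) W" "\<zero>\<^bsub>fib B x\<^esub> \<in> W"
  obtain U \<epsilon> where U: "openin X U" "x \<in> U" "(0::real) < \<epsilon>"
    "\<And>e. \<lbrakk>e \<in> topspace (total B); proj B e \<in> U; bnorm e < \<epsilon>\<rbrakk> \<Longrightarrow> e \<in> W"
    by (rule zero_neighbourhood[OF x W]) (rule that)
  have "\<zero>\<^bsub>fib B y\<^esub> \<in> W" if "y \<in> U" for y
    using U(3) U(4)[of "\<zero>\<^bsub>fib B y\<^esub>"] z[of y] openin_subset[OF U(1)] that by auto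
  then show "\<exists>U. openin X U \<and> x \<in> U \<and> (\<forall>y\<in>U. \<zero>\<^bsub>fib B y\<^esub> \<in> W)" using U by blast
qed

lemma Gamma0D:
  assumes "a \<in> Gamma0 X B"
  shows "a \<in> extensional (topspace X)" "continuous_map X (total B) a"
    "x \<in> topspace X \<Longrightarrow> proj B (a x) = x" "x \<in> topspace X \<Longrightarrow> a x \<in> carrier (fib B x)"
    "0 < \<epsilon> \<Longrightarrow> compactin X {x \<in> topspace X. \<epsilon> \<le> cnorm (fib B x) (a x)}"
  using assms continuous_map_funspace[of X "total B" a] carrier_fib[of x "a x"]
  unfolding Gamma0_def by auto

text \<open>The set where the norm is at least \<open>\<epsilon>\<close> is closed by upper
  semicontinuity, so containment in some compact set suffices.\<close>

lemma Gamma0I: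
  assumes c: "continuous_map X (total B) a" and p: "\<And>x. x \<in> topspace X \<Longrightarrow> proj B (a x) = x"
    and v: "\<And>\<epsilon>::real. 0 < \<epsilon> \<Longrightarrow>
      \<exists>K. compactin X K \<and> (\<forall>x\<in>topspace X - K. cnorm (fib B x) (a x) < \<epsilon>)"
  shows "restrict a (topspace X) \<in> Gamma0 X B"
  unfolding Gamma0_def
proof (intro CollectI conjI ballI allI impI)
  show "continuous_map X (total B) (restrict a (topspace X))"
    by (rule continuous_map_eq[OF c]) simp
  fix \<epsilon> :: real assume e: "0 < \<epsilon>"
  obtain K where K: "compactin X K" "\<forall>x\<in>topspace X - K. cnorm (fib B x) (a x) < \<epsilon>" using v[OF e] by blast
  let ?S = "{x \<in> topspace X. \<epsilon> \<le> cnorm (fib B x) (restrict a (topspace X) x)}"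
  have "?S = topspace X - {x \<in> topspace X. bnorm (a x) < \<epsilon>}" using p by auto
  then have "closedin X ?S" by (simp only:) (intro closedin_diff closedin_topspace openin_bnorm_less c)
  moreover have "?S \<subseteq> K" using K(2) by force
  ultimately show "compactin X ?S" using closed_compactin[OF K(1)] by blast
qed (use p in auto)

text \<open>The norm is below 1 off a compact set and bounded on that set.\<close>

lemma bounded_on_Gamma0:
  assumes a: "a \<in> Gamma0 X B"
  obtains C where "0 < C" "\<And>x. x \<in> topspace X \<Longrightarrow> cnorm (fib B x) (a x) \<le> C"
proof -
  note a' = Gamma0D[OF a]
  obtain C where C: "0 < C" "\<And>x. x \<in> {x \<in> topspace X. 1 \<le> cnorm (fib B x) (a x)} \<Longrightarrow> bnorm (a x) \<le> C"
    using bnorm_bounded_on_compact[OF a'(2) a'(5)[OF zero_less_one]] by blast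
  show thesis
  proof (rule that[of "max C 1"])
    show "cnorm (fib B x) (a x) \<le> max C 1" if "x \<in> topspace X" for x
      using C(2)[of x] a'(3)[OF that] that by fastforce
  qed simp
qed

lemma carrier_section_algebra [simp]: "carrier (section_algebra X B) = Gamma0 X B"
  by (simp add: section_algebra_def)

lemma section_algebra_simps:
  "a \<otimes>\<^bsub>section_algebra X B\<^esub> b = (\<lambda>x\<in>topspace X. a x \<otimes>\<^bsub>fib B x\<^esub> b x)"
  "a \<oplus>\<^bsub>section_algebra X B\<^esub> b = (\<lambda>x\<in>topspace X. a x \<oplus>\<^bsub>fib B x\<^esub> b x)"
  "k \<odot>\<^bsub>section_algebra X B\<^esub> a = (\<lambda>x\<in>topspace X. k \<odot>\<^bsub>fib B x\<^esub> a x)"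
  "star (section_algebra X B) a = (\<lambda>x\<in>topspace X. star (fib B x) (a x))"
  "\<zero>\<^bsub>section_algebra X B\<^esub> = (\<lambda>x\<in>topspace X. \<zero>\<^bsub>fib B x\<^esub>)"
  "cnorm (section_algebra X B) a = Sup (insert 0 ((\<lambda>x. cnorm (fib B x) (a x)) ` topspace X))"
  by (simp_all add: section_algebra_def)

lemma Gamma0_ext:
  "\<lbrakk>a \<in> Gamma0 X B; b \<in> Gamma0 X B; \<And>x. x \<in> topspace X \<Longrightarrow> a x = b x\<rbrakk> \<Longrightarrow> a = b"
  by (meson Gamma0D(1) extensionalityI)

lemma proj_ops:
  assumes x: "x \<in> topspace X" and a: "a \<in> carrier (fib B x)" and b: "b \<in> carrier (fib B x)"
  shows "proj B (a \<oplus>\<^bsub>fib B x\<^esub> b) = x" "proj B (a \<otimes>\<^bsub>fib B x\<^esub> b) = x"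
    "proj B (k \<odot>\<^bsub>fib B x\<^esub> a) = x" "proj B (star (fib B x) a) = x" "proj B \<zero>\<^bsub>fib B x\<^esub> = x"
proof -
  interpret F: cstar_algebra "fib B x" using fib_cstar[OF x] .
  have "a \<oplus>\<^bsub>fib B x\<^esub> b \<in> carrier (fib B x)" "a \<otimes>\<^bsub>fib B x\<^esub> b \<in> carrier (fib B x)"
    "k \<odot>\<^bsub>fib B x\<^esub> a \<in> carrier (fib B x)" "star (fib B x) a \<in> carrier (fib B x)"
    using a b by (auto simp: F.mult_closed F.smult_closed F.star_closed)
  then show "proj B (a \<oplus>\<^bsub>fib B x\<^esub> b) = x" "proj B (a \<otimes>\<^bsub>fib B x\<^esub> b) = x"
    "proj B (k \<odot>\<^bsub>fib B x\<^esub> a) = x" "proj B (star (fib B x) a) = x" "proj B \<zero>\<^bsub>fib B x\<^esub> = x"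
    using carrier_fib[OF x] F.zero_closed by auto
qed

lemma Gamma0_zero: "(\<lambda>x\<in>topspace X. \<zero>\<^bsub>fib B x\<^esub>) \<in> Gamma0 X B"
proof (rule Gamma0I[OF continuous_map_zero_section])
  show "proj B \<zero>\<^bsub>fib B x\<^esub> = x" if "x \<in> topspace X" for x
    using carrier_fib[OF that] abelian_monoid.zero_closed[of "fib B x"] fib_cstar[OF that]
    by (simp add: cstar_algebra_def abelian_group_def)
  show "\<exists>K. compactin X K \<and> (\<forall>x\<in>topspace X - K. cnorm (fib B x) \<zero>\<^bsub>fib B x\<^esub> < \<epsilon>)" if "0 < \<epsilon>" for \<epsilon> :: real
    using that by (intro exI[of _ "{}"]) (auto simp: cstar_algebra.cnorm_zero fib_cstar)
qed

lemma Gamma0_add: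
  assumes a: "a \<in> Gamma0 X B" and b: "b \<in> Gamma0 X B"
  shows "(\<lambda>x\<in>topspace X. a x \<oplus>\<^bsub>fib B x\<^esub> b x) \<in> Gamma0 X B"
proof (rule Gamma0I)
  note a' = Gamma0D[OF a] and b' = Gamma0D[OF b]
  show "continuous_map X (total B) (\<lambda>x. a x \<oplus>\<^bsub>fib B x\<^esub> b x)"
    by (rule continuous_map_eq[OF continuous_map_add[OF a'(2) b'(2)]]) (simp_all add: a'(3) b'(3))
  show "proj B (a x \<oplus>\<^bsub>fib B x\<^esub> b x) = x" if "x \<in> topspace X" for x
    using that a'(4) b'(4) by (simp add: proj_ops)
  fix \<epsilon> :: real assume "0 < \<epsilon>"
  then have e: "0 < \<epsilon> / 2" by simp
  show "\<exists>K. compactin X K \<and> (\<forall>x\<in>topspace X - K. cnorm (fib B x) (a x \<oplus>\<^bsub>fib B x\<^esub> b x) < \<epsilon>)"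
  proof (intro exI conjI ballI)
    show "compactin X ({x \<in> topspace X. \<epsilon> / 2 \<le> cnorm (fib B x) (a x)} \<union> {x \<in> topspace X. \<epsilon> / 2 \<le> cnorm (fib B x) (b x)})"
      by (intro compactin_Un a'(5)[OF e] b'(5)[OF e])
    fix x assume "x \<in> topspace X - ({x \<in> topspace X. \<epsilon> / 2 \<le> cnorm (fib B x) (a x)} \<union> {x \<in> topspace X. \<epsilon> / 2 \<le> cnorm (fib B x) (b x)})"
    then have x: "x \<in> topspace X" and "cnorm (fib B x) (a x) < \<epsilon> / 2" "cnorm (fib B x) (b x) < \<epsilon> / 2" by auto
    then show "cnorm (fib B x) (a x \<oplus>\<^bsub>fib B x\<^esub> b x) < \<epsilon>"
      using cstar_algebra.cnorm_add[OF fib_cstar[OF x] a'(4)[OF x] b'(4)[OF x]] by linarith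
  qed
qed

lemma Gamma0_smult:
  assumes f: "continuous_map X euclidean f" and a: "a \<in> Gamma0 X B"
    and bd: "\<And>x. x \<in> topspace X \<Longrightarrow> cmod (f x) \<le> C"
  shows "(\<lambda>x\<in>topspace X. f x \<odot>\<^bsub>fib B x\<^esub> a x) \<in> Gamma0 X B"
proof (rule Gamma0I)
  note a' = Gamma0D[OF a]
  show "continuous_map X (total B) (\<lambda>x. f x \<odot>\<^bsub>fib B x\<^esub> a x)"
    by (rule continuous_map_eq[OF continuous_map_smult[OF f a'(2)]]) (simp_all add: a'(3))
  show "proj B (f x \<odot>\<^bsub>fib B x\<^esub> a x) = x" if "x \<in> topspace X" for x
    using that a'(4) proj_ops(3) by blast
  fix \<epsilon> :: real assume \<epsilon>: "0 < \<epsilon>"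
  define D where "D = max C 1"
  have D: "D > 0" "C \<le> D" by (auto simp: D_def)
  then have e: "0 < \<epsilon> / D" using \<epsilon> by simp
  show "\<exists>K. compactin X K \<and> (\<forall>x\<in>topspace X - K. cnorm (fib B x) (f x \<odot>\<^bsub>fib B x\<^esub> a x) < \<epsilon>)"
  proof (intro exI conjI ballI)
    show "compactin X {x \<in> topspace X. \<epsilon> / D \<le> cnorm (fib B x) (a x)}" by (rule a'(5)[OF e])
    fix x assume "x \<in> topspace X - {x \<in> topspace X. \<epsilon> / D \<le> cnorm (fib B x) (a x)}"
    then have x: "x \<in> topspace X" "cnorm (fib B x) (a x) < \<epsilon> / D" by auto
    interpret F: cstar_algebra "fib B x" using fib_cstar[OF x(1)] .
    have "cmod (f x) * cnorm (fib B x) (a x) \<le> D * cnorm (fib B x) (a x)"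
      using bd[OF x(1)] D(2) by (intro mult_right_mono F.cnorm_nonneg a'(4) x(1)) linarith
    also have "\<dots> < \<epsilon>" using x(2) D(1) by (simp add: field_simps)
    finally show "cnorm (fib B x) (f x \<odot>\<^bsub>fib B x\<^esub> a x) < \<epsilon>" using a'(4)[OF x(1)] by (simp add: F.cnorm_smult)
  qed
qed

lemma Gamma0_star:
  assumes a: "a \<in> Gamma0 X B"
  shows "(\<lambda>x\<in>topspace X. star (fib B x) (a x)) \<in> Gamma0 X B"
proof (rule Gamma0I)
  note a' = Gamma0D[OF a]
  show "continuous_map X (total B) (\<lambda>x. star (fib B x) (a x))"
    by (rule continuous_map_eq[OF continuous_map_star[OF a'(2)]]) (simp_all add: a'(3))
  show "proj B (star (fib B x) (a x)) = x" if "x \<in> topspace X" for x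
    using that a'(4) proj_ops(4) by blast
  fix \<epsilon> :: real assume \<epsilon>: "0 < \<epsilon>"
  show "\<exists>K. compactin X K \<and> (\<forall>x\<in>topspace X - K. cnorm (fib B x) (star (fib B x) (a x)) < \<epsilon>)"
    using a'(5)[OF \<epsilon>] cstar_algebra.cnorm_star[OF fib_cstar a'(4)] by force
qed

text \<open>The bounded section \<open>\<sigma>\<close> need not vanish at infinity: it is a multiplier of the section algebra.\<close>

lemma
  assumes \<sigma>: "continuous_map X (total B) \<sigma>" "\<And>x. x \<in> topspace X \<Longrightarrow> proj B (\<sigma> x) = x"
    and bd: "\<And>x. x \<in> topspace X \<Longrightarrow> cnorm (fib B x) (\<sigma> x) \<le> C" and a: "a \<in> Gamma0 X B"
  shows Gamma0_mult_left: "(\<lambda>x\<in>topspace X. \<sigma> x \<otimes>\<^bsub>fib B x\<^esub> a x) \<in> Gamma0 X B"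
    and Gamma0_mult_right: "(\<lambda>x\<in>topspace X. a x \<otimes>\<^bsub>fib B x\<^esub> \<sigma> x) \<in> Gamma0 X B"
proof -
  note a' = Gamma0D[OF a]
  have \<sigma>c: "\<sigma> x \<in> carrier (fib B x)" if "x \<in> topspace X" for x
    using continuous_map_funspace[OF \<sigma>(1)] \<sigma>(2)[OF that] that carrier_fib by auto
  define D where "D = max C 1"
  have D: "D > 0" "C \<le> D" by (auto simp: D_def)
  have small: "cnorm (fib B x) (\<sigma> x \<otimes>\<^bsub>fib B x\<^esub> a x) < \<epsilon> \<and> cnorm (fib B x) (a x \<otimes>\<^bsub>fib B x\<^esub> \<sigma> x) < \<epsilon>"
    if "x \<in> topspace X - {x \<in> topspace X. \<epsilon> / D \<le> cnorm (fib B x) (a x)}" for x \<epsilon>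
  proof -
    from that have x: "x \<in> topspace X" "cnorm (fib B x) (a x) < \<epsilon> / D" by auto
    interpret F: cstar_algebra "fib B x" using fib_cstar[OF x(1)] .
    have "cnorm (fib B x) (\<sigma> x) * cnorm (fib B x) (a x) \<le> D * cnorm (fib B x) (a x)"
      using bd[OF x(1)] D(2) by (intro mult_right_mono F.cnorm_nonneg a'(4) x(1)) linarith
    also have "\<dots> < \<epsilon>" using x(2) D(1) by (simp add: field_simps)
    finally show ?thesis
      using F.cnorm_mult[OF \<sigma>c[OF x(1)] a'(4)[OF x(1)]] F.cnorm_mult[OF a'(4)[OF x(1)] \<sigma>c[OF x(1)]]
      by (simp add: mult.commute)
  qed
  show "(\<lambda>x\<in>topspace X. \<sigma> x \<otimes>\<^bsub>fib B x\<^esub> a x) \<in> Gamma0 X B"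
  proof (rule Gamma0I)
    show "continuous_map X (total B) (\<lambda>x. \<sigma> x \<otimes>\<^bsub>fib B x\<^esub> a x)"
      by (rule continuous_map_eq[OF continuous_map_mult[OF \<sigma>(1) a'(2)]]) (simp_all add: a'(3) \<sigma>(2))
    show "proj B (\<sigma> x \<otimes>\<^bsub>fib B x\<^esub> a x) = x" if "x \<in> topspace X" for x
      using that a'(4) \<sigma>c proj_ops(2) by blast
    show "\<exists>K. compactin X K \<and> (\<forall>x\<in>topspace X - K. cnorm (fib B x) (\<sigma> x \<otimes>\<^bsub>fib B x\<^esub> a x) < \<epsilon>)" if "0 < \<epsilon>" for \<epsilon> :: real
      using a'(5)[of "\<epsilon> / D"] that D small[of _ \<epsilon>]
      by (intro exI[of _ "{x \<in> topspace X. \<epsilon> / D \<le> cnorm (fib B x) (a x)}"]) simp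
  qed
  show "(\<lambda>x\<in>topspace X. a x \<otimes>\<^bsub>fib B x\<^esub> \<sigma> x) \<in> Gamma0 X B"
  proof (rule Gamma0I)
    show "continuous_map X (total B) (\<lambda>x. a x \<otimes>\<^bsub>fib B x\<^esub> \<sigma> x)"
      by (rule continuous_map_eq[OF continuous_map_mult[OF a'(2) \<sigma>(1)]]) (simp_all add: a'(3) \<sigma>(2))
    show "proj B (a x \<otimes>\<^bsub>fib B x\<^esub> \<sigma> x) = x" if "x \<in> topspace X" for x
      using that a'(4) \<sigma>c proj_ops(2) by blast
    show "\<exists>K. compactin X K \<and> (\<forall>x\<in>topspace X - K. cnorm (fib B x) (a x \<otimes>\<^bsub>fib B x\<^esub> \<sigma> x) < \<epsilon>)" if "0 < \<epsilon>" for \<epsilon> :: real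
      using a'(5)[of "\<epsilon> / D"] that D small[of _ \<epsilon>]
      by (intro exI[of _ "{x \<in> topspace X. \<epsilon> / D \<le> cnorm (fib B x) (a x)}"]) simp
  qed
qed

lemma Gamma0_mult:
  assumes a: "a \<in> Gamma0 X B" and b: "b \<in> Gamma0 X B"
  shows "(\<lambda>x\<in>topspace X. a x \<otimes>\<^bsub>fib B x\<^esub> b x) \<in> Gamma0 X B"
  by (rule bounded_on_Gamma0[OF a]) (rule Gamma0_mult_left[OF Gamma0D(2,3)[OF a] _ b])

lemma Gamma0_uminus:
  assumes a: "a \<in> Gamma0 X B"
  shows "(\<lambda>x\<in>topspace X. (- 1) \<odot>\<^bsub>fib B x\<^esub> a x) \<in> Gamma0 X B"
  using Gamma0_smult[of "\<lambda>_. - 1" a 1] a by simp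

text \<open>Needed so that the difference in \<open>section_algebra\<close>, which enters
  \<open>cdist\<close>, can be computed fibrewise.\<close>

lemma abelian_group_section_algebra: "abelian_group (section_algebra X B)"
proof (rule abelian_groupI)
  let ?A = "section_algebra X B"
  have F: "abelian_group (fib B x)" if "x \<in> topspace X" for x
    using fib_cstar[OF that] by (simp add: cstar_algebra_def)
  then have M: "abelian_monoid (fib B x)" if "x \<in> topspace X" for x
    using that by (simp add: abelian_group_def)
  fix a b c assume c: "a \<in> carrier ?A" "b \<in> carrier ?A" "c \<in> carrier ?A"
  then show "a \<oplus>\<^bsub>?A\<^esub> b \<in> carrier ?A" by (simp add: section_algebra_simps Gamma0_add)
  show "(a \<oplus>\<^bsub>?A\<^esub> b) \<oplus>\<^bsub>?A\<^esub> c = a \<oplus>\<^bsub>?A\<^esub> (b \<oplus>\<^bsub>?A\<^esub> c)" "a \<oplus>\<^bsub>?A\<^esub> b = b \<oplus>\<^bsub>?A\<^esub> a"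
    using c Gamma0D(4) abelian_monoid.a_assoc[OF M] abelian_monoid.a_comm[OF M]
    by (auto simp: section_algebra_simps intro!: restrict_ext)
  show "\<zero>\<^bsub>?A\<^esub> \<oplus>\<^bsub>?A\<^esub> a = a"
    using c(1) Gamma0D(1,4)[of a] abelian_monoid.l_zero[OF M]
    by (intro extensionalityI[of _ "topspace X"]) (auto simp: section_algebra_simps)
  show "\<exists>b\<in>carrier ?A. b \<oplus>\<^bsub>?A\<^esub> a = \<zero>\<^bsub>?A\<^esub>"
  proof
    let ?b = "\<lambda>x\<in>topspace X. (- 1) \<odot>\<^bsub>fib B x\<^esub> a x"
    show "?b \<in> carrier ?A" using c(1) by (simp add: Gamma0_uminus)
    have "(- 1) \<odot>\<^bsub>fib B x\<^esub> a x \<oplus>\<^bsub>fib B x\<^esub> a x = \<zero>\<^bsub>fib B x\<^esub>" if "x \<in> topspace X" for x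
      using c(1) that Gamma0D(4)[of a] abelian_group.l_neg[OF F] by (simp flip: cstar_algebra.uminus_eq_smult[OF fib_cstar])
    then show "?b \<oplus>\<^bsub>?A\<^esub> a = \<zero>\<^bsub>?A\<^esub>" by (auto simp: section_algebra_simps intro!: restrict_ext)
  qed
qed (simp add: section_algebra_simps Gamma0_zero)

lemma section_diff:
  assumes a: "a \<in> Gamma0 X B" and b: "b \<in> Gamma0 X B"
  shows "a \<ominus>\<^bsub>section_algebra X B\<^esub> b = (\<lambda>x\<in>topspace X. a x \<ominus>\<^bsub>fib B x\<^esub> b x)"
proof -
  interpret A: abelian_group "section_algebra X B" by (rule abelian_group_section_algebra)
  let ?c = "\<lambda>x\<in>topspace X. (- 1) \<odot>\<^bsub>fib B x\<^esub> b x"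
  have F: "abelian_group (fib B x)" if "x \<in> topspace X" for x
    using fib_cstar[OF that] by (simp add: cstar_algebra_def)
  have u: "(- 1) \<odot>\<^bsub>fib B x\<^esub> b x = \<ominus>\<^bsub>fib B x\<^esub> b x" if "x \<in> topspace X" for x
    using that Gamma0D(4)[OF b] by (simp flip: cstar_algebra.uminus_eq_smult[OF fib_cstar])
  have "?c \<oplus>\<^bsub>section_algebra X B\<^esub> b = \<zero>\<^bsub>section_algebra X B\<^esub>"
    using Gamma0D(4)[OF b] abelian_group.l_neg[OF F] u by (auto simp: section_algebra_simps intro!: restrict_ext)
  then have "\<ominus>\<^bsub>section_algebra X B\<^esub> b = ?c"
    using b by (intro A.minus_equality) (simp_all add: Gamma0_uminus)
  then show ?thesis using u by (auto simp: a_minus_def section_algebra_simps intro!: restrict_ext)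
qed

lemma Gamma0_diff:
  assumes "a \<in> Gamma0 X B" "b \<in> Gamma0 X B"
  shows "(\<lambda>x\<in>topspace X. a x \<ominus>\<^bsub>fib B x\<^esub> b x) \<in> Gamma0 X B"
  using abelian_group.minus_closed[OF abelian_group_section_algebra, of a b] assms by (simp add: section_diff)

lemma cnorm_section_upper:
  assumes a: "a \<in> Gamma0 X B" and x: "x \<in> topspace X"
  shows "cnorm (fib B x) (a x) \<le> cnorm (section_algebra X B) a"
proof -
  obtain C where C: "0 < C" "\<And>x. x \<in> topspace X \<Longrightarrow> cnorm (fib B x) (a x) \<le> C"
    by (rule bounded_on_Gamma0[OF a]) (rule that)
  then have "bdd_above (insert 0 ((\<lambda>x. cnorm (fib B x) (a x)) ` topspace X))"
    by (intro bdd_aboveI[of _ C]) auto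
  then show ?thesis unfolding section_algebra_simps using x by (intro cSup_upper) auto
qed

lemma cnorm_section_least:
  assumes "\<And>x. x \<in> topspace X \<Longrightarrow> cnorm (fib B x) (a x) \<le> C" "0 \<le> C"
  shows "cnorm (section_algebra X B) a \<le> C"
  unfolding section_algebra_simps using assms by (intro cSup_least) auto

lemma cnorm_section_nonneg: "a \<in> Gamma0 X B \<Longrightarrow> 0 \<le> cnorm (section_algebra X B) a"
proof -
  assume a: "a \<in> Gamma0 X B"
  obtain C where C: "0 < C" "\<And>x. x \<in> topspace X \<Longrightarrow> cnorm (fib B x) (a x) \<le> C"
    by (rule bounded_on_Gamma0[OF a]) (rule that)
  then have "bdd_above (insert 0 ((\<lambda>x. cnorm (fib B x) (a x)) ` topspace X))"
    by (intro bdd_aboveI[of _ C]) auto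
  then show ?thesis unfolding section_algebra_simps by (intro cSup_upper) auto
qed

text \<open>Each law passes from the fibres to the supremum by \<open>cnorm_section_upper\<close>
  and \<open>cnorm_section_least\<close>. Density is then a statement about balls, because
  \<open>norm_topology\<close> is the topology of this metric.\<close>

lemma metric_section_algebra: "Metric_space (Gamma0 X B) (cdist (section_algebra X B))"
proof
  let ?A = "section_algebra X B"
  have d: "cdist ?A a b = cnorm ?A (\<lambda>x\<in>topspace X. a x \<ominus>\<^bsub>fib B x\<^esub> b x)"
    if "a \<in> Gamma0 X B" "b \<in> Gamma0 X B" for a b
    using that by (simp add: cdist_def section_diff)
  have le: "cdist ?A a b \<le> cdist ?A b a" if "a \<in> Gamma0 X B" "b \<in> Gamma0 X B" for a b
    unfolding d[OF that]
  proof (rule cnorm_section_least)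
    fix x assume x: "x \<in> topspace X"
    show "cnorm (fib B x) ((\<lambda>x\<in>topspace X. a x \<ominus>\<^bsub>fib B x\<^esub> b x) x) \<le> cdist ?A b a"
      using cnorm_section_upper[OF Gamma0_diff[OF that(2,1)] x] Gamma0D(4)[OF that(1) x] Gamma0D(4)[OF that(2) x] x
      by (simp add: d[OF that(2,1)] cstar_algebra.cnorm_diff_commute[OF fib_cstar, of x "a x" "b x"])
  qed (use that in \<open>simp add: d cnorm_section_nonneg Gamma0_diff\<close>)
  show nn: "0 \<le> cdist ?A a b" for a b
    by (cases "a \<in> Gamma0 X B \<and> b \<in> Gamma0 X B")
      (auto simp: d cnorm_section_nonneg Gamma0_diff, auto simp: cdist_def)
  show "cdist ?A a b = cdist ?A b a" for a b
    using le[of a b] le[of b a] by (cases "a \<in> Gamma0 X B \<and> b \<in> Gamma0 X B") (auto, auto simp: cdist_def)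
  fix a b assume a: "a \<in> Gamma0 X B" and b: "b \<in> Gamma0 X B"
  have up: "cnorm (fib B x) (a x \<ominus>\<^bsub>fib B x\<^esub> b x) \<le> cdist ?A a b" if "x \<in> topspace X"
    "a \<in> Gamma0 X B" "b \<in> Gamma0 X B" for x a b
    using cnorm_section_upper[OF Gamma0_diff[OF that(2,3)] that(1)] that by (simp add: d)
  show "cdist ?A a b = 0 \<longleftrightarrow> a = b"
  proof
    assume 0: "cdist ?A a b = 0"
    show "a = b"
    proof (rule Gamma0_ext[OF a b])
      fix x assume x: "x \<in> topspace X"
      interpret F: cstar_algebra "fib B x" using fib_cstar[OF x] .
      have "a x \<ominus>\<^bsub>fib B x\<^esub> b x = \<zero>\<^bsub>fib B x\<^esub>"
        using up[OF x a b] 0 Gamma0D(4)[OF a x] Gamma0D(4)[OF b x] F.cnorm_nonneg[of "a x \<ominus>\<^bsub>fib B x\<^esub> b x"]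
          F.cnorm_eq_0[of "a x \<ominus>\<^bsub>fib B x\<^esub> b x"] by simp
      then show "a x = b x" using F.diff_eq_zero Gamma0D(4)[OF a x] Gamma0D(4)[OF b x] by blast
    qed
  next
    assume "a = b"
    moreover have "cdist ?A b b \<le> 0" unfolding d[OF b b]
    proof (rule cnorm_section_least)
      fix x assume x: "x \<in> topspace X"
      interpret F: cstar_algebra "fib B x" using fib_cstar[OF x] .
      show "cnorm (fib B x) ((\<lambda>x\<in>topspace X. b x \<ominus>\<^bsub>fib B x\<^esub> b x) x) \<le> 0" using x Gamma0D(4)[OF b x] by simp
    qed simp
    ultimately show "cdist ?A a b = 0" using nn[of b b] by simp
  qed
  fix c assume c: "c \<in> Gamma0 X B"
  show "cdist ?A a c \<le> cdist ?A a b + cdist ?A b c" unfolding d[OF a c]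
  proof (rule cnorm_section_least)
    fix x assume x: "x \<in> topspace X"
    interpret F: cstar_algebra "fib B x" using fib_cstar[OF x] .
    show "cnorm (fib B x) ((\<lambda>x\<in>topspace X. a x \<ominus>\<^bsub>fib B x\<^esub> c x) x) \<le> cdist ?A a b + cdist ?A b c"
      using F.cnorm_triangle[OF Gamma0D(4)[OF a x] Gamma0D(4)[OF b x] Gamma0D(4)[OF c x]]
        up[OF x a b] up[OF x b c] x by simp
  qed (use nn in simp)
qed

subsection \<open>Compactly supported sections\<close>

lemma base_bump:
  assumes K: "compactin X K"
  obtains f where "bump X f" "\<And>x. x \<in> K \<Longrightarrow> f x = 1"
proof -
  obtain f V where "bump X f" "openin X V" "K \<subseteq> V" "\<And>x. x \<in> V \<Longrightarrow> f x = 1"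
    by (rule bump_neighbourhood[OF base_lc base_Hausdorff K openin_topspace compactin_subset_topspace[OF K]]) blast
  then show thesis using that by blast
qed

text \<open>A bump function equal to 1 on \<open>K\<close> reproduces a section vanishing off
  \<open>K\<close>. The support condition is the working form of membership: unlike the product
  form, it is visibly stable under sums.\<close>

lemma Cc_sections_iff:
  "a \<in> Cc_sections X B \<longleftrightarrow>
    a \<in> Gamma0 X B \<and> (\<exists>K. compactin X K \<and> (\<forall>x\<in>topspace X - K. a x = \<zero>\<^bsub>fib B x\<^esub>))"
proof
  assume "a \<in> Cc_sections X B"
  then obtain f b where f: "f \<in> Cc X" and b: "b \<in> Gamma0 X B"
    and a: "a = (\<lambda>x\<in>topspace X. f x \<odot>\<^bsub>fib B x\<^esub> b x)"
    unfolding Cc_sections_def by auto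
  note b' = Gamma0D[OF b]
  obtain K where K: "compactin X K" "\<And>x. \<lbrakk>x \<in> topspace X; x \<notin> K\<rbrakk> \<Longrightarrow> f x = 0"
    by (rule Cc_compact_support[OF f]) (rule that)
  have z: "f x \<odot>\<^bsub>fib B x\<^esub> b x = \<zero>\<^bsub>fib B x\<^esub>" if "x \<in> topspace X" "x \<notin> K" for x
    using K(2)[OF that] b'(4)[OF that(1)] cstar_algebra.smult_zero_left[OF fib_cstar] that by simp
  have "a \<in> Gamma0 X B" unfolding a
  proof (rule Gamma0I)
    show "continuous_map X (total B) (\<lambda>x. f x \<odot>\<^bsub>fib B x\<^esub> b x)"
      using f by (intro continuous_map_eq[OF continuous_map_smult[OF _ b'(2), of f]]) (simp_all add: b'(3) Cc_def)
    show "proj B (f x \<odot>\<^bsub>fib B x\<^esub> b x) = x" if "x \<in> topspace X" for x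
      using that b'(4) proj_ops(3) by blast
    show "\<exists>K. compactin X K \<and> (\<forall>x\<in>topspace X - K. cnorm (fib B x) (f x \<odot>\<^bsub>fib B x\<^esub> b x) < \<epsilon>)" if "0 < \<epsilon>" for \<epsilon> :: real
      using K(1) z that by (intro exI[of _ K]) (auto simp: cstar_algebra.cnorm_zero fib_cstar)
  qed
  then show "a \<in> Gamma0 X B \<and> (\<exists>K. compactin X K \<and> (\<forall>x\<in>topspace X - K. a x = \<zero>\<^bsub>fib B x\<^esub>))"
    using K(1) z by (auto simp: a)
next
  assume "a \<in> Gamma0 X B \<and> (\<exists>K. compactin X K \<and> (\<forall>x\<in>topspace X - K. a x = \<zero>\<^bsub>fib B x\<^esub>))"
  then obtain K where a: "a \<in> Gamma0 X B" and K: "compactin X K" "\<forall>x\<in>topspace X - K. a x = \<zero>\<^bsub>fib B x\<^esub>" by blast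
  obtain f where f: "bump X f" "\<And>x. x \<in> K \<Longrightarrow> f x = 1" by (rule base_bump[OF K(1)]) (rule that)
  have "a = (\<lambda>x\<in>topspace X. complex_of_real (f x) \<odot>\<^bsub>fib B x\<^esub> a x)"
  proof (rule extensionalityI[OF Gamma0D(1)[OF a]])
    fix x assume x: "x \<in> topspace X"
    interpret F: cstar_algebra "fib B x" using fib_cstar[OF x] .
    show "a x = (\<lambda>x\<in>topspace X. complex_of_real (f x) \<odot>\<^bsub>fib B x\<^esub> a x) x"
      using x f(2)[of x] K(2) Gamma0D(4)[OF a x] F.smult_one[of "a x"] by (cases "x \<in> K") auto
  qed simp
  then show "a \<in> Cc_sections X B"
    using bump_Cc[OF f(1)] a unfolding Cc_sections_def by auto
qed

lemma star_subalgebra_Cc_sections: "star_subalgebra (section_algebra X B) (Cc_sections X B)"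
  unfolding star_subalgebra_def
proof (intro conjI ballI allI)
  show "Cc_sections X B \<subseteq> carrier (section_algebra X B)" by (auto simp: Cc_sections_iff)
  show "\<zero>\<^bsub>section_algebra X B\<^esub> \<in> Cc_sections X B"
    unfolding Cc_sections_iff section_algebra_simps using Gamma0_zero by (auto intro!: exI[of _ "{}"])
  fix a assume a: "a \<in> Cc_sections X B"
  then obtain K where a': "a \<in> Gamma0 X B" "compactin X K" "\<forall>x\<in>topspace X - K. a x = \<zero>\<^bsub>fib B x\<^esub>"
    unfolding Cc_sections_iff by blast
  show "star (section_algebra X B) a \<in> Cc_sections X B"
    unfolding Cc_sections_iff section_algebra_simps
    using a' Gamma0_star[OF a'(1)] cstar_algebra.star_zero[OF fib_cstar] by (auto intro!: exI[of _ K])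
  show "k \<odot>\<^bsub>section_algebra X B\<^esub> a \<in> Cc_sections X B" for k
    unfolding Cc_sections_iff section_algebra_simps
    using a' Gamma0_smult[OF _ a'(1), of "\<lambda>_. k" "cmod k"] cstar_algebra.smult_zero_right[OF fib_cstar]
    by (auto intro!: exI[of _ K])
  fix b assume b: "b \<in> Cc_sections X B"
  then obtain L where b': "b \<in> Gamma0 X B" "compactin X L" "\<forall>x\<in>topspace X - L. b x = \<zero>\<^bsub>fib B x\<^esub>"
    unfolding Cc_sections_iff by blast
  have M: "abelian_monoid (fib B x)" if "x \<in> topspace X" for x
    using fib_cstar[OF that] by (simp add: cstar_algebra_def abelian_group_def)
  show "a \<oplus>\<^bsub>section_algebra X B\<^esub> b \<in> Cc_sections X B"
    unfolding Cc_sections_iff section_algebra_simps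
  proof (intro conjI exI[of _ "K \<union> L"] ballI compactin_Un a'(2) b'(2) Gamma0_add a'(1) b'(1))
    fix x assume "x \<in> topspace X - (K \<union> L)"
    then show "(\<lambda>x\<in>topspace X. a x \<oplus>\<^bsub>fib B x\<^esub> b x) x = \<zero>\<^bsub>fib B x\<^esub>"
      using a'(3) b'(3) abelian_monoid.l_zero[OF M] abelian_monoid.zero_closed[OF M] by simp
  qed
  show "a \<otimes>\<^bsub>section_algebra X B\<^esub> b \<in> Cc_sections X B"
    unfolding Cc_sections_iff section_algebra_simps
    using a' Gamma0D(4)[OF b'(1)] Gamma0_mult[OF a'(1) b'(1)] cstar_algebra.mult_zero_left[OF fib_cstar]
    by (auto intro!: exI[of _ K])
qed

text \<open>Multiplication by a bump function that is 1 where the norm is at least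
  \<open>r / 2\<close> changes a section by at most \<open>r / 2\<close>.\<close>

lemma dense_Cc_sections: "dense_in_cstar (section_algebra X B) (Cc_sections X B)"
proof -
  let ?A = "section_algebra X B"
  interpret M: Metric_space "Gamma0 X B" "cdist ?A" by (rule metric_section_algebra)
  have "\<exists>b\<in>Cc_sections X B. b \<in> M.mball a r" if a: "a \<in> Gamma0 X B" and r: "0 < r" for a r
  proof -
    \<comment> \<open>Half of \<open>r\<close>, since the estimate of a supremum is not
      strict.\<close>
    have r2: "0 < r / 2" using r by simp
    note K = Gamma0D(5)[OF a r2]
    obtain f where f: "bump X f" "\<And>x. x \<in> {x \<in> topspace X. r / 2 \<le> cnorm (fib B x) (a x)} \<Longrightarrow> f x = 1"
      by (rule base_bump[OF K]) (rule that)
    let ?b = "\<lambda>x\<in>topspace X. complex_of_real (f x) \<odot>\<^bsub>fib B x\<^esub> a x"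
    have b: "?b \<in> Cc_sections X B" using bump_Cc[OF f(1)] a unfolding Cc_sections_def by auto
    then have b0: "?b \<in> Gamma0 X B" by (simp add: Cc_sections_iff)
    have "cnorm ?A (a \<ominus>\<^bsub>?A\<^esub> ?b) \<le> r / 2" unfolding section_diff[OF a b0]
    proof (rule cnorm_section_least)
      fix x assume x: "x \<in> topspace X"
      interpret F: cstar_algebra "fib B x" using fib_cstar[OF x] .
      have ax: "a x \<in> carrier (fib B x)" by (rule Gamma0D(4)[OF a x])
      have f01: "0 \<le> f x" "f x \<le> 1" using f(1) x by (auto simp: bump_def)
      have "a x \<ominus>\<^bsub>fib B x\<^esub> complex_of_real (f x) \<odot>\<^bsub>fib B x\<^esub> a x = complex_of_real (1 - f x) \<odot>\<^bsub>fib B x\<^esub> a x"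
        using ax by (simp add: F.smult_diff_left F.smult_one)
      then have "cnorm (fib B x) (a x \<ominus>\<^bsub>fib B x\<^esub> complex_of_real (f x) \<odot>\<^bsub>fib B x\<^esub> a x) = (1 - f x) * cnorm (fib B x) (a x)"
        using ax f01 by (simp add: F.cnorm_smult del: of_real_diff)
      also have "\<dots> \<le> r / 2"
      proof (cases "r / 2 \<le> cnorm (fib B x) (a x)")
        case True
        then show ?thesis using f(2)[of x] x r by simp
      next
        case False
        then show ?thesis using f01 F.cnorm_nonneg[OF ax] mult_left_le_one_le[of "cnorm (fib B x) (a x)" "1 - f x"] by simp
      qed
      finally show "cnorm (fib B x) ((\<lambda>x\<in>topspace X. a x \<ominus>\<^bsub>fib B x\<^esub> ?b x) x) \<le> r / 2" using x by simp
    qed (use r in simp)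
    then have "cdist ?A a ?b < r" using a b0 r by (simp add: cdist_def)
    then show ?thesis using a b b0 by (intro bexI[OF _ b]) (simp add: M.in_mball)
  qed
  then show ?thesis
    unfolding dense_in_cstar_def norm_topology_def carrier_section_algebra M.metric_closure_of by auto
qed

end

section \<open>Groupoids with Haar systems\<close>

lemma borel_of_euclidean: "borel_of (euclidean :: 'a::topological_space topology) = borel"
  by (simp add: borel_of_def borel_def)

lemma range_fibreD: "\<gamma> \<in> range_fibre G u \<Longrightarrow> \<gamma> \<in> arrows G \<and> rng G \<gamma> = u"
  by (simp add: range_fibre_def)

section \<open>Topology of the groupoid and compactness from properness\<close>

context lch_groupoid
begin

lemma units_iff: "u \<in> units G \<longleftrightarrow> u \<in> arrows G \<and> rng G u = u"
  using unit_ends rng_closed by (auto simp: unit_space_def intro!: image_eqI[of u "rng G" u])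

lemma rng_unit: "x \<in> arrows G \<Longrightarrow> rng G x \<in> units G"
  using unit_ends rng_closed by (simp add: units_iff)

lemma src_unit: "x \<in> arrows G \<Longrightarrow> src G x \<in> units G"
  using unit_ends src_closed by (simp add: units_iff)

lemma continuous_map_gcomp:
  assumes "continuous_map T (gtop G) f" "continuous_map T (gtop G) g"
    and "\<And>t. t \<in> topspace T \<Longrightarrow> src G (f t) = rng G (g t)"
  shows "continuous_map T (gtop G) (\<lambda>t. gcomp G (f t) (g t))"
proof -
  have "continuous_map T (subtopology (prod_topology (gtop G) (gtop G)) {(x, y). src G x = rng G y}) (\<lambda>t. (f t, g t))"
    using assms by (auto simp: continuous_map_in_subtopology continuous_map_paired)
  from continuous_map_compose[OF this comp_continuous] show ?thesis by (simp add: o_def)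
qed

text \<open>The range of \<open>x\<close> is \<open>x\<close> composed with its inverse, so
  continuity follows from that of the operations.\<close>

lemma rng_continuous: "continuous_map (gtop G) (unit_space G) (rng G)"
proof -
  have "continuous_map (gtop G) (gtop G) (\<lambda>x. gcomp G x (ginv G x))"
    by (intro continuous_map_gcomp inv_continuous) (simp_all add: inv_ends continuous_map_id[unfolded id_def])
  then have "continuous_map (gtop G) (gtop G) (rng G)"
    by (rule continuous_map_eq) (simp add: comp_inv)
  then show ?thesis by (auto simp: unit_space_def continuous_map_in_subtopology)
qed

lemma src_continuous: "continuous_map (gtop G) (unit_space G) (src G)"
proof -
  have "continuous_map (gtop G) (unit_space G) (rng G \<circ> ginv G)"
    by (rule continuous_map_compose[OF inv_continuous rng_continuous])
  then show ?thesis by (rule continuous_map_eq) (simp add: inv_ends)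
qed

lemma unit_space_Hausdorff: "Hausdorff_space (unit_space G)"
  unfolding unit_space_def by (intro Hausdorff_space_subtopology Hausdorff)

lemma range_fibre_closedin: "u \<in> units G \<Longrightarrow> closedin (gtop G) (range_fibre G u)"
proof -
  assume u: "u \<in> units G"
  have "closedin (gtop G) {x \<in> topspace (gtop G). rng G x \<in> {u}}"
    using u by (intro closedin_continuous_map_preimage[OF rng_continuous] closedin_Hausdorff_singleton unit_space_Hausdorff)
  then show ?thesis by (simp add: range_fibre_def)
qed

lemma compactin_closedin: "compactin (gtop G) K \<Longrightarrow> closedin (gtop G) K"
  by (rule compactin_imp_closedin[OF Hausdorff])

lemma gcomp_fibre:
  assumes "\<gamma> \<in> arrows G" "\<eta> \<in> range_fibre G (src G \<gamma>)"
  shows "gcomp G \<gamma> \<eta> \<in> range_fibre G (rng G \<gamma>)" "src G (gcomp G \<gamma> \<eta>) = src G \<eta>"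
    "gcomp G (ginv G \<gamma>) (gcomp G \<gamma> \<eta>) = \<eta>"
proof -
  have e: "\<eta> \<in> arrows G" "rng G \<eta> = src G \<gamma>" using assms(2) by (auto simp: range_fibre_def)
  show "gcomp G \<gamma> \<eta> \<in> range_fibre G (rng G \<gamma>)" "src G (gcomp G \<gamma> \<eta>) = src G \<eta>"
    using assms(1) e comp_closed comp_ends by (auto simp: range_fibre_def)
  have "gcomp G (ginv G \<gamma>) (gcomp G \<gamma> \<eta>) = gcomp G (gcomp G (ginv G \<gamma>) \<gamma>) \<eta>"
    using assms(1) e by (intro comp_assoc[symmetric]) (simp_all add: inv_closed inv_ends)
  also have "\<dots> = \<eta>" using comp_unit[OF e(1)] comp_inv[OF assms(1)] e by simp
  finally show "gcomp G (ginv G \<gamma>) (gcomp G \<gamma> \<eta>) = \<eta>" .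
qed

lemma translation_continuous:
  assumes "\<gamma> \<in> arrows G"
  shows "continuous_map (subtopology (gtop G) (range_fibre G (src G \<gamma>))) (gtop G) (gcomp G \<gamma>)"
  using assms by (intro continuous_map_gcomp continuous_map_from_subtopology)
    (auto simp: range_fibre_def continuous_map_id[unfolded id_def])

text \<open>The source of the compact sets of arrows that carry the integrands. Both ends have to be
  controlled: a compact set of sources alone need not give a compact set of arrows.\<close>

lemma proper_preimage_compactin:
  assumes p: "proper_groupoid G" and K: "compactin (unit_space G) K" and L: "compactin (unit_space G) L"
  shows "compactin (gtop G) {\<gamma> \<in> arrows G. rng G \<gamma> \<in> K \<and> src G \<gamma> \<in> L}"
proof -
  have "compactin (prod_topology (unit_space G) (unit_space G)) (K \<times> L)"
    using K L by (simp add: compactin_Times)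
  then have "compactin (gtop G) {\<gamma> \<in> topspace (gtop G). (rng G \<gamma>, src G \<gamma>) \<in> K \<times> L}"
    using p by (intro compactin_proper_map_preimage) (auto simp: proper_groupoid_def)
  then show ?thesis by simp
qed

end

section \<open>Haar measures on the range fibres and openness of the range map\<close>

locale haar_groupoid = lch_groupoid G + haar_system G lam for G :: "'g groupoid" and lam
begin

abbreviation fibre_measure :: "'g \<Rightarrow> 'g measure" where
  "fibre_measure u \<equiv> restrict_space (lam u) (range_fibre G u)"

lemma space_lam: "u \<in> units G \<Longrightarrow> space (lam u) = arrows G"
  using sets_eq_imp_space_eq[OF sets_lam] by simp

lemma openin_sets_lam: "\<lbrakk>u \<in> units G; openin (gtop G) U\<rbrakk> \<Longrightarrow> U \<in> sets (lam u)"
  by (simp add: sets_lam sets_borel_of_openin)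

lemma closedin_sets_lam: "\<lbrakk>u \<in> units G; closedin (gtop G) S\<rbrakk> \<Longrightarrow> S \<in> sets (lam u)"
proof -
  assume u: "u \<in> units G" and S: "closedin (gtop G) S"
  then have "space (lam u) - (arrows G - S) \<in> sets (lam u)"
    by (intro sets.compl_sets openin_sets_lam) auto
  moreover have "space (lam u) - (arrows G - S) = S" using u closedin_subset[OF S] by (auto simp: space_lam)
  ultimately show ?thesis by simp
qed

lemma range_fibre_sets: "u \<in> units G \<Longrightarrow> range_fibre G u \<in> sets (lam u)"
  by (intro closedin_sets_lam range_fibre_closedin)

lemma space_fibre_measure: "u \<in> units G \<Longrightarrow> space (fibre_measure u) = range_fibre G u"
  by (auto simp: space_restrict_space space_lam range_fibre_def)

text \<open>A point off the range fibre is outside the support and has a null neighbourhood; by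
  second countability, countably many basic null sets cover the complement.\<close>

lemma emeasure_off_fibre:
  assumes u: "u \<in> units G"
  shows "emeasure (lam u) (arrows G - range_fibre G u) = 0"
proof -
  obtain \<B> where B: "countable \<B>" "\<forall>V\<in>\<B>. openin (gtop G) V"
    "\<forall>U x. openin (gtop G) U \<and> x \<in> U \<longrightarrow> (\<exists>V\<in>\<B>. x \<in> V \<and> V \<subseteq> U)"
    using second_countable unfolding second_countable_def by blast
  let ?N = "{V \<in> \<B>. emeasure (lam u) V = 0}"
  have "arrows G - range_fibre G u \<subseteq> \<Union>?N"
  proof
    fix x assume x: "x \<in> arrows G - range_fibre G u"
    then have "x \<notin> msupport (gtop G) (lam u)" using lam_support[OF u] by simp
    then obtain U where U: "openin (gtop G) U" "x \<in> U" "emeasure (lam u) U = 0"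
      using x unfolding msupport_def by (auto simp: not_gr_zero)
    obtain V where V: "V \<in> \<B>" "x \<in> V" "V \<subseteq> U" using B(3) U by blast
    have "emeasure (lam u) V \<le> emeasure (lam u) U" by (rule emeasure_mono[OF V(3) openin_sets_lam[OF u U(1)]])
    then show "x \<in> \<Union>?N" using V U(3) by auto
  qed
  moreover have "\<Union>?N \<in> null_sets (lam u)"
  proof -
    have "(\<Union>V\<in>?N. V) \<in> null_sets (lam u)"
      using B openin_sets_lam[OF u] by (intro null_sets_UN') (auto intro: countable_subset[OF _ B(1)])
    then show ?thesis by simp
  qed
  moreover have "arrows G - range_fibre G u \<in> sets (lam u)"
    using range_fibre_sets[OF u] by (simp flip: space_lam[OF u])
  ultimately show ?thesis using null_sets_subset by blast
qed

lemma sets_fibre_measure: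
  assumes u: "u \<in> units G" and U: "openin (subtopology (gtop G) (range_fibre G u)) U"
  shows "U \<in> sets (fibre_measure u)"
proof -
  obtain V where V: "openin (gtop G) V" "U = V \<inter> range_fibre G u" using U by (auto simp: openin_subtopology)
  then have "U = range_fibre G u \<inter> V" by auto
  then show ?thesis unfolding sets_restrict_space using openin_sets_lam[OF u V(1)] by blast
qed

lemma topspace_fibre: "topspace (subtopology (gtop G) (range_fibre G u)) = range_fibre G u"
  by (auto simp: range_fibre_def)

lemma continuous_map_fibre_measurable:
  assumes u: "u \<in> units G" and f: "continuous_map (subtopology (gtop G) (range_fibre G u)) T f"
  shows "f \<in> measurable (fibre_measure u) (borel_of T)"
proof (rule measurable_sigma_sets[OF sets_borel_of])
  show "f \<in> space (fibre_measure u) \<rightarrow> topspace T"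
    using continuous_map_funspace[OF f, unfolded topspace_fibre] by (simp only: space_fibre_measure[OF u])
  show "f -` U \<inter> space (fibre_measure u) \<in> sets (fibre_measure u)" if "U \<in> {U. openin T U}" for U
  proof (rule sets_fibre_measure[OF u])
    have "f -` U \<inter> space (fibre_measure u) = {x \<in> topspace (subtopology (gtop G) (range_fibre G u)). f x \<in> U}"
      unfolding topspace_fibre by (auto simp: space_fibre_measure[OF u])
    then show "openin (subtopology (gtop G) (range_fibre G u)) (f -` U \<inter> space (fibre_measure u))"
      using openin_continuous_map_preimage[OF f, of U] that by simp
  qed
qed (auto dest: openin_subset)

lemma continuous_map_fibre_borel_measurable:
  assumes "u \<in> units G" "continuous_map (subtopology (gtop G) (range_fibre G u)) euclideanreal f"
  shows "f \<in> borel_measurable (fibre_measure u)"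
  using continuous_map_fibre_measurable[OF assms] by (simp add: borel_of_euclidean)

lemma compactin_fibre_measure:
  assumes u: "u \<in> units G" and K: "compactin (gtop G) K"
  shows "range_fibre G u \<inter> K \<in> sets (fibre_measure u)" "emeasure (fibre_measure u) (range_fibre G u \<inter> K) < \<infinity>"
proof -
  have K': "K \<in> sets (lam u)" by (rule closedin_sets_lam[OF u compactin_closedin[OF K]])
  then show "range_fibre G u \<inter> K \<in> sets (fibre_measure u)" unfolding sets_restrict_space by blast
  have "emeasure (fibre_measure u) (range_fibre G u \<inter> K) = emeasure (lam u) (range_fibre G u \<inter> K)"
    using range_fibre_sets[OF u] by (intro emeasure_restrict_space) auto
  also have "\<dots> \<le> emeasure (lam u) K" by (intro emeasure_mono K') auto
  also have "\<dots> < \<infinity>" by (rule lam_compact[OF u K])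
  finally show "emeasure (fibre_measure u) (range_fibre G u \<inter> K) < \<infinity>" .
qed

lemma integrable_fibre:
  fixes f :: "'g \<Rightarrow> real"
  assumes u: "u \<in> units G" and f: "continuous_map (subtopology (gtop G) (range_fibre G u)) euclideanreal f"
    and K: "compactin (gtop G) K" and bd: "\<And>\<gamma>. \<gamma> \<in> range_fibre G u \<Longrightarrow> \<bar>f \<gamma>\<bar> \<le> C"
    and z: "\<And>\<gamma>. \<lbrakk>\<gamma> \<in> range_fibre G u; \<gamma> \<notin> K\<rbrakk> \<Longrightarrow> f \<gamma> = 0"
  shows "integrable (fibre_measure u) f"
  using bd z
  by (intro integrableI_bounded_set[OF compactin_fibre_measure(1)[OF u K]
        continuous_map_fibre_borel_measurable[OF u f] compactin_fibre_measure(2)[OF u K], of C] AE_I2)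
    (auto simp: space_fibre_measure[OF u])

lemma bump_integrable:
  assumes u: "u \<in> units G" and \<phi>: "bump (gtop G) \<phi>"
  shows "integrable (fibre_measure u) \<phi>"
proof -
  obtain K where K: "compactin (gtop G) K" "\<And>x. \<lbrakk>x \<in> arrows G; x \<notin> K\<rbrakk> \<Longrightarrow> \<phi> x = 0"
    by (rule bump_compact_support[OF \<phi>]) (rule that)
  show ?thesis
    using \<phi> K(2) by (intro integrable_fibre[OF u _ K(1), of _ 1] continuous_map_from_subtopology)
      (auto simp: bump_def range_fibre_def)
qed

lemma bump_integral_nonneg:
  assumes "u \<in> units G" "bump (gtop G) \<phi>"
  shows "0 \<le> (\<integral>\<gamma>. \<phi> \<gamma> \<partial>fibre_measure u)"
  using assms by (intro Bochner_Integration.integral_nonneg) (auto simp: space_fibre_measure bump_def dest!: range_fibreD)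

text \<open>The complement of the range fibre is null, so restriction loses nothing. This links the
  Haar axioms for \<open>lam u\<close> with the restricted measures of
  \<open>is_D_inner\<close>.\<close>

lemma integral_lam_eq:
  fixes f :: "'g \<Rightarrow> 'b::{banach, second_countable_topology}"
  assumes u: "u \<in> units G" and f: "f \<in> borel_measurable (lam u)"
  shows "(\<integral>\<gamma>. f \<gamma> \<partial>fibre_measure u) = (\<integral>\<gamma>. f \<gamma> \<partial>lam u)"
proof -
  have "(\<integral>\<gamma>. f \<gamma> \<partial>fibre_measure u) = (\<integral>\<gamma>. indicator (range_fibre G u) \<gamma> *\<^sub>R f \<gamma> \<partial>lam u)"
    using range_fibre_sets[OF u] by (intro integral_restrict_space) auto
  also have "\<dots> = (\<integral>\<gamma>. f \<gamma> \<partial>lam u)"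
  proof (rule integral_cong_AE)
    have "arrows G - range_fibre G u \<in> null_sets (lam u)"
      using emeasure_off_fibre[OF u] range_fibre_sets[OF u]
      by (intro null_setsI) (auto simp flip: space_lam[OF u])
    moreover have "{\<gamma> \<in> space (lam u). indicator (range_fibre G u) \<gamma> *\<^sub>R f \<gamma> \<noteq> f \<gamma>} \<subseteq> arrows G - range_fibre G u"
      by (auto simp: space_lam[OF u] indicator_def)
    ultimately show "AE \<gamma> in lam u. indicator (range_fibre G u) \<gamma> *\<^sub>R f \<gamma> = f \<gamma>"
      by (rule AE_I')
  qed (use f range_fibre_sets[OF u] in measurable)
  finally show ?thesis .
qed

lemma continuous_map_lam_borel_measurable:
  fixes f :: "'g \<Rightarrow> 'b::topological_space"
  assumes u: "u \<in> units G" and f: "continuous_map (gtop G) euclidean f"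
  shows "f \<in> borel_measurable (lam u)"
  unfolding borel_of_euclidean[symmetric]
proof (rule measurable_sigma_sets[OF sets_borel_of])
  show "f -` U \<inter> space (lam u) \<in> sets (lam u)" if "U \<in> {U. openin euclidean U}" for U
  proof (rule openin_sets_lam[OF u])
    have "f -` U \<inter> space (lam u) = {x \<in> arrows G. f x \<in> U}" by (auto simp: space_lam[OF u])
    then show "openin (gtop G) (f -` U \<inter> space (lam u))"
      using openin_continuous_map_preimage[OF f, of U] that by simp
  qed
qed auto

text \<open>The Haar axiom concerns complex functions; the real part recovers the real
  integral.\<close>

lemma bump_integral_continuous:
  assumes \<phi>: "bump (gtop G) \<phi>"
  shows "continuous_map (unit_space G) euclideanreal (\<lambda>u. \<integral>\<gamma>. \<phi> \<gamma> \<partial>fibre_measure u)"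
proof -
  have "continuous_map (unit_space G) euclideanreal (Re \<circ> (\<lambda>u. LINT \<gamma>|lam u. complex_of_real (\<phi> \<gamma>)))"
    by (rule continuous_map_compose[OF lam_continuous[OF bump_Cc[OF \<phi>]]]) (simp add: continuous_on_Re)
  moreover have "(Re \<circ> (\<lambda>u. LINT \<gamma>|lam u. complex_of_real (\<phi> \<gamma>))) u = (\<integral>\<gamma>. \<phi> \<gamma> \<partial>fibre_measure u)"
    if "u \<in> units G" for u
    using \<phi> integral_lam_eq[OF that continuous_map_lam_borel_measurable[OF that, of \<phi>]] by (simp add: bump_def)
  ultimately show ?thesis by (rule continuous_map_eq)
qed

text \<open>The integral is continuous in \<open>u\<close> and vanishes unless \<open>u\<close> lies
  in the compact image, under the range map, of a compact set carrying
  \<open>\<phi>\<close>.\<close>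

lemma bump_integral_bounded:
  assumes \<phi>: "bump (gtop G) \<phi>"
  obtains C where "0 < C" "\<And>u. u \<in> units G \<Longrightarrow> (\<integral>\<gamma>. \<phi> \<gamma> \<partial>fibre_measure u) \<le> C"
proof -
  obtain K where K: "compactin (gtop G) K" "\<And>x. \<lbrakk>x \<in> arrows G; x \<notin> K\<rbrakk> \<Longrightarrow> \<phi> x = 0"
    by (rule bump_compact_support[OF \<phi>]) (rule that)
  let ?I = "\<lambda>u. \<integral>\<gamma>. \<phi> \<gamma> \<partial>fibre_measure u"
  have "compactin euclideanreal (?I ` (rng G ` K))"
    by (intro image_compactin[OF image_compactin[OF K(1) rng_continuous] bump_integral_continuous[OF \<phi>]])
  then have "bounded (?I ` (rng G ` K))" by (simp add: compact_imp_bounded)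
  then obtain C where C: "\<And>x. x \<in> K \<Longrightarrow> \<bar>?I (rng G x)\<bar> \<le> C" unfolding bounded_iff by auto
  have "?I u \<le> max C 1" if u: "u \<in> units G" for u
  proof (cases "u \<in> rng G ` K")
    case True
    then show ?thesis using C by fastforce
  next
    case False
    then have "?I u = (\<integral>\<gamma>. 0 \<partial>fibre_measure u)"
      using K(2) by (intro Bochner_Integration.integral_cong refl) (auto simp: space_fibre_measure[OF u] dest!: range_fibreD)
    then show ?thesis by simp
  qed
  then show thesis using that[of "max C 1"] by simp
qed

text \<open>Full support of the Haar measures is the reason. A bump function at
  \<open>\<gamma>\<close> has positive integral over the fibre of \<open>\<gamma>\<close> and, by
  continuity, over nearby fibres; a fibre missing \<open>N\<close> would give integral 0.\<close>

lemma rng_open: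
  assumes N: "openin (gtop G) N" and \<gamma>: "\<gamma> \<in> N"
  obtains U where "openin (unit_space G) U" "rng G \<gamma> \<in> U" "U \<subseteq> rng G ` N"
proof -
  have ga: "\<gamma> \<in> arrows G" using openin_subset[OF N] \<gamma> by blast
  note u = rng_unit[OF ga]
  have c: "compactin (gtop G) {\<gamma>}" using ga by simp
  obtain \<phi> V where \<phi>: "bump (gtop G) \<phi>" "openin (gtop G) V" "{\<gamma>} \<subseteq> V" "\<And>x. x \<in> V \<Longrightarrow> \<phi> x = 1"
    "\<And>x. \<lbrakk>x \<in> arrows G; \<phi> x \<noteq> 0\<rbrakk> \<Longrightarrow> x \<in> N"
    by (rule bump_neighbourhood[OF locally_compact Hausdorff c N]) (use \<gamma> in blast, rule that)
  let ?I = "\<lambda>u. \<integral>\<gamma>. \<phi> \<gamma> \<partial>fibre_measure u"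
  \<comment> \<open>A zero integral would make \<open>V\<close>, where the bump is 1, a null
    neighbourhood of \<open>\<gamma>\<close>, against \<open>lam_support\<close>.\<close>
  have pos: "0 < ?I (rng G \<gamma>)"
  proof (rule ccontr)
    assume "\<not> 0 < ?I (rng G \<gamma>)"
    then have "?I (rng G \<gamma>) = 0" using bump_integral_nonneg[OF u \<phi>(1)] by simp
    then have ae: "AE x in fibre_measure (rng G \<gamma>). \<phi> x = 0"
      using \<phi>(1) by (subst (asm) integral_nonneg_eq_0_iff_AE[OF bump_integrable[OF u \<phi>(1)]])
        (auto intro!: AE_I2 simp: space_fibre_measure[OF u] bump_def dest!: range_fibreD)
    have Vs: "range_fibre G (rng G \<gamma>) \<inter> V \<in> sets (fibre_measure (rng G \<gamma>))"
      unfolding sets_restrict_space using openin_sets_lam[OF u \<phi>(2)] by blast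
    have "AE x in fibre_measure (rng G \<gamma>). x \<notin> range_fibre G (rng G \<gamma>) \<inter> V"
      using ae by eventually_elim (use \<phi>(4) in auto)
    then have "emeasure (fibre_measure (rng G \<gamma>)) (range_fibre G (rng G \<gamma>) \<inter> V) = 0"
      using Vs by (subst (asm) AE_iff_measurable[OF Vs]) (auto dest: sets.sets_into_space)
    then have 1: "emeasure (lam (rng G \<gamma>)) (range_fibre G (rng G \<gamma>) \<inter> V) = 0"
      using range_fibre_sets[OF u] by (subst (asm) emeasure_restrict_space) auto
    have "emeasure (lam (rng G \<gamma>)) V \<le> emeasure (lam (rng G \<gamma>))
        ((range_fibre G (rng G \<gamma>) \<inter> V) \<union> (arrows G - range_fibre G (rng G \<gamma>)))"
      using openin_subset[OF \<phi>(2)] range_fibre_sets[OF u] openin_sets_lam[OF u \<phi>(2)]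
      by (intro emeasure_mono sets.Un sets.Int) (auto simp flip: space_lam[OF u])
    also have "\<dots> \<le> emeasure (lam (rng G \<gamma>)) (range_fibre G (rng G \<gamma>) \<inter> V) +
        emeasure (lam (rng G \<gamma>)) (arrows G - range_fibre G (rng G \<gamma>))"
      using range_fibre_sets[OF u] openin_sets_lam[OF u \<phi>(2)]
      by (intro emeasure_subadditive sets.Int) (auto simp flip: space_lam[OF u])
    finally have "emeasure (lam (rng G \<gamma>)) V = 0" using 1 emeasure_off_fibre[OF u] by simp
    moreover have "\<gamma> \<in> msupport (gtop G) (lam (rng G \<gamma>))"
      unfolding lam_support[OF u] using ga by (simp add: range_fibre_def)
    ultimately show False using \<phi>(2,3) by (auto simp: msupport_def)
  qed
  show thesis
  proof
    show "openin (unit_space G) {u \<in> units G. ?I u \<in> {0<..}}"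
      by (rule openin_continuous_map_preimage[OF bump_integral_continuous[OF \<phi>(1)]]) simp
    show "rng G \<gamma> \<in> {u \<in> units G. ?I u \<in> {0<..}}" using pos u by simp
    show "{u \<in> units G. ?I u \<in> {0<..}} \<subseteq> rng G ` N"
    proof
      fix v assume "v \<in> {u \<in> units G. ?I u \<in> {0<..}}"
      then have v: "v \<in> units G" "?I v \<noteq> 0" by auto
      show "v \<in> rng G ` N"
      proof (rule ccontr)
        assume "v \<notin> rng G ` N"
        then have "?I v = (\<integral>\<gamma>. 0 \<partial>fibre_measure v)"
          using \<phi>(5) by (intro Bochner_Integration.integral_cong refl)
            (auto simp: space_fibre_measure[OF v(1)] dest!: range_fibreD)
        then show False using v(2) by simp
      qed
    qed
  qed
qed

text \<open>Translation by \<open>ginv G \<gamma>\<close> maps the part of the carrier of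
  \<open>\<phi>\<close> in the range fibre to a compact set, so the translate is integrable. The
  Haar axiom is then rewritten in terms of the restricted measures.\<close>

lemma
  assumes \<gamma>: "\<gamma> \<in> arrows G" and \<phi>: "bump (gtop G) \<phi>"
  shows bump_translate_integrable: "integrable (fibre_measure (src G \<gamma>)) (\<lambda>\<eta>. \<phi> (gcomp G \<gamma> \<eta>))"
    and bump_left_invariant:
      "(\<integral>\<eta>. \<phi> (gcomp G \<gamma> \<eta>) \<partial>fibre_measure (src G \<gamma>)) = (\<integral>\<eta>. \<phi> \<eta> \<partial>fibre_measure (rng G \<gamma>))"
proof -
  note u = rng_unit[OF \<gamma>] src_unit[OF \<gamma>] and gi = inv_closed[OF \<gamma>]
  obtain K where K: "compactin (gtop G) K" "\<And>x. \<lbrakk>x \<in> arrows G; x \<notin> K\<rbrakk> \<Longrightarrow> \<phi> x = 0"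
    by (rule bump_compact_support[OF \<phi>]) (rule that)
  \<comment> \<open>Only arrows with range \<open>rng G \<gamma>\<close> can be composed with
    \<open>ginv G \<gamma>\<close> on the left.\<close>
  let ?K = "K \<inter> range_fibre G (rng G \<gamma>)"
  have c: "continuous_map (gtop G) euclideanreal \<phi>" using \<phi> by (simp add: bump_def)
  have "compactin (gtop G) ?K"
    by (rule compact_Int_closedin[OF K(1) range_fibre_closedin[OF u(1)]])
  then have "compactin (subtopology (gtop G) (range_fibre G (rng G \<gamma>))) ?K"
    by (simp add: compactin_subtopology)
  then have cK: "compactin (gtop G) (gcomp G (ginv G \<gamma>) ` ?K)"
    using translation_continuous[OF gi] inv_ends[OF \<gamma>] by (intro image_compactin) auto
  have "\<phi> (gcomp G \<gamma> \<eta>) = 0" if "\<eta> \<in> range_fibre G (src G \<gamma>)" "\<eta> \<notin> gcomp G (ginv G \<gamma>) ` ?K" for \<eta>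
  proof (rule K(2))
    show "gcomp G \<gamma> \<eta> \<in> arrows G" using gcomp_fibre(1)[OF \<gamma> that(1)] by (simp add: range_fibre_def)
    show "gcomp G \<gamma> \<eta> \<notin> K"
      using gcomp_fibre(1,3)[OF \<gamma> that(1)] that(2) by (metis IntI image_eqI)
  qed
  moreover have "continuous_map (subtopology (gtop G) (range_fibre G (src G \<gamma>))) euclideanreal (\<lambda>\<eta>. \<phi> (gcomp G \<gamma> \<eta>))"
    using continuous_map_compose[OF translation_continuous[OF \<gamma>] c] by (simp add: o_def)
  moreover have "\<bar>\<phi> (gcomp G \<gamma> \<eta>)\<bar> \<le> 1" if "\<eta> \<in> range_fibre G (src G \<gamma>)" for \<eta>
    using gcomp_fibre(1)[OF \<gamma> that] \<phi> by (auto simp: range_fibre_def bump_def)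
  ultimately show int: "integrable (fibre_measure (src G \<gamma>)) (\<lambda>\<eta>. \<phi> (gcomp G \<gamma> \<eta>))"
    by (intro integrable_fibre[OF u(2) _ cK, of _ 1])
  have set_eq: "(LINT \<eta>:range_fibre G v|lam v. complex_of_real (f \<eta>)) = complex_of_real (\<integral>\<eta>. f \<eta> \<partial>fibre_measure v)"
    if v: "v \<in> units G" for v f
  proof -
    have "(LINT \<eta>:range_fibre G v|lam v. complex_of_real (f \<eta>)) = (\<integral>\<eta>. complex_of_real (f \<eta>) \<partial>fibre_measure v)"
      unfolding set_lebesgue_integral_def
      using range_fibre_sets[OF v] by (intro integral_restrict_space[symmetric]) auto
    then show ?thesis by simp
  qed
  have "complex_of_real (\<integral>\<eta>. \<phi> (gcomp G \<gamma> \<eta>) \<partial>fibre_measure (src G \<gamma>)) =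
      complex_of_real (\<integral>\<eta>. \<phi> \<eta> \<partial>fibre_measure (rng G \<gamma>))"
    using lam_left_invariant[OF bump_Cc[OF \<phi>] \<gamma>] set_eq[OF u(1), of \<phi>] set_eq[OF u(2), of "\<lambda>\<eta>. \<phi> (gcomp G \<gamma> \<eta>)"]
    by simp
  then show "(\<integral>\<eta>. \<phi> (gcomp G \<gamma> \<eta>) \<partial>fibre_measure (src G \<gamma>)) = (\<integral>\<eta>. \<phi> \<eta> \<partial>fibre_measure (rng G \<gamma>))"
    by (simp only: of_real_eq_iff)
qed

end

section \<open>Integrating sections of a bundle along the range fibres\<close>

context usc_cstar_bundle
begin

lemma continuous_map_fibre_diff:
  assumes f: "continuous_map T (total B) f" and g: "continuous_map T (total B) g"
    and p: "\<And>t. t \<in> topspace T \<Longrightarrow> proj B (f t) = proj B (g t)"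
  shows "continuous_map T (total B) (\<lambda>t. f t \<ominus>\<^bsub>fib B (proj B (f t))\<^esub> g t)"
proof -
  have gc: "g t \<in> carrier (fib B (proj B (g t)))" "proj B (g t) \<in> topspace X" if "t \<in> topspace T" for t
    using continuous_map_funspace[OF g] that proj_in in_fib_proj by blast+
  have "proj B ((- 1) \<odot>\<^bsub>fib B (proj B (g t))\<^esub> g t) = proj B (g t)" if "t \<in> topspace T" for t
    using gc[OF that] proj_ops(3) by blast
  then have "continuous_map T (total B) (\<lambda>t. f t \<oplus>\<^bsub>fib B (proj B (f t))\<^esub> ((- 1) \<odot>\<^bsub>fib B (proj B (g t))\<^esub> g t))"
    using p by (intro continuous_map_add f continuous_map_smult_const g) simp
  then show ?thesis
  proof (rule continuous_map_eq)
    fix t assume t: "t \<in> topspace T"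
    interpret F: cstar_algebra "fib B (proj B (g t))" using fib_cstar gc(2)[OF t] .
    show "f t \<oplus>\<^bsub>fib B (proj B (f t))\<^esub> ((- 1) \<odot>\<^bsub>fib B (proj B (g t))\<^esub> g t) = f t \<ominus>\<^bsub>fib B (proj B (f t))\<^esub> g t"
      using gc(1)[OF t] by (simp add: p[OF t] a_minus_def F.uminus_eq_smult)
  qed
qed

end

section \<open>Sections over the arrows and their Riemann sums\<close>

locale haar_bundle = haar_groupoid G lam + usc_cstar_bundle "unit_space G" B
  for G :: "'g groupoid" and lam and B :: "('g, 'e) cbundle"
begin

text \<open>These are the continuous sections of the pullback of the bundle along the range map. On
  one range fibre they take values in a single C*-algebra and can be integrated there.\<close>

definition pullback_section :: "('g \<Rightarrow> 'e) \<Rightarrow> bool" where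
  "pullback_section F \<longleftrightarrow> continuous_map (gtop G) (total B) F \<and> (\<forall>\<gamma>\<in>arrows G. proj B (F \<gamma>) = rng G \<gamma>)"

lemma pullback_sectionD:
  assumes "pullback_section F"
  shows "continuous_map (gtop G) (total B) F" "\<gamma> \<in> arrows G \<Longrightarrow> proj B (F \<gamma>) = rng G \<gamma>"
    "\<gamma> \<in> arrows G \<Longrightarrow> F \<gamma> \<in> carrier (fib B (rng G \<gamma>))"
    "\<gamma> \<in> range_fibre G u \<Longrightarrow> F \<gamma> \<in> carrier (fib B u)"
proof -
  show 1: "continuous_map (gtop G) (total B) F" and 2: "\<gamma> \<in> arrows G \<Longrightarrow> proj B (F \<gamma>) = rng G \<gamma>" for \<gamma>
    using assms by (auto simp: pullback_section_def)
  show 3: "F \<gamma> \<in> carrier (fib B (rng G \<gamma>))" if "\<gamma> \<in> arrows G" for \<gamma>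
    using continuous_map_funspace[OF 1] 2[OF that] that carrier_fib[OF rng_unit[OF that]] by auto
  show "\<gamma> \<in> range_fibre G u \<Longrightarrow> F \<gamma> \<in> carrier (fib B u)"
    using 3[of \<gamma>] by (auto dest!: range_fibreD)
qed

text \<open>Within one fibre the fixed value \<open>F \<gamma>0\<close> can be subtracted; upper
  semicontinuity makes smallness of the difference an open condition. The measurability demanded by
  \<open>has_cstar_integral\<close> follows from this.\<close>

lemma pullback_section_norm_continuous:
  assumes F: "pullback_section F" and u: "u \<in> units G"
  shows "continuous_map (subtopology (gtop G) (range_fibre G u)) (norm_topology (fib B u)) F"
proof (rule continuous_map_localI)
  interpret A: cstar_algebra "fib B u" using fib_cstar[OF u] .
  note F' = pullback_sectionD[OF F]
  show "F \<gamma> \<in> topspace (norm_topology (fib B u))" if "\<gamma> \<in> topspace (subtopology (gtop G) (range_fibre G u))" for \<gamma>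
    using that F'(4) by (simp add: topspace_fibre)
  fix \<gamma>0 W assume "\<gamma>0 \<in> topspace (subtopology (gtop G) (range_fibre G u))"
    and W: "openin (norm_topology (fib B u)) W" "F \<gamma>0 \<in> W"
  then have \<gamma>0: "\<gamma>0 \<in> range_fibre G u" by (simp only: topspace_fibre)
  obtain r where r: "0 < r" "\<And>y. \<lbrakk>y \<in> carrier (fib B u); cnorm (fib B u) (y \<ominus>\<^bsub>fib B u\<^esub> F \<gamma>0) < r\<rbrakk> \<Longrightarrow> y \<in> W"
    using W unfolding A.openin_norm_topology by blast
  let ?T = "subtopology (gtop G) (range_fibre G u)"
  have pF: "proj B (F \<gamma>) = u" if "\<gamma> \<in> range_fibre G u" for \<gamma>
    using F'(2) range_fibreD[OF that] by simp
  have "continuous_map ?T (total B) (\<lambda>\<gamma>. F \<gamma> \<ominus>\<^bsub>fib B (proj B (F \<gamma>))\<^esub> F \<gamma>0)"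
  proof (rule continuous_map_fibre_diff)
    show "continuous_map ?T (total B) F" by (rule continuous_map_from_subtopology[OF F'(1)])
    show "continuous_map ?T (total B) (\<lambda>_. F \<gamma>0)" using F'(4)[OF \<gamma>0] carrier_fib[OF u] by simp
  qed (use pF[OF \<gamma>0] pF in \<open>simp add: topspace_fibre del: topspace_subtopology\<close>)
  then have "openin ?T {\<gamma> \<in> topspace ?T. bnorm (F \<gamma> \<ominus>\<^bsub>fib B (proj B (F \<gamma>))\<^esub> F \<gamma>0) < r}"
    by (rule openin_bnorm_less)
  also have "{\<gamma> \<in> topspace ?T. bnorm (F \<gamma> \<ominus>\<^bsub>fib B (proj B (F \<gamma>))\<^esub> F \<gamma>0) < r} =
      {\<gamma> \<in> range_fibre G u. cnorm (fib B u) (F \<gamma> \<ominus>\<^bsub>fib B u\<^esub> F \<gamma>0) < r}"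
  proof (intro Collect_cong conj_cong)
    fix \<gamma> assume "\<gamma> \<in> range_fibre G u"
    then have "proj B (F \<gamma> \<ominus>\<^bsub>fib B u\<^esub> F \<gamma>0) = u" "proj B (F \<gamma>) = u"
      using pF carrier_fib[OF u] A.minus_closed[OF F'(4) F'(4)[OF \<gamma>0]] by auto
    then show "bnorm (F \<gamma> \<ominus>\<^bsub>fib B (proj B (F \<gamma>))\<^esub> F \<gamma>0) < r \<longleftrightarrow> cnorm (fib B u) (F \<gamma> \<ominus>\<^bsub>fib B u\<^esub> F \<gamma>0) < r"
      by simp
  qed (simp only: topspace_fibre)
  finally show "\<exists>U. openin ?T U \<and> \<gamma>0 \<in> U \<and> (\<forall>\<gamma>\<in>U. F \<gamma> \<in> W)"
    using r \<gamma>0 F'(4) by (intro exI[of _ "{\<gamma> \<in> range_fibre G u. cnorm (fib B u) (F \<gamma> \<ominus>\<^bsub>fib B u\<^esub> F \<gamma>0) < r}"]) auto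
qed

lemma pullback_section_measurable:
  assumes "pullback_section F" "u \<in> units G"
  shows "F \<in> measurable (fibre_measure u) (borel_of (norm_topology (fib B u)))"
  by (rule continuous_map_fibre_measurable[OF assms(2) pullback_section_norm_continuous[OF assms]])

text \<open>Only arrows with equal range have comparable values. The pairs of such arrows with
  difference below \<open>\<epsilon>\<close> form a relatively open set containing the diagonal
  point, and a product neighbourhood of that point gives \<open>N\<close>.\<close>

lemma pullback_section_oscillation:
  assumes F: "pullback_section F" and \<gamma>0: "\<gamma>0 \<in> arrows G" and \<epsilon>: "(0::real) < \<epsilon>"
  obtains N where "openin (gtop G) N" "\<gamma>0 \<in> N"
    "\<And>\<gamma> \<gamma>'. \<lbrakk>\<gamma> \<in> N; \<gamma>' \<in> N; rng G \<gamma> = rng G \<gamma>'\<rbrakk> \<Longrightarrow>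
      cnorm (fib B (rng G \<gamma>)) (F \<gamma> \<ominus>\<^bsub>fib B (rng G \<gamma>)\<^esub> F \<gamma>') < \<epsilon>"
proof -
  note F' = pullback_sectionD[OF F]
  let ?P = "prod_topology (gtop G) (gtop G)"
  let ?D = "subtopology ?P {(\<gamma>, \<gamma>'). rng G \<gamma> = rng G \<gamma>'}"
  let ?f = "\<lambda>p. F (fst p) \<ominus>\<^bsub>fib B (proj B (F (fst p)))\<^esub> F (snd p)"
  have "continuous_map ?D (total B) ?f"
  proof (rule continuous_map_fibre_diff)
    show "continuous_map ?D (total B) (\<lambda>p. F (fst p))" "continuous_map ?D (total B) (\<lambda>p. F (snd p))"
      using continuous_map_compose[OF continuous_map_fst F'(1), of "gtop G"]
        continuous_map_compose[OF continuous_map_snd F'(1), of "gtop G"]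
      by (auto simp: o_def intro: continuous_map_from_subtopology)
  qed (use F'(2) in auto)
  then have "openin ?D {p \<in> topspace ?D. bnorm (?f p) < \<epsilon>}" by (rule openin_bnorm_less)
  then obtain T where T: "openin ?P T"
    "{p \<in> topspace ?D. bnorm (?f p) < \<epsilon>} = T \<inter> {(\<gamma>, \<gamma>'). rng G \<gamma> = rng G \<gamma>'}"
    unfolding openin_subtopology by blast
  have eq: "bnorm (?f (\<gamma>, \<gamma>')) = cnorm (fib B (rng G \<gamma>)) (F \<gamma> \<ominus>\<^bsub>fib B (rng G \<gamma>)\<^esub> F \<gamma>')"
    if "\<gamma> \<in> arrows G" "\<gamma>' \<in> arrows G" "rng G \<gamma> = rng G \<gamma>'" for \<gamma> \<gamma>'
  proof -
    interpret A: cstar_algebra "fib B (rng G \<gamma>)" using fib_cstar[OF rng_unit[OF that(1)]] .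
    have "F \<gamma> \<ominus>\<^bsub>fib B (rng G \<gamma>)\<^esub> F \<gamma>' \<in> carrier (fib B (rng G \<gamma>))"
      by (rule A.minus_closed[OF F'(3)[OF that(1)] F'(3)[OF that(2), folded that(3)]])
    then show ?thesis using carrier_fib[OF rng_unit[OF that(1)]] F'(2)[OF that(1)] by simp
  qed
  have "(\<gamma>0, \<gamma>0) \<in> {p \<in> topspace ?D. bnorm (?f p) < \<epsilon>}"
    using \<gamma>0 \<epsilon> eq[OF \<gamma>0 \<gamma>0] F'(3)[OF \<gamma>0] rng_unit[OF \<gamma>0] fib_cstar
    by (simp add: cstar_algebra.diff_self cstar_algebra.cnorm_zero)
  then have "(\<gamma>0, \<gamma>0) \<in> T" unfolding T(2) by (rule IntD1)
  from openin_prod_topology_alt[THEN iffD1, rule_format, OF T(1) this] obtain N1 N2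
    where N: "openin (gtop G) N1" "openin (gtop G) N2" "\<gamma>0 \<in> N1" "\<gamma>0 \<in> N2" "N1 \<times> N2 \<subseteq> T"
    by (elim exE conjE) (rule that)
  show thesis
  proof
    show "openin (gtop G) (N1 \<inter> N2)" "\<gamma>0 \<in> N1 \<inter> N2" using N by auto
    fix \<gamma> \<gamma>' assume g: "\<gamma> \<in> N1 \<inter> N2" "\<gamma>' \<in> N1 \<inter> N2" "rng G \<gamma> = rng G \<gamma>'"
    have a: "\<gamma> \<in> arrows G" "\<gamma>' \<in> arrows G" using g openin_subset[OF N(1)] by auto
    have "(\<gamma>, \<gamma>') \<in> T \<inter> {(\<gamma>, \<gamma>'). rng G \<gamma> = rng G \<gamma>'}" using g N(5) by auto
    then have "bnorm (?f (\<gamma>, \<gamma>')) < \<epsilon>" unfolding T(2)[symmetric] by simp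
    then show "cnorm (fib B (rng G \<gamma>)) (F \<gamma> \<ominus>\<^bsub>fib B (rng G \<gamma>)\<^esub> F \<gamma>') < \<epsilon>" using eq[OF a g(3)] by simp
  qed
qed

text \<open>Data for Riemann sums \<open>\<Sum>j. (\<integral> \<phi> j d\<lambda>\<^sup>u) F \<gamma>\<^sub>j\<close> with tags \<open>\<gamma>\<^sub>j \<in> N j\<close> in the range fibre of \<open>u\<close>.
  The dominating function \<open>\<psi>\<close> does not depend on \<open>\<epsilon>\<close>.\<close>

definition riemann_data ::
  "('g \<Rightarrow> 'e) \<Rightarrow> ('g \<Rightarrow> real) \<Rightarrow> real \<Rightarrow> 'g set \<Rightarrow> ('g \<Rightarrow> 'g \<Rightarrow> real) \<Rightarrow> ('g \<Rightarrow> 'g set) \<Rightarrow> bool" where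
  "riemann_data F \<psi> \<epsilon> J \<phi> N \<longleftrightarrow> finite J \<and>
     (\<forall>j\<in>J. bump (gtop G) (\<phi> j) \<and> openin (gtop G) (N j) \<and> j \<in> N j \<and>
        (\<forall>\<gamma>\<in>arrows G. \<phi> j \<gamma> \<noteq> 0 \<longrightarrow> \<gamma> \<in> N j) \<and>
        (\<forall>\<gamma>\<in>N j. \<forall>\<gamma>'\<in>N j. rng G \<gamma> = rng G \<gamma>' \<longrightarrow>
           cnorm (fib B (rng G \<gamma>)) (F \<gamma> \<ominus>\<^bsub>fib B (rng G \<gamma>)\<^esub> F \<gamma>') < \<epsilon>)) \<and>
     (\<forall>\<gamma>\<in>arrows G. (\<Sum>j\<in>J. \<phi> j \<gamma>) \<le> \<psi> \<gamma>)"

text \<open>Every \<open>N j\<close> is shrunk into \<open>W\<close>, where \<open>\<psi>\<close> is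
  1, so that \<open>\<psi>\<close> dominates the partition for every \<open>\<epsilon>\<close>. Only
  the part of \<open>K\<close> over \<open>u\<close> is covered, which places all tags in that
  fibre.\<close>

lemma riemann_data_exists:
  assumes F: "pullback_section F" and u: "u \<in> units G" and K: "compactin (gtop G) K"
    and W: "openin (gtop G) W" "K \<subseteq> W" and \<psi>: "bump (gtop G) \<psi>" "\<And>\<gamma>. \<gamma> \<in> W \<Longrightarrow> \<psi> \<gamma> = 1" and \<epsilon>: "0 < \<epsilon>"
  obtains J \<phi> N V where "riemann_data F \<psi> \<epsilon> J \<phi> N" "J \<subseteq> range_fibre G u"
    "openin (gtop G) V" "K \<inter> range_fibre G u \<subseteq> V" "\<And>\<gamma>. \<gamma> \<in> V \<Longrightarrow> (\<Sum>j\<in>J. \<phi> j \<gamma>) = 1"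
proof -
  have "\<exists>N. openin (gtop G) N \<and> \<gamma> \<in> N \<and> N \<subseteq> W \<and> (\<forall>\<gamma>\<in>N. \<forall>\<gamma>'\<in>N. rng G \<gamma> = rng G \<gamma>' \<longrightarrow>
           cnorm (fib B (rng G \<gamma>)) (F \<gamma> \<ominus>\<^bsub>fib B (rng G \<gamma>)\<^esub> F \<gamma>') < \<epsilon>)"
    if \<gamma>: "\<gamma> \<in> K \<inter> range_fibre G u" for \<gamma>
  proof -
    have ga: "\<gamma> \<in> arrows G" using \<gamma> by (auto dest!: range_fibreD)
    obtain N where N: "openin (gtop G) N" "\<gamma> \<in> N" "\<And>\<gamma> \<gamma>'. \<lbrakk>\<gamma> \<in> N; \<gamma>' \<in> N; rng G \<gamma> = rng G \<gamma>'\<rbrakk> \<Longrightarrow>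
      cnorm (fib B (rng G \<gamma>)) (F \<gamma> \<ominus>\<^bsub>fib B (rng G \<gamma>)\<^esub> F \<gamma>') < \<epsilon>"
      by (rule pullback_section_oscillation[OF F ga \<epsilon>]) (rule that)
    then show ?thesis using \<gamma> W by (intro exI[of _ "N \<inter> W"]) auto
  qed
  then have "\<forall>\<gamma>\<in>K \<inter> range_fibre G u. \<exists>N. openin (gtop G) N \<and> \<gamma> \<in> N \<and> N \<subseteq> W \<and> (\<forall>\<gamma>\<in>N. \<forall>\<gamma>'\<in>N. rng G \<gamma> = rng G \<gamma>' \<longrightarrow>
           cnorm (fib B (rng G \<gamma>)) (F \<gamma> \<ominus>\<^bsub>fib B (rng G \<gamma>)\<^esub> F \<gamma>') < \<epsilon>)" by (intro ballI)
  from bchoice[OF this] obtain N where N: "\<forall>j\<in>K \<inter> range_fibre G u. openin (gtop G) (N j) \<and> j \<in> N j \<and> N j \<subseteq> W \<and>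
      (\<forall>\<gamma>\<in>N j. \<forall>\<gamma>'\<in>N j. rng G \<gamma> = rng G \<gamma>' \<longrightarrow>
           cnorm (fib B (rng G \<gamma>)) (F \<gamma> \<ominus>\<^bsub>fib B (rng G \<gamma>)\<^esub> F \<gamma>') < \<epsilon>)" ..
  have c: "compactin (gtop G) (K \<inter> range_fibre G u)"
    by (rule compact_Int_closedin[OF K range_fibre_closedin[OF u]])
  obtain J \<phi> V where J: "finite J" "J \<subseteq> K \<inter> range_fibre G u" "openin (gtop G) V" "K \<inter> range_fibre G u \<subseteq> V"
    "\<And>j. j \<in> J \<Longrightarrow> bump (gtop G) (\<phi> j)"
    "\<And>j x. \<lbrakk>j \<in> J; x \<in> arrows G; \<phi> j x \<noteq> 0\<rbrakk> \<Longrightarrow> x \<in> N j"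
    "\<And>x. x \<in> arrows G \<Longrightarrow> (\<Sum>j\<in>J. \<phi> j x) \<le> 1" "\<And>x. x \<in> V \<Longrightarrow> (\<Sum>j\<in>J. \<phi> j x) = 1"
    by (rule partition_of_unity[OF locally_compact Hausdorff c, of N]) (use N in blast, rule that)
  \<comment> \<open>In \<open>W\<close> the majorant is 1; outside \<open>W\<close> all partition
    functions vanish.\<close>
  have "(\<Sum>j\<in>J. \<phi> j \<gamma>) \<le> \<psi> \<gamma>" if \<gamma>: "\<gamma> \<in> arrows G" for \<gamma>
  proof (cases "\<gamma> \<in> W")
    case True
    then show ?thesis using \<psi>(2) J(7)[OF \<gamma>] by simp
  next
    case False
    then have "\<phi> j \<gamma> = 0" if "j \<in> J" for j using J(2,6) N \<gamma> that by blast
    then show ?thesis using \<psi>(1) \<gamma> by (simp add: bump_def)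
  qed
  then have "riemann_data F \<psi> \<epsilon> J \<phi> N"
    unfolding riemann_data_def using J N by (intro conjI ballI) blast+
  then show thesis using that J by blast
qed

text \<open>A nonvanishing weight puts \<open>\<gamma>\<close> and the tag \<open>g j\<close> in the
  same \<open>N j\<close> over the same unit, so its term errs by at most
  \<open>\<epsilon> * \<phi> j \<gamma>\<close>. The tags are free within \<open>N j\<close>; in the
  continuity proof they vary with \<open>v\<close>.\<close>

lemma riemann_pointwise:
  assumes F: "pullback_section F" and R: "riemann_data F \<psi> \<epsilon> J \<phi> N" and v: "v \<in> units G"
    and tag: "\<And>j. j \<in> J \<Longrightarrow> g j \<in> N j \<and> g j \<in> range_fibre G v"
    and \<gamma>: "\<gamma> \<in> range_fibre G v" and one: "F \<gamma> = \<zero>\<^bsub>fib B v\<^esub> \<or> (\<Sum>j\<in>J. \<phi> j \<gamma>) = 1" and \<epsilon>: "0 < \<epsilon>"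
  shows "cnorm (fib B v) (F \<gamma> \<ominus>\<^bsub>fib B v\<^esub> (\<Oplus>\<^bsub>fib B v\<^esub>j\<in>J. complex_of_real (\<phi> j \<gamma>) \<odot>\<^bsub>fib B v\<^esub> F (g j))) \<le> \<epsilon> * \<psi> \<gamma>"
proof -
  interpret A: cstar_algebra "fib B v" using fib_cstar[OF v] .
  note F' = pullback_sectionD[OF F]
  have J: "finite J" using R by (simp add: riemann_data_def)
  have ga: "\<gamma> \<in> arrows G" "rng G \<gamma> = v" using range_fibreD[OF \<gamma>] by auto
  have Fg: "F \<gamma> \<in> carrier (fib B v)" by (rule F'(4)[OF \<gamma>])
  have Fj: "F (g j) \<in> carrier (fib B v)" if "j \<in> J" for j using F'(4) tag[OF that] by blast
  \<comment> \<open>Where the weights do not add up to 1, \<open>F \<gamma>\<close> is zero and both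
    sides vanish.\<close>
  have "F \<gamma> = (\<Oplus>\<^bsub>fib B v\<^esub>j\<in>J. complex_of_real (\<phi> j \<gamma>) \<odot>\<^bsub>fib B v\<^esub> F \<gamma>)"
    using one Fg A.finsum_smult_left[OF J Fg, of "\<lambda>j. complex_of_real (\<phi> j \<gamma>)"]
    by (auto simp: A.smult_one simp flip: of_real_sum)
  then have "F \<gamma> \<ominus>\<^bsub>fib B v\<^esub> (\<Oplus>\<^bsub>fib B v\<^esub>j\<in>J. complex_of_real (\<phi> j \<gamma>) \<odot>\<^bsub>fib B v\<^esub> F (g j)) =
      (\<Oplus>\<^bsub>fib B v\<^esub>j\<in>J. complex_of_real (\<phi> j \<gamma>) \<odot>\<^bsub>fib B v\<^esub> F \<gamma> \<ominus>\<^bsub>fib B v\<^esub> complex_of_real (\<phi> j \<gamma>) \<odot>\<^bsub>fib B v\<^esub> F (g j))"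
    using Fg Fj by (subst A.finsum_diff[OF J, symmetric]) (auto intro: A.smult_closed)
  also have "cnorm (fib B v) \<dots> \<le> (\<Sum>j\<in>J. cnorm (fib B v)
      (complex_of_real (\<phi> j \<gamma>) \<odot>\<^bsub>fib B v\<^esub> F \<gamma> \<ominus>\<^bsub>fib B v\<^esub> complex_of_real (\<phi> j \<gamma>) \<odot>\<^bsub>fib B v\<^esub> F (g j)))"
    using Fg Fj by (intro A.cnorm_finsum J) (auto intro!: A.minus_closed A.smult_closed)
  also have "\<dots> \<le> (\<Sum>j\<in>J. \<epsilon> * \<phi> j \<gamma>)"
  proof (rule sum_mono)
    fix j assume j: "j \<in> J"
    have \<phi>: "0 \<le> \<phi> j \<gamma>" using R j ga by (simp add: riemann_data_def bump_def)
    have "cnorm (fib B v) (F \<gamma> \<ominus>\<^bsub>fib B v\<^esub> F (g j)) \<le> \<epsilon>" if "\<phi> j \<gamma> \<noteq> 0"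
    proof -
      have "\<gamma> \<in> N j" "g j \<in> N j" "rng G \<gamma> = rng G (g j)"
        using R j ga that tag[OF j] range_fibreD[of "g j" G v] unfolding riemann_data_def by auto
      then show ?thesis using R j ga(2) unfolding riemann_data_def by (metis less_imp_le)
    qed
    then have "\<phi> j \<gamma> * cnorm (fib B v) (F \<gamma> \<ominus>\<^bsub>fib B v\<^esub> F (g j)) \<le> \<phi> j \<gamma> * \<epsilon>"
      using \<phi> by (cases "\<phi> j \<gamma> = 0") (auto intro: mult_left_mono)
    then show "cnorm (fib B v) (complex_of_real (\<phi> j \<gamma>) \<odot>\<^bsub>fib B v\<^esub> F \<gamma> \<ominus>\<^bsub>fib B v\<^esub> complex_of_real (\<phi> j \<gamma>) \<odot>\<^bsub>fib B v\<^esub> F (g j)) \<le> \<epsilon> * \<phi> j \<gamma>"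
      using \<phi> Fg Fj[OF j] by (simp add: A.cnorm_smult mult.commute flip: A.smult_diff_right)
  qed
  also have "\<dots> \<le> \<epsilon> * \<psi> \<gamma>"
    using R ga \<epsilon> by (simp add: riemann_data_def flip: sum_distrib_left)
  finally show ?thesis .
qed

lemma riemann_sum_integral:
  assumes F: "pullback_section F" and R: "riemann_data F \<psi> \<epsilon> J \<phi> N" and v: "v \<in> units G"
    and tag: "\<And>j. j \<in> J \<Longrightarrow> g j \<in> N j \<and> g j \<in> range_fibre G v"
  shows "has_dominated_integral (fib B v) (fibre_measure v)
      (\<lambda>\<gamma>. \<Oplus>\<^bsub>fib B v\<^esub>j\<in>J. complex_of_real (\<phi> j \<gamma>) \<odot>\<^bsub>fib B v\<^esub> F (g j))
      (\<Oplus>\<^bsub>fib B v\<^esub>j\<in>J. complex_of_real (\<integral>\<gamma>. \<phi> j \<gamma> \<partial>fibre_measure v) \<odot>\<^bsub>fib B v\<^esub> F (g j))"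
proof -
  interpret A: cstar_algebra "fib B v" using fib_cstar[OF v] .
  show ?thesis
    using R tag pullback_sectionD(4)[OF F] unfolding riemann_data_def
    by (intro A.has_dominated_integral_finsum A.has_dominated_integral_smult_const bump_integrable[OF v]) auto
qed

lemma riemann_sum_error:
  assumes F: "pullback_section F" and R: "riemann_data F \<psi> \<epsilon> J \<phi> N" and v: "v \<in> units G"
    and tag: "\<And>j. j \<in> J \<Longrightarrow> g j \<in> N j \<and> g j \<in> range_fibre G v"
    and one: "\<And>\<gamma>. \<gamma> \<in> range_fibre G v \<Longrightarrow> F \<gamma> = \<zero>\<^bsub>fib B v\<^esub> \<or> (\<Sum>j\<in>J. \<phi> j \<gamma>) = 1"
    and \<epsilon>: "0 < \<epsilon>" and \<psi>: "bump (gtop G) \<psi>" and x: "has_dominated_integral (fib B v) (fibre_measure v) F x"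
  shows "cnorm (fib B v) (x \<ominus>\<^bsub>fib B v\<^esub>
      (\<Oplus>\<^bsub>fib B v\<^esub>j\<in>J. complex_of_real (\<integral>\<gamma>. \<phi> j \<gamma> \<partial>fibre_measure v) \<odot>\<^bsub>fib B v\<^esub> F (g j)))
    \<le> \<epsilon> * (\<integral>\<gamma>. \<psi> \<gamma> \<partial>fibre_measure v)"
proof -
  interpret A: cstar_algebra "fib B v" using fib_cstar[OF v] .
  have "cnorm (fib B v) (x \<ominus>\<^bsub>fib B v\<^esub>
      (\<Oplus>\<^bsub>fib B v\<^esub>j\<in>J. complex_of_real (\<integral>\<gamma>. \<phi> j \<gamma> \<partial>fibre_measure v) \<odot>\<^bsub>fib B v\<^esub> F (g j)))
      \<le> (\<integral>\<gamma>. \<epsilon> * \<psi> \<gamma> \<partial>fibre_measure v)"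
    using bump_integrable[OF v \<psi>] riemann_pointwise[OF F R v tag _ one \<epsilon>]
    by (intro A.cnorm_dominated_integral[OF A.has_dominated_integral_diff[OF x riemann_sum_integral[OF F R v tag]]])
      (auto simp: space_fibre_measure[OF v])
  then show ?thesis by simp
qed

lemma support_bump:
  assumes K: "compactin (gtop G) K"
  obtains \<psi> W where "bump (gtop G) \<psi>" "openin (gtop G) W" "K \<subseteq> W" "\<And>\<gamma>. \<gamma> \<in> W \<Longrightarrow> \<psi> \<gamma> = 1"
  by (rule bump_neighbourhood[OF locally_compact Hausdorff K openin_topspace compactin_subset_topspace[OF K]])
    (rule that)

lemma fibre_integral_exists:
  assumes F: "pullback_section F" and v: "v \<in> units G" and K: "compactin (gtop G) K"
    and z: "\<And>\<gamma>. \<lbrakk>\<gamma> \<in> range_fibre G v; \<gamma> \<notin> K\<rbrakk> \<Longrightarrow> F \<gamma> = \<zero>\<^bsub>fib B v\<^esub>"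
  shows "\<exists>x. has_dominated_integral (fib B v) (fibre_measure v) F x"
proof -
  interpret A: cstar_algebra "fib B v" using fib_cstar[OF v] .
  obtain \<psi> W where \<psi>: "bump (gtop G) \<psi>" and W: "openin (gtop G) W" "K \<subseteq> W" "\<And>\<gamma>. \<gamma> \<in> W \<Longrightarrow> \<psi> \<gamma> = 1"
    by (rule support_bump[OF K]) (rule that)
  show ?thesis
  proof (rule A.has_dominated_integral_limit)
    show "F \<in> space (fibre_measure v) \<rightarrow> carrier (fib B v)"
      using pullback_sectionD(4)[OF F] by (auto simp: space_fibre_measure[OF v])
    fix \<epsilon> :: real assume \<epsilon>: "0 < \<epsilon>"
    \<comment> \<open>Adding 1 permits division by \<open>C\<close> and makes the final error
      \<open>\<epsilon> / C * (C - 1)\<close> strictly smaller than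
      \<open>\<epsilon>\<close>.\<close>
    define C where "C = (\<integral>\<gamma>. \<psi> \<gamma> \<partial>fibre_measure v) + 1"
    have C: "0 < C" using bump_integral_nonneg[OF v \<psi>] by (simp add: C_def)
    then have \<delta>: "0 < \<epsilon> / C" using \<epsilon> by simp
    obtain J \<phi> N V where R: "riemann_data F \<psi> (\<epsilon> / C) J \<phi> N" "J \<subseteq> range_fibre G v"
      "openin (gtop G) V" "K \<inter> range_fibre G v \<subseteq> V" "\<And>\<gamma>. \<gamma> \<in> V \<Longrightarrow> (\<Sum>j\<in>J. \<phi> j \<gamma>) = 1"
      by (rule riemann_data_exists[OF F v K W(1,2) \<psi> W(3) \<delta>]) (assumption, rule that)
    have tag: "j \<in> N j \<and> j \<in> range_fibre G v" if "j \<in> J" for j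
      using R(1,2) that by (auto simp: riemann_data_def)
    have one: "F \<gamma> = \<zero>\<^bsub>fib B v\<^esub> \<or> (\<Sum>j\<in>J. \<phi> j \<gamma>) = 1" if "\<gamma> \<in> range_fibre G v" for \<gamma>
      using z[OF that] R(4,5) that by blast
    have "(\<integral>\<gamma>. \<epsilon> / C * \<psi> \<gamma> \<partial>fibre_measure v) = \<epsilon> / C * (C - 1)"
      by (simp add: C_def)
    also have "\<dots> < \<epsilon>" using C \<epsilon> by (simp add: field_simps)
    finally show "\<exists>g y \<psi>. has_dominated_integral (fib B v) (fibre_measure v) g y \<and> integrable (fibre_measure v) \<psi> \<and>
      (\<forall>t\<in>space (fibre_measure v). cnorm (fib B v) (F t \<ominus>\<^bsub>fib B v\<^esub> g t) \<le> \<psi> t) \<and> (\<integral>t. \<psi> t \<partial>fibre_measure v) < \<epsilon>"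
    proof (intro exI conjI ballI)
      show "has_dominated_integral (fib B v) (fibre_measure v)
          (\<lambda>\<gamma>. \<Oplus>\<^bsub>fib B v\<^esub>j\<in>J. complex_of_real (\<phi> j \<gamma>) \<odot>\<^bsub>fib B v\<^esub> F j)
          (\<Oplus>\<^bsub>fib B v\<^esub>j\<in>J. complex_of_real (\<integral>\<gamma>. \<phi> j \<gamma> \<partial>fibre_measure v) \<odot>\<^bsub>fib B v\<^esub> F j)"
        by (rule riemann_sum_integral[OF F R(1) v tag])
      show "integrable (fibre_measure v) (\<lambda>\<gamma>. \<epsilon> / C * \<psi> \<gamma>)"
        by (intro integrable_mult_right bump_integrable[OF v \<psi>])
      show "cnorm (fib B v) (F \<gamma> \<ominus>\<^bsub>fib B v\<^esub> (\<Oplus>\<^bsub>fib B v\<^esub>j\<in>J. complex_of_real (\<phi> j \<gamma>) \<odot>\<^bsub>fib B v\<^esub> F j)) \<le> \<epsilon> / C * \<psi> \<gamma>"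
        if "\<gamma> \<in> space (fibre_measure v)" for \<gamma>
        using that by (intro riemann_pointwise[OF F R(1) v tag _ one \<delta>]) (simp_all only: space_fibre_measure[OF v])
    qed
  qed
qed

lemma riemann_sum_neighbourhood:
  assumes J: "finite J" "J \<subseteq> range_fibre G u0" and u0: "u0 \<in> units G"
    and H: "\<And>j. j \<in> J \<Longrightarrow> pullback_section (H j)"
    and V: "openin (total B) V" "(\<Oplus>\<^bsub>fib B u0\<^esub>j\<in>J. H j j) \<in> V"
  shows "\<exists>U N. openin (unit_space G) U \<and> u0 \<in> U \<and> (\<forall>j\<in>J. openin (gtop G) (N j) \<and> j \<in> N j) \<and>
    (\<forall>u\<in>U. \<forall>g. (\<forall>j\<in>J. g j \<in> N j \<and> g j \<in> range_fibre G u) \<longrightarrow> (\<Oplus>\<^bsub>fib B u\<^esub>j\<in>J. H j (g j)) \<in> V)"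
  using J H V
proof (induction J arbitrary: V rule: finite_induct)
  case empty
  have fe: "(\<Oplus>\<^bsub>fib B u\<^esub>j\<in>{}. h j) = \<zero>\<^bsub>fib B u\<^esub>" if "u \<in> units G" for u and h :: "'g \<Rightarrow> 'e"
    using fib_cstar[OF that] abelian_monoid.finsum_empty by (auto simp: cstar_algebra_def abelian_group_def)
  have "openin (unit_space G) {u \<in> units G. \<zero>\<^bsub>fib B u\<^esub> \<in> V}"
    by (rule openin_continuous_map_preimage[OF continuous_map_zero_section empty.prems(3)])
  then show ?case using empty.prems(4) u0 fe
    by (intro exI[of _ "{u \<in> units G. \<zero>\<^bsub>fib B u\<^esub> \<in> V}"]) auto
next
  case (insert i J)
  interpret A0: cstar_algebra "fib B u0" using fib_cstar[OF u0] .
  have i: "i \<in> range_fibre G u0" and JG: "J \<subseteq> range_fibre G u0" using insert.prems(1) by auto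
  have Hi: "pullback_section (H i)" and HJ: "\<And>j. j \<in> J \<Longrightarrow> pullback_section (H j)" using insert.prems(2) by auto
  have carr: "(\<lambda>j. H j (g j)) \<in> J \<rightarrow> carrier (fib B u)" "H i (g i) \<in> carrier (fib B u)"
    if "\<forall>j\<in>insert i J. g j \<in> range_fibre G u" for g u
    using pullback_sectionD(4)[OF HJ] pullback_sectionD(4)[OF Hi] that by auto
  have s0: "(\<Oplus>\<^bsub>fib B u0\<^esub>j\<in>J. H j j) \<in> carrier (fib B u0)"
    using carr[of "\<lambda>j. j" u0] insert.prems(1) by (intro A0.finsum_closed) auto
  let ?D = "subtopology (prod_topology (total B) (total B)) {(a, b). proj B a = proj B b}"
  have "openin ?D {p \<in> topspace ?D. (\<lambda>(a, b). a \<oplus>\<^bsub>fib B (proj B a)\<^esub> b) p \<in> V}"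
    by (rule openin_continuous_map_preimage[OF add_continuous insert.prems(3)])
  then obtain T where T: "openin (prod_topology (total B) (total B)) T"
    "{p \<in> topspace ?D. (\<lambda>(a, b). a \<oplus>\<^bsub>fib B (proj B a)\<^esub> b) p \<in> V} = T \<inter> {(a, b). proj B a = proj B b}"
    unfolding openin_subtopology by blast
  have "(H i i, \<Oplus>\<^bsub>fib B u0\<^esub>j\<in>J. H j j) \<in> {p \<in> topspace ?D. (\<lambda>(a, b). a \<oplus>\<^bsub>fib B (proj B a)\<^esub> b) p \<in> V}"
  proof -
    have "H i i \<oplus>\<^bsub>fib B u0\<^esub> (\<Oplus>\<^bsub>fib B u0\<^esub>j\<in>J. H j j) \<in> V"
      using insert.prems(4) insert.hyps carr[of "\<lambda>j. j" u0] insert.prems(1) by (subst (asm) A0.finsum_insert) auto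
    then show ?thesis
      using s0 carr(2)[of "\<lambda>j. j" u0] insert.prems(1) carrier_fib[OF u0] by auto
  qed
  then have "(H i i, \<Oplus>\<^bsub>fib B u0\<^esub>j\<in>J. H j j) \<in> T" unfolding T(2) by (rule IntD1)
  from openin_prod_topology_alt[THEN iffD1, rule_format, OF T(1) this] obtain V1 V2
    where V12: "openin (total B) V1" "openin (total B) V2" "H i i \<in> V1" "(\<Oplus>\<^bsub>fib B u0\<^esub>j\<in>J. H j j) \<in> V2" "V1 \<times> V2 \<subseteq> T"
    by (elim exE conjE) (rule that)
  have "\<exists>U N. openin (unit_space G) U \<and> u0 \<in> U \<and> (\<forall>j\<in>J. openin (gtop G) (N j) \<and> j \<in> N j) \<and>
    (\<forall>u\<in>U. \<forall>g. (\<forall>j\<in>J. g j \<in> N j \<and> g j \<in> range_fibre G u) \<longrightarrow> (\<Oplus>\<^bsub>fib B u\<^esub>j\<in>J. H j (g j)) \<in> V2)"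
    by (rule insert.IH[OF JG HJ V12(2,4)])
  then obtain U N where UN: "openin (unit_space G) U" "u0 \<in> U" "\<forall>j\<in>J. openin (gtop G) (N j) \<and> j \<in> N j"
    "\<forall>u\<in>U. \<forall>g. (\<forall>j\<in>J. g j \<in> N j \<and> g j \<in> range_fibre G u) \<longrightarrow> (\<Oplus>\<^bsub>fib B u\<^esub>j\<in>J. H j (g j)) \<in> V2" by blast
  \<comment> \<open>The new tag is confined to the arrows where its term lies in \<open>V1\<close>;
    the old tags keep the sets of the induction hypothesis, which puts their sum in
    \<open>V2\<close>.\<close>
  define N' where "N' = N(i := {\<gamma> \<in> arrows G. H i \<gamma> \<in> V1})"
  have N': "openin (gtop G) (N' j) \<and> j \<in> N' j" if "j \<in> insert i J" for j
    using that UN(3) openin_continuous_map_preimage[OF pullback_sectionD(1)[OF Hi] V12(1)] V12(3) range_fibreD[OF i]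
    by (auto simp: N'_def)
  have "(\<Oplus>\<^bsub>fib B u\<^esub>j\<in>insert i J. H j (g j)) \<in> V"
    if u: "u \<in> U" and g: "\<forall>j\<in>insert i J. g j \<in> N' j \<and> g j \<in> range_fibre G u" for u g
  proof -
    have uX: "u \<in> units G" using openin_subset[OF UN(1)] u by blast
    interpret A: cstar_algebra "fib B u" using fib_cstar[OF uX] .
    have c: "(\<lambda>j. H j (g j)) \<in> J \<rightarrow> carrier (fib B u)" "H i (g i) \<in> carrier (fib B u)"
      using carr[of g u] g by auto
    then have sc: "(\<Oplus>\<^bsub>fib B u\<^esub>j\<in>J. H j (g j)) \<in> carrier (fib B u)" by (intro A.finsum_closed)
    have "\<forall>j\<in>J. g j \<in> N j \<and> g j \<in> range_fibre G u"
      using g insert.hyps(2) by (auto simp: N'_def split: if_splits)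
    then have "(\<Oplus>\<^bsub>fib B u\<^esub>j\<in>J. H j (g j)) \<in> V2" using UN(4) u by blast
    moreover have "H i (g i) \<in> V1" using g by (simp add: N'_def)
    moreover have p: "proj B (H i (g i)) = u" "proj B (\<Oplus>\<^bsub>fib B u\<^esub>j\<in>J. H j (g j)) = u"
      using c(2) sc carrier_fib[OF uX] by auto
    ultimately have "(H i (g i), \<Oplus>\<^bsub>fib B u\<^esub>j\<in>J. H j (g j)) \<in> T \<inter> {(a, b). proj B a = proj B b}"
      using V12(5) by auto
    then have "H i (g i) \<oplus>\<^bsub>fib B u\<^esub> (\<Oplus>\<^bsub>fib B u\<^esub>j\<in>J. H j (g j)) \<in> V"
      unfolding T(2)[symmetric] using p by simp
    then show ?thesis using c insert.hyps by (subst A.finsum_insert) auto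
  qed
  then show ?case using UN(1,2) N' by (intro exI[of _ U] exI[of _ N']) blast
qed

end

section \<open>Proper groupoid dynamical systems\<close>

text \<open>Boundedness implies contractivity: on a self-adjoint \<open>h\<close> the C*-identity gives
  \<open>\<parallel>h^(2^n)\<parallel> = \<parallel>h\<parallel>^(2^n)\<close>, so a bound \<open>C\<close> improves to its \<open>2^n\<close>-th root.\<close>

lemma star_iso_contractive:
  assumes A: "cstar_algebra A" and B: "cstar_algebra B" and iso: "star_iso A B \<phi>"
    and bd: "\<And>x. x \<in> carrier A \<Longrightarrow> cnorm B (\<phi> x) \<le> C * cnorm A x" and x: "x \<in> carrier A"
  shows "cnorm B (\<phi> x) \<le> cnorm A x"
proof -
  interpret A: cstar_algebra A by fact
  interpret B: cstar_algebra B by fact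
  have \<phi>c: "\<phi> y \<in> carrier B" if "y \<in> carrier A" for y
    using iso that by (auto simp: star_iso_def dest: bij_betwE)
  have \<phi>m: "\<phi> (y \<otimes>\<^bsub>A\<^esub> z) = \<phi> y \<otimes>\<^bsub>B\<^esub> \<phi> z" and \<phi>s: "\<phi> (star A y) = star B (\<phi> y)"
    if "y \<in> carrier A" "z \<in> carrier A" for y z
    using iso that by (auto simp: star_iso_def)
  have sa: "cnorm B (\<phi> h) \<le> cnorm A h" if h: "h \<in> carrier A" "star A h = h" for h
  proof (rule ccontr)
    assume "\<not> cnorm B (\<phi> h) \<le> cnorm A h"
    then have gt: "cnorm A h < cnorm B (\<phi> h)" by simp
    \<comment> \<open>\<open>p n\<close> is the power of \<open>h\<close> with exponent
      \<open>2 ^ n\<close>. Squaring preserves self-adjointness, so the C*-identity applies in both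
      algebras at every stage.\<close>
    define p where "p n = ((\<lambda>y. y \<otimes>\<^bsub>A\<^esub> y) ^^ n) h" for n
    have p: "p n \<in> carrier A \<and> star A (p n) = p n \<and> cnorm A (p n) = cnorm A h ^ (2 ^ n) \<and>
        cnorm B (\<phi> (p n)) = cnorm B (\<phi> h) ^ (2 ^ n)" for n
    proof (induction n)
      case 0
      show ?case using h by (simp add: p_def)
    next
      case (Suc n)
      then have c: "p n \<in> carrier A" "star A (p n) = p n" by auto
      have pS: "p (Suc n) = p n \<otimes>\<^bsub>A\<^esub> p n" by (simp add: p_def)
      have "cnorm A (p n \<otimes>\<^bsub>A\<^esub> p n) = (cnorm A (p n))\<^sup>2"
        using A.cstar_identity[OF c(1)] c(2) by simp
      moreover have "cnorm B (\<phi> (p n) \<otimes>\<^bsub>B\<^esub> \<phi> (p n)) = (cnorm B (\<phi> (p n)))\<^sup>2"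
        using B.cstar_identity[OF \<phi>c[OF c(1)]] \<phi>s[OF c(1) c(1)] c(2) by simp
      ultimately show ?case
        using Suc c by (simp add: pS A.mult_closed A.star_mult \<phi>m power_mult[symmetric] mult.commute)
    qed
    have "cnorm A h \<noteq> 0"
    proof
      assume "cnorm A h = 0"
      then show False using bd[OF h(1)] gt by simp
    qed
    then have pos: "0 < cnorm A h" using A.cnorm_nonneg[OF h(1)] by simp
    \<comment> \<open>If \<open>\<phi>\<close> increased the norm of \<open>h\<close>, the bound at
      \<open>p n\<close> would read \<open>q ^ (2 ^ n) \<le> C\<close> for all \<open>n\<close>,
      impossible for a ratio above 1.\<close>
    define q where "q = cnorm B (\<phi> h) / cnorm A h"
    have q: "1 < q" using gt pos by (simp add: q_def)
    obtain n where n: "C < q ^ n" using real_arch_pow[OF q] by blast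
    have "q ^ n \<le> q ^ (2 ^ n)" using q by (intro power_increasing) (auto intro: less_imp_le)
    moreover have "q ^ (2 ^ n) \<le> C"
      using bd[of "p n"] p[of n] pos by (simp add: q_def power_divide field_simps)
    ultimately show False using n by simp
  qed
  \<comment> \<open>A general \<open>x\<close> is reduced to the self-adjoint product of
    \<open>star A x\<close> and \<open>x\<close> by the C*-identity.\<close>
  have "(cnorm B (\<phi> x))\<^sup>2 = cnorm B (\<phi> (star A x \<otimes>\<^bsub>A\<^esub> x))"
    using x \<phi>c by (simp add: \<phi>m \<phi>s A.star_closed B.cstar_identity)
  also have "\<dots> \<le> cnorm A (star A x \<otimes>\<^bsub>A\<^esub> x)"
    using x by (intro sa) (simp_all add: A.mult_closed A.star_closed A.star_mult A.star_star)
  also have "\<dots> = (cnorm A x)\<^sup>2" using x by (simp add: A.cstar_identity)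
  finally show ?thesis using A.cnorm_nonneg[OF x] by (rule power2_le_imp_le)
qed

section \<open>Contractivity of the action and the sections it produces\<close>

locale proper_system = haar_bundle G lam B + groupoid_dynamical_system G B \<alpha>
  for G :: "'g groupoid" and lam and B :: "('g, 'e) cbundle" and \<alpha> +
  assumes proper: "proper_groupoid G"
begin

lemma action_closed:
  "\<lbrakk>\<gamma> \<in> arrows G; e \<in> carrier (fib B (src G \<gamma>))\<rbrakk> \<Longrightarrow> \<alpha> \<gamma> e \<in> carrier (fib B (rng G \<gamma>))"
  using action_iso[of \<gamma>] by (auto simp: star_iso_def dest: bij_betwE)

lemma action_linear: "\<gamma> \<in> arrows G \<Longrightarrow> cstar_linear (fib B (src G \<gamma>)) (fib B (rng G \<gamma>)) (\<alpha> \<gamma>)"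
  using action_iso[of \<gamma>] action_closed by (auto simp: star_iso_def cstar_linear_def)

text \<open>\<open>star_iso\<close> contains no norm condition. Continuity of the action at
  \<open>\<gamma>\<close> and the zero of the source fibre keeps image norms below 1 on a small
  ball, and homogeneity extends this to a linear bound.\<close>

lemma action_bounded:
  assumes \<gamma>: "\<gamma> \<in> arrows G"
  obtains C where "\<And>e. e \<in> carrier (fib B (src G \<gamma>)) \<Longrightarrow> cnorm (fib B (rng G \<gamma>)) (\<alpha> \<gamma> e) \<le> C * cnorm (fib B (src G \<gamma>)) e"
proof -
  let ?s = "src G \<gamma>" and ?r = "rng G \<gamma>"
  note s = src_unit[OF \<gamma>] and r = rng_unit[OF \<gamma>]
  interpret S: cstar_algebra "fib B ?s" using fib_cstar[OF s] .
  interpret R: cstar_algebra "fib B ?r" using fib_cstar[OF r] .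
  note lin = action_linear[OF \<gamma>]
  have \<alpha>0: "\<alpha> \<gamma> \<zero>\<^bsub>fib B ?s\<^esub> = \<zero>\<^bsub>fib B ?r\<^esub>"
    by (rule cstar_linear_zero[OF S.cstar_algebra_axioms R.cstar_algebra_axioms lin])
  let ?D = "subtopology (prod_topology (gtop G) (total B)) {(\<gamma>, a). src G \<gamma> = proj B a}"
  let ?W = "{e \<in> topspace (total B). bnorm e < 1}"
  have "openin ?D {p \<in> topspace ?D. (\<lambda>(\<gamma>, a). \<alpha> \<gamma> a) p \<in> ?W}"
    by (rule openin_continuous_map_preimage[OF action_continuous norm_usc])
  then obtain T where T: "openin (prod_topology (gtop G) (total B)) T"
    "{p \<in> topspace ?D. (\<lambda>(\<gamma>, a). \<alpha> \<gamma> a) p \<in> ?W} = T \<inter> {(\<gamma>, a). src G \<gamma> = proj B a}"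
    unfolding openin_subtopology by blast
  have z: "\<zero>\<^bsub>fib B ?s\<^esub> \<in> topspace (total B)" "proj B \<zero>\<^bsub>fib B ?s\<^esub> = ?s"
    "\<zero>\<^bsub>fib B ?r\<^esub> \<in> topspace (total B)" "proj B \<zero>\<^bsub>fib B ?r\<^esub> = ?r"
    using S.zero_closed R.zero_closed carrier_fib[OF s] carrier_fib[OF r] by auto
  have "(\<gamma>, \<zero>\<^bsub>fib B ?s\<^esub>) \<in> {p \<in> topspace ?D. (\<lambda>(\<gamma>, a). \<alpha> \<gamma> a) p \<in> ?W}"
    using z \<gamma> by (simp add: \<alpha>0)
  then have "(\<gamma>, \<zero>\<^bsub>fib B ?s\<^esub>) \<in> T" unfolding T(2) by (rule IntD1)
  from openin_prod_topology_alt[THEN iffD1, rule_format, OF T(1) this] obtain V1 V0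
    where V: "openin (gtop G) V1" "openin (total B) V0" "\<gamma> \<in> V1" "\<zero>\<^bsub>fib B ?s\<^esub> \<in> V0" "V1 \<times> V0 \<subseteq> T"
    by (elim exE conjE) (rule that)
  obtain U \<epsilon> where U: "openin (unit_space G) U" "?s \<in> U" "(0::real) < \<epsilon>"
    "\<And>e. \<lbrakk>e \<in> topspace (total B); proj B e \<in> U; bnorm e < \<epsilon>\<rbrakk> \<Longrightarrow> e \<in> V0"
    by (rule zero_neighbourhood[OF s V(2,4)]) (rule that)
  have small: "cnorm (fib B ?r) (\<alpha> \<gamma> e) < 1" if e: "e \<in> carrier (fib B ?s)" "cnorm (fib B ?s) e < \<epsilon>" for e
  proof -
    have et: "e \<in> topspace (total B)" "proj B e = ?s" using e carrier_fib[OF s] by auto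
    then have "e \<in> V0" using U e(2) by simp
    then have "(\<gamma>, e) \<in> T \<inter> {(\<gamma>, a). src G \<gamma> = proj B a}" using V et by auto
    then have "bnorm (\<alpha> \<gamma> e) < 1" unfolding T(2)[symmetric] by simp
    moreover have "proj B (\<alpha> \<gamma> e) = ?r" using action_closed[OF \<gamma> e(1)] carrier_fib[OF r] by simp
    ultimately show ?thesis by simp
  qed
  show thesis
  proof
    fix e assume e: "e \<in> carrier (fib B ?s)"
    show "cnorm (fib B ?r) (\<alpha> \<gamma> e) \<le> (2 / \<epsilon>) * cnorm (fib B ?s) e"
    proof (cases "cnorm (fib B ?s) e = 0")
      case True
      then show ?thesis using e S.cnorm_eq_0 \<alpha>0 by simp
    next
      case False
      then have pos: "0 < cnorm (fib B ?s) e" using S.cnorm_nonneg[OF e] by simp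
      \<comment> \<open>Scaling to norm \<open>\<epsilon> / 2\<close> lands strictly inside the
        ball, whence the constant \<open>2 / \<epsilon>\<close>.\<close>
      define k where "k = \<epsilon> / (2 * cnorm (fib B ?s) e)"
      have k: "0 < k" "k * cnorm (fib B ?s) e = \<epsilon> / 2" using pos U(3) by (auto simp: k_def)
      have "cnorm (fib B ?s) (complex_of_real k \<odot>\<^bsub>fib B ?s\<^esub> e) < \<epsilon>"
        using e k U(3) by (simp add: S.cnorm_smult)
      then have "cnorm (fib B ?r) (\<alpha> \<gamma> (complex_of_real k \<odot>\<^bsub>fib B ?s\<^esub> e)) < 1"
        using e by (intro small S.smult_closed)
      moreover have "\<alpha> \<gamma> (complex_of_real k \<odot>\<^bsub>fib B ?s\<^esub> e) = complex_of_real k \<odot>\<^bsub>fib B ?r\<^esub> \<alpha> \<gamma> e"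
        using lin e by (simp add: cstar_linear_def)
      ultimately have "k * cnorm (fib B ?r) (\<alpha> \<gamma> e) < 1"
        using k action_closed[OF \<gamma> e] by (simp add: R.cnorm_smult)
      then show ?thesis using pos U(3) by (simp add: k_def field_simps)
    qed
  qed
qed

text \<open>The constant from \<open>action_bounded\<close> depends on \<open>\<gamma>\<close>;
  \<open>star_iso_contractive\<close> replaces it by 1, uniformly.\<close>

lemma action_contractive:
  assumes "\<gamma> \<in> arrows G" "e \<in> carrier (fib B (src G \<gamma>))"
  shows "cnorm (fib B (rng G \<gamma>)) (\<alpha> \<gamma> e) \<le> cnorm (fib B (src G \<gamma>)) e"
  by (rule action_bounded[OF assms(1)])
    (rule star_iso_contractive[OF fib_cstar[OF src_unit[OF assms(1)]] fib_cstar[OF rng_unit[OF assms(1)]]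
        action_iso[OF assms(1)] _ assms(2)])

lemma action_pullback_section:
  assumes m: "m \<in> Gamma0 (unit_space G) B"
  shows "pullback_section (\<lambda>\<gamma>. \<alpha> \<gamma> (m (src G \<gamma>)))"
  unfolding pullback_section_def
proof
  note m' = Gamma0D[OF m]
  have "continuous_map (gtop G) (subtopology (prod_topology (gtop G) (total B)) {(\<gamma>, a). src G \<gamma> = proj B a})
      (\<lambda>\<gamma>. (\<gamma>, m (src G \<gamma>)))"
    using continuous_map_compose[OF src_continuous m'(2)] m'(3) src_unit
    by (auto simp: continuous_map_in_subtopology continuous_map_paired o_def continuous_map_id[unfolded id_def])
  from continuous_map_compose[OF this action_continuous]
  show "continuous_map (gtop G) (total B) (\<lambda>\<gamma>. \<alpha> \<gamma> (m (src G \<gamma>)))" by (simp add: o_def)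
  show "\<forall>\<gamma>\<in>arrows G. proj B (\<alpha> \<gamma> (m (src G \<gamma>))) = rng G \<gamma>"
    using action_closed m'(4) src_unit rng_unit carrier_fib by blast
qed

lemma pullback_section_rng:
  assumes c: "c \<in> Gamma0 (unit_space G) B"
  shows "pullback_section (\<lambda>\<gamma>. c (rng G \<gamma>))"
  using continuous_map_compose[OF rng_continuous Gamma0D(2)[OF c]] Gamma0D(3)[OF c] rng_unit
  by (auto simp: pullback_section_def o_def)

lemma pullback_section_mult:
  assumes F: "pullback_section F" and H: "pullback_section H"
  shows "pullback_section (\<lambda>\<gamma>. F \<gamma> \<otimes>\<^bsub>fib B (rng G \<gamma>)\<^esub> H \<gamma>)"
  unfolding pullback_section_def
proof
  note F' = pullback_sectionD[OF F] and H' = pullback_sectionD[OF H]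
  show "continuous_map (gtop G) (total B) (\<lambda>\<gamma>. F \<gamma> \<otimes>\<^bsub>fib B (rng G \<gamma>)\<^esub> H \<gamma>)"
    by (rule continuous_map_eq[OF continuous_map_mult[OF F'(1) H'(1)]]) (simp_all add: F'(2) H'(2))
  show "\<forall>\<gamma>\<in>arrows G. proj B (F \<gamma> \<otimes>\<^bsub>fib B (rng G \<gamma>)\<^esub> H \<gamma>) = rng G \<gamma>"
    using F'(3) H'(3) rng_unit proj_ops(2) by blast
qed

text \<open>Lets the coefficients of a Riemann sum, which vary with the unit, be absorbed into the
  section.\<close>

lemma pullback_section_smult_units:
  assumes F: "pullback_section F" and f: "continuous_map (unit_space G) euclidean f"
  shows "pullback_section (\<lambda>\<gamma>. f (rng G \<gamma>) \<odot>\<^bsub>fib B (rng G \<gamma>)\<^esub> F \<gamma>)"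
  unfolding pullback_section_def
proof
  note F' = pullback_sectionD[OF F]
  have "continuous_map (gtop G) euclidean (\<lambda>\<gamma>. f (rng G \<gamma>))"
    using continuous_map_compose[OF rng_continuous f] by (simp add: o_def)
  from continuous_map_smult[OF this F'(1)]
  show "continuous_map (gtop G) (total B) (\<lambda>\<gamma>. f (rng G \<gamma>) \<odot>\<^bsub>fib B (rng G \<gamma>)\<^esub> F \<gamma>)"
    by (rule continuous_map_eq) (simp add: F'(2))
  show "\<forall>\<gamma>\<in>arrows G. proj B (f (rng G \<gamma>) \<odot>\<^bsub>fib B (rng G \<gamma>)\<^esub> F \<gamma>) = rng G \<gamma>"
    using F'(3) rng_unit proj_ops(3) by blast
qed

subsection \<open>The invariant section obtained by averaging\<close>

text \<open>The description is proper only for compactly supported \<open>m\<close>. The integrand is then compactly supported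
  on each range fibre, although not on \<open>G\<close>.\<close>

definition average :: "('g \<Rightarrow> 'e) \<Rightarrow> 'g \<Rightarrow> 'e" where
  "average m u = (THE x. has_dominated_integral (fib B u) (fibre_measure u) (\<lambda>\<gamma>. \<alpha> \<gamma> (m (src G \<gamma>))) x)"

context
  fixes m :: "'g \<Rightarrow> 'e" and L :: "'g set"
  assumes m: "m \<in> Gamma0 (unit_space G) B" and L: "compactin (unit_space G) L"
    and mL: "\<forall>u\<in>units G - L. m u = \<zero>\<^bsub>fib B u\<^esub>"
begin

abbreviation orbit_section :: "'g \<Rightarrow> 'e" where
  "orbit_section \<gamma> \<equiv> \<alpha> \<gamma> (m (src G \<gamma>))"

lemma orbit_section_zero:
  "\<lbrakk>\<gamma> \<in> arrows G; src G \<gamma> \<notin> L\<rbrakk> \<Longrightarrow> orbit_section \<gamma> = \<zero>\<^bsub>fib B (rng G \<gamma>)\<^esub>"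
  using cstar_linear_zero[OF fib_cstar[OF src_unit[of \<gamma>]] fib_cstar[OF rng_unit[of \<gamma>]] action_linear[of \<gamma>]]
    bspec[OF mL, of "src G \<gamma>"] src_unit[of \<gamma>] by simp

lemma orbit_section_support:
  assumes "\<gamma> \<in> range_fibre G v" "v \<in> K" "\<gamma> \<notin> {\<gamma> \<in> arrows G. rng G \<gamma> \<in> K \<and> src G \<gamma> \<in> L}"
  shows "orbit_section \<gamma> = \<zero>\<^bsub>fib B v\<^esub>"
  using orbit_section_zero[of \<gamma>] assms range_fibreD[OF assms(1)] by auto

lemma average_integral:
  assumes u: "u \<in> units G"
  shows "has_dominated_integral (fib B u) (fibre_measure u) orbit_section (average m u)"
proof -
  interpret A: cstar_algebra "fib B u" using fib_cstar[OF u] .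
  have c: "compactin (unit_space G) {u}" using u by simp
  have "\<exists>x. has_dominated_integral (fib B u) (fibre_measure u) orbit_section x"
    by (rule fibre_integral_exists[OF action_pullback_section[OF m] u proper_preimage_compactin[OF proper c L]])
      (rule orbit_section_support[of _ _ "{u}"], simp_all)
  then obtain x where x: "has_dominated_integral (fib B u) (fibre_measure u) orbit_section x" ..
  show ?thesis unfolding average_def
    by (rule theI[of _ x]) (rule x, rule A.has_dominated_integral_unique[OF _ x])
qed

lemma average_closed: "u \<in> units G \<Longrightarrow> average m u \<in> carrier (fib B u)"
  using average_integral by (simp add: has_dominated_integral_def)

text \<open>Both sides are compared with the same Riemann sum \<open>?z\<close>. Translation by
  \<open>\<gamma>\<close> changes its weights but not their integrals, and it leaves the vectors at
  the tags alone.\<close>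

lemma average_invariant:
  assumes \<gamma>: "\<gamma> \<in> arrows G"
  shows "\<alpha> \<gamma> (average m (src G \<gamma>)) = average m (rng G \<gamma>)"
proof -
  let ?s = "src G \<gamma>" and ?r = "rng G \<gamma>"
  note s = src_unit[OF \<gamma>] and r = rng_unit[OF \<gamma>]
  interpret S: cstar_algebra "fib B ?s" using fib_cstar[OF s] .
  interpret R: cstar_algebra "fib B ?r" using fib_cstar[OF r] .
  note F = action_pullback_section[OF m]
  let ?x = "\<alpha> \<gamma> (average m ?s)" and ?y = "average m ?r"
  have xc: "?x \<in> carrier (fib B ?r)" by (rule action_closed[OF \<gamma> average_closed[OF s]])
  have yc: "?y \<in> carrier (fib B ?r)" by (rule average_closed[OF r])
  have "has_dominated_integral (fib B ?r) (fibre_measure ?s) (\<lambda>\<eta>. \<alpha> \<gamma> (orbit_section \<eta>)) ?x"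
    using action_contractive[OF \<gamma>]
    by (intro has_dominated_integral_linear[OF S.cstar_algebra_axioms R.cstar_algebra_axioms action_linear[OF \<gamma>]
          _ average_integral[OF s], of 1]) simp
  \<comment> \<open>Multiplicativity of the action turns the image under
    \<open>\<alpha> \<gamma>\<close> into a translate of the same integrand.\<close>
  moreover have "\<alpha> \<gamma> (orbit_section \<eta>) = orbit_section (gcomp G \<gamma> \<eta>)" if "\<eta> \<in> range_fibre G ?s" for \<eta>
    using action_comp[OF \<gamma>, of \<eta> "m (src G \<eta>)"] gcomp_fibre(2)[OF \<gamma> that] range_fibreD[OF that]
      Gamma0D(4)[OF m] src_unit by simp
  ultimately have x: "has_dominated_integral (fib B ?r) (fibre_measure ?s) (\<lambda>\<eta>. orbit_section (gcomp G \<gamma> \<eta>)) ?x"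
    by (subst has_dominated_integral_cong[where g="\<lambda>\<eta>. \<alpha> \<gamma> (orbit_section \<eta>)"]) (simp_all add: space_fibre_measure[OF s])
  have c: "compactin (unit_space G) {?r}" using r by simp
  define K where "K = {\<gamma> \<in> arrows G. rng G \<gamma> \<in> {?r} \<and> src G \<gamma> \<in> L}"
  have K: "compactin (gtop G) K" unfolding K_def by (rule proper_preimage_compactin[OF proper c L])
  obtain \<psi> W where \<psi>: "bump (gtop G) \<psi>" and W: "openin (gtop G) W" "K \<subseteq> W" "\<And>\<gamma>. \<gamma> \<in> W \<Longrightarrow> \<psi> \<gamma> = 1"
    by (rule support_bump[OF K]) (rule that)
  define C where "C = (\<integral>\<eta>. \<psi> \<eta> \<partial>fibre_measure ?r)"
  have C: "0 \<le> C" unfolding C_def by (rule bump_integral_nonneg[OF r \<psi>])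
  have le: "cnorm (fib B ?r) (?x \<ominus>\<^bsub>fib B ?r\<^esub> ?y) \<le> 2 * \<epsilon> * C" if \<epsilon>: "0 < \<epsilon>" for \<epsilon>
  proof -
    obtain J \<phi> N V where R: "riemann_data orbit_section \<psi> \<epsilon> J \<phi> N" "J \<subseteq> range_fibre G ?r"
      "openin (gtop G) V" "K \<inter> range_fibre G ?r \<subseteq> V" "\<And>\<gamma>. \<gamma> \<in> V \<Longrightarrow> (\<Sum>j\<in>J. \<phi> j \<gamma>) = 1"
      by (rule riemann_data_exists[OF F r K W(1,2) \<psi> W(3) \<epsilon>]) (assumption, rule that)
    have tag: "j \<in> N j \<and> j \<in> range_fibre G ?r" if "j \<in> J" for j
      using R(1,2) that by (auto simp: riemann_data_def)
    have one: "orbit_section \<eta> = \<zero>\<^bsub>fib B ?r\<^esub> \<or> (\<Sum>j\<in>J. \<phi> j \<eta>) = 1" if "\<eta> \<in> range_fibre G ?r" for \<eta>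
    proof (cases "\<eta> \<in> K")
      case True
      then show ?thesis using R(4,5) that by blast
    next
      case False
      then show ?thesis using orbit_section_support[OF that, of "{?r}"] by (simp add: K_def)
    qed
    let ?z = "\<Oplus>\<^bsub>fib B ?r\<^esub>j\<in>J. complex_of_real (\<integral>\<eta>. \<phi> j \<eta> \<partial>fibre_measure ?r) \<odot>\<^bsub>fib B ?r\<^esub> orbit_section j"
    have zc: "?z \<in> carrier (fib B ?r)"
      using pullback_sectionD(4)[OF F] tag by (intro R.finsum_closed) (auto intro: R.smult_closed)
    have y: "cnorm (fib B ?r) (?y \<ominus>\<^bsub>fib B ?r\<^esub> ?z) \<le> \<epsilon> * C"
      unfolding C_def by (rule riemann_sum_error[OF F R(1) r tag one \<epsilon> \<psi> average_integral[OF r]])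
    have "has_dominated_integral (fib B ?r) (fibre_measure ?s)
        (\<lambda>\<eta>. \<Oplus>\<^bsub>fib B ?r\<^esub>j\<in>J. complex_of_real (\<phi> j (gcomp G \<gamma> \<eta>)) \<odot>\<^bsub>fib B ?r\<^esub> orbit_section j)
        (\<Oplus>\<^bsub>fib B ?r\<^esub>j\<in>J. complex_of_real (\<integral>\<eta>. \<phi> j (gcomp G \<gamma> \<eta>) \<partial>fibre_measure ?s) \<odot>\<^bsub>fib B ?r\<^esub> orbit_section j)"
      using R(1) tag pullback_sectionD(4)[OF F] unfolding riemann_data_def
      by (intro R.has_dominated_integral_finsum R.has_dominated_integral_smult_const bump_translate_integrable[OF \<gamma>]) auto
    \<comment> \<open>Left invariance of the Haar system enters here, for one scalar weight at a
      time.\<close>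
    also have "(\<Oplus>\<^bsub>fib B ?r\<^esub>j\<in>J. complex_of_real (\<integral>\<eta>. \<phi> j (gcomp G \<gamma> \<eta>) \<partial>fibre_measure ?s) \<odot>\<^bsub>fib B ?r\<^esub> orbit_section j) = ?z"
    proof (intro R.finsum_cong' refl)
      show "(\<lambda>j. complex_of_real (\<integral>\<eta>. \<phi> j \<eta> \<partial>fibre_measure ?r) \<odot>\<^bsub>fib B ?r\<^esub> orbit_section j) \<in> J \<rightarrow> carrier (fib B ?r)"
        using pullback_sectionD(4)[OF F] tag by (auto intro: R.smult_closed)
      fix j assume "j \<in> J"
      then have "bump (gtop G) (\<phi> j)" using R(1) by (simp add: riemann_data_def)
      then show "complex_of_real (\<integral>\<eta>. \<phi> j (gcomp G \<gamma> \<eta>) \<partial>fibre_measure ?s) \<odot>\<^bsub>fib B ?r\<^esub> orbit_section j =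
          complex_of_real (\<integral>\<eta>. \<phi> j \<eta> \<partial>fibre_measure ?r) \<odot>\<^bsub>fib B ?r\<^esub> orbit_section j"
        by (simp only: bump_left_invariant[OF \<gamma>])
    qed
    finally have "cnorm (fib B ?r) (?x \<ominus>\<^bsub>fib B ?r\<^esub> ?z) \<le> (\<integral>\<eta>. \<epsilon> * \<psi> (gcomp G \<gamma> \<eta>) \<partial>fibre_measure ?s)"
      using riemann_pointwise[OF F R(1) r tag gcomp_fibre(1)[OF \<gamma>] one[OF gcomp_fibre(1)[OF \<gamma>]] \<epsilon>]
      by (intro R.cnorm_dominated_integral[OF R.has_dominated_integral_diff[OF x]] integrable_mult_right
          bump_translate_integrable[OF \<gamma> \<psi>]) (simp_all add: space_fibre_measure[OF s])
    also have "\<dots> = \<epsilon> * C" by (simp add: C_def bump_left_invariant[OF \<gamma> \<psi>])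
    finally show ?thesis
      using R.cnorm_triangle[OF xc zc yc] y R.cnorm_diff_commute[OF yc zc] by simp
  qed
  have "cnorm (fib B ?r) (?x \<ominus>\<^bsub>fib B ?r\<^esub> ?y) \<le> 0"
  proof (rule field_le_epsilon)
    fix e :: real assume e: "0 < e"
    \<comment> \<open>\<open>C\<close> may be 0, hence the mesh
      \<open>e / (2 * (C + 1))\<close>.\<close>
    have "2 * (e / (2 * (C + 1))) * C \<le> e" using C e by (simp add: field_simps)
    moreover have "0 < e / (2 * (C + 1))" using C e by simp
    ultimately show "cnorm (fib B ?r) (?x \<ominus>\<^bsub>fib B ?r\<^esub> ?y) \<le> 0 + e" using le by fastforce
  qed
  then have "?x \<ominus>\<^bsub>fib B ?r\<^esub> ?y = \<zero>\<^bsub>fib B ?r\<^esub>"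
    using R.cnorm_nonneg[of "?x \<ominus>\<^bsub>fib B ?r\<^esub> ?y"] R.cnorm_eq_0 xc yc by simp
  then show ?thesis by (rule R.diff_eq_zero[OF xc yc])
qed

text \<open>The average vanishes on units whose orbit misses \<open>L\<close>; on the others invariance moves the
  estimate to a unit in the compact set \<open>L\<close>.\<close>

lemma average_bounded:
  obtains C where "\<And>u. u \<in> units G \<Longrightarrow> cnorm (fib B u) (average m u) \<le> C"
proof -
  note F = action_pullback_section[OF m]
  \<comment> \<open>Arrows from \<open>L\<close> to \<open>L\<close>: for a unit in \<open>L\<close>
    they carry the whole integrand, and properness makes them a compact set.\<close>
  define K where "K = {\<gamma> \<in> arrows G. rng G \<gamma> \<in> L \<and> src G \<gamma> \<in> L}"
  have K: "compactin (gtop G) K" unfolding K_def by (rule proper_preimage_compactin[OF proper L L])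
  obtain \<psi> W where \<psi>: "bump (gtop G) \<psi>" and W: "openin (gtop G) W" "K \<subseteq> W" "\<And>\<gamma>. \<gamma> \<in> W \<Longrightarrow> \<psi> \<gamma> = 1"
    by (rule support_bump[OF K]) (rule that)
  obtain C1 where C1: "0 < C1" "\<And>u. u \<in> units G \<Longrightarrow> (\<integral>\<gamma>. \<psi> \<gamma> \<partial>fibre_measure u) \<le> C1"
    by (rule bump_integral_bounded[OF \<psi>]) (rule that)
  obtain C2 where C2: "0 < C2" "\<And>\<gamma>. \<gamma> \<in> K \<Longrightarrow> bnorm (orbit_section \<gamma>) \<le> C2"
    by (rule bnorm_bounded_on_compact[OF pullback_sectionD(1)[OF F] K]) (rule that)
  have inL: "cnorm (fib B v) (average m v) \<le> C2 * C1" if v: "v \<in> units G" "v \<in> L" for v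
  proof -
    interpret A: cstar_algebra "fib B v" using fib_cstar[OF v(1)] .
    have "cnorm (fib B v) (average m v) \<le> (\<integral>\<gamma>. C2 * \<psi> \<gamma> \<partial>fibre_measure v)"
    proof (rule A.cnorm_dominated_integral[OF average_integral[OF v(1)]])
      show "integrable (fibre_measure v) (\<lambda>\<gamma>. C2 * \<psi> \<gamma>)"
        by (intro integrable_mult_right bump_integrable[OF v(1) \<psi>])
      fix \<gamma> assume "\<gamma> \<in> space (fibre_measure v)"
      then have \<gamma>: "\<gamma> \<in> range_fibre G v" by (simp only: space_fibre_measure[OF v(1)])
      then have g: "\<gamma> \<in> arrows G" "rng G \<gamma> = v" by (auto dest!: range_fibreD)
      show "cnorm (fib B v) (orbit_section \<gamma>) \<le> C2 * \<psi> \<gamma>"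
      proof (cases "\<gamma> \<in> K")
        case True
        then have "\<psi> \<gamma> = 1" using W by blast
        then show ?thesis using C2(2)[OF True] pullback_sectionD(2)[OF F g(1)] g(2) by simp
      next
        case False
        then have "orbit_section \<gamma> = \<zero>\<^bsub>fib B v\<^esub>" using orbit_section_support[OF \<gamma> v(2)] by (simp add: K_def)
        then show ?thesis using C2(1) \<psi> g by (simp add: bump_def)
      qed
    qed
    also have "\<dots> \<le> C2 * C1" using C1(2)[OF v(1)] C2(1) by simp
    finally show ?thesis .
  qed
  show thesis
  proof
    fix u assume u: "u \<in> units G"
    interpret A: cstar_algebra "fib B u" using fib_cstar[OF u] .
    show "cnorm (fib B u) (average m u) \<le> C2 * C1"
    proof (cases "\<exists>\<gamma>\<in>range_fibre G u. src G \<gamma> \<in> L")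
      case True
      then obtain \<gamma> where g: "\<gamma> \<in> range_fibre G u" "src G \<gamma> \<in> L" by blast
      then have \<gamma>: "\<gamma> \<in> arrows G" "rng G \<gamma> = u" "src G \<gamma> \<in> L" by (auto dest!: range_fibreD)
      have "cnorm (fib B u) (average m u) = cnorm (fib B (rng G \<gamma>)) (\<alpha> \<gamma> (average m (src G \<gamma>)))"
        using average_invariant[OF \<gamma>(1)] \<gamma>(2) by simp
      also have "\<dots> \<le> cnorm (fib B (src G \<gamma>)) (average m (src G \<gamma>))"
        by (rule action_contractive[OF \<gamma>(1) average_closed[OF src_unit[OF \<gamma>(1)]]])
      also have "\<dots> \<le> C2 * C1" by (rule inL[OF src_unit[OF \<gamma>(1)] \<gamma>(3)])
      finally show ?thesis .
    next
      case False
      have "cnorm (fib B u) (average m u) \<le> (\<integral>\<gamma>. 0 \<partial>fibre_measure u)"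
      proof (rule A.cnorm_dominated_integral[OF average_integral[OF u]])
        fix \<gamma> assume "\<gamma> \<in> space (fibre_measure u)"
        then have "\<gamma> \<in> range_fibre G u" by (simp only: space_fibre_measure[OF u])
        then have "orbit_section \<gamma> = \<zero>\<^bsub>fib B u\<^esub>"
          using False orbit_section_zero[of \<gamma>] by (auto dest: range_fibreD)
        then show "cnorm (fib B u) (orbit_section \<gamma>) \<le> 0" by simp
      qed simp
      also have "\<dots> \<le> C2 * C1" using C1(1) C2(1) by simp
      finally show ?thesis .
    qed
  qed
qed

text \<open>Near \<open>u0\<close> the average is within \<open>\<epsilon>\<close> of a Riemann sum
  whose partition comes from the fibre of \<open>u0\<close> and whose tags move with the unit. Such
  sums can be kept in any neighbourhood of the sum at \<open>u0\<close>, which is what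
  \<open>continuous_section_criterion\<close> asks for.\<close>

lemma average_continuous: "continuous_map (unit_space G) (total B) (average m)"
proof (rule continuous_section_criterion[OF average_closed])
  fix u0 and \<epsilon> :: real assume u0: "u0 \<in> units G" and \<epsilon>: "0 < \<epsilon>"
  note F = action_pullback_section[OF m]
  interpret A0: cstar_algebra "fib B u0" using fib_cstar[OF u0] .
  \<comment> \<open>A compact neighbourhood of \<open>u0\<close> makes the set of arrows into it
    from \<open>L\<close> compact, so that one dominating \<open>\<psi>\<close> serves all nearby
    units.\<close>
  obtain U0 C0 where U0: "openin (unit_space G) U0" "compactin (unit_space G) C0" "u0 \<in> U0" "U0 \<subseteq> C0"
    using base_lc u0 unfolding locally_compact_space_def by blast
  define K where "K = {\<gamma> \<in> arrows G. rng G \<gamma> \<in> C0 \<and> src G \<gamma> \<in> L}"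
  have K: "compactin (gtop G) K" unfolding K_def by (rule proper_preimage_compactin[OF proper U0(2) L])
  obtain \<psi> W where \<psi>: "bump (gtop G) \<psi>" and W: "openin (gtop G) W" "K \<subseteq> W" "\<And>\<gamma>. \<gamma> \<in> W \<Longrightarrow> \<psi> \<gamma> = 1"
    by (rule support_bump[OF K]) (rule that)
  obtain C where C: "0 < C" "\<And>u. u \<in> units G \<Longrightarrow> (\<integral>\<gamma>. \<psi> \<gamma> \<partial>fibre_measure u) \<le> C"
    by (rule bump_integral_bounded[OF \<psi>]) (rule that)
  \<comment> \<open>\<open>C\<close> bounds the integral of \<open>\<psi>\<close> over every fibre;
    the factor 2 makes the resulting error strictly smaller than \<open>\<epsilon>\<close>.\<close>
  define \<delta> where "\<delta> = \<epsilon> / (2 * C)"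
  have \<delta>: "0 < \<delta>" using \<epsilon> C by (simp add: \<delta>_def)
  have small: "\<delta> * (\<integral>\<gamma>. \<psi> \<gamma> \<partial>fibre_measure u) < \<epsilon>" if "u \<in> units G" for u
  proof -
    have "\<delta> * (\<integral>\<gamma>. \<psi> \<gamma> \<partial>fibre_measure u) \<le> \<delta> * C" using C(2)[OF that] \<delta> by simp
    also have "\<dots> < \<epsilon>" using C(1) \<epsilon> by (simp add: \<delta>_def)
    finally show ?thesis .
  qed
  obtain J \<phi> N V1 where R: "riemann_data orbit_section \<psi> \<delta> J \<phi> N" "J \<subseteq> range_fibre G u0"
    "openin (gtop G) V1" "K \<inter> range_fibre G u0 \<subseteq> V1" "\<And>\<gamma>. \<gamma> \<in> V1 \<Longrightarrow> (\<Sum>j\<in>J. \<phi> j \<gamma>) = 1"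
    by (rule riemann_data_exists[OF F u0 K W(1,2) \<psi> W(3) \<delta>]) (assumption, rule that)
  have J: "finite J" "\<And>j. j \<in> J \<Longrightarrow> bump (gtop G) (\<phi> j)" "\<And>j. j \<in> J \<Longrightarrow> openin (gtop G) (N j) \<and> j \<in> N j"
    using R(1) by (auto simp: riemann_data_def)
  \<comment> \<open>Partition sums equal 1 on \<open>V1\<close>, which is only known to contain the
    part of \<open>K\<close> over \<open>u0\<close>. The units above which \<open>K\<close> leaves
    \<open>V1\<close> form a compact set avoiding \<open>u0\<close>; removing them secures the value
    1 on \<open>K\<close> over the remaining units.\<close>
  define U1 where "U1 = units G - rng G ` (K - V1)"
  have U1: "openin (unit_space G) U1"
  proof -
    have "K - V1 = K \<inter> (arrows G - V1)" using compactin_subset_topspace[OF K] by auto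
    then have "compactin (gtop G) (K - V1)" using R(3) by (auto intro: compact_Int_closedin[OF K])
    then have "compactin (unit_space G) (rng G ` (K - V1))" by (rule image_compactin[OF _ rng_continuous])
    then have "closedin (unit_space G) (rng G ` (K - V1))" by (rule compactin_imp_closedin[OF unit_space_Hausdorff])
    then show ?thesis unfolding U1_def by (rule openin_diff[OF openin_topspace])
  qed
  have u0U1: "u0 \<in> U1" using u0 R(4) compactin_subset_topspace[OF K] by (auto simp: U1_def range_fibre_def)
  have one: "orbit_section \<gamma> = \<zero>\<^bsub>fib B u\<^esub> \<or> (\<Sum>j\<in>J. \<phi> j \<gamma>) = 1"
    if "u \<in> U0 \<inter> U1" "\<gamma> \<in> range_fibre G u" for u \<gamma>
  proof (cases "\<gamma> \<in> K")
    case True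
    then have "\<gamma> \<in> V1" using that range_fibreD[OF that(2)] by (auto simp: U1_def)
    then show ?thesis using R(5) by blast
  next
    case False
    then show ?thesis using orbit_section_support[OF that(2), of C0] that(1) U0(4) by (auto simp: K_def)
  qed
  have u0U: "u0 \<in> U0 \<inter> U1" using U0(3) u0U1 by blast
  define t where "t j u = complex_of_real (\<integral>\<gamma>. \<phi> j \<gamma> \<partial>fibre_measure u)" for j u
  \<comment> \<open>The integrals of the weights depend on the unit. Multiplied into the section,
    they leave plain sums of pullback sections, to which \<open>riemann_sum_neighbourhood\<close>
    applies.\<close>
  define H where "H j \<gamma> = t j (rng G \<gamma>) \<odot>\<^bsub>fib B (rng G \<gamma>)\<^esub> orbit_section \<gamma>" for j \<gamma>
  have tc: "continuous_map (unit_space G) euclidean (t j)" if "j \<in> J" for j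
  proof -
    have "continuous_map (unit_space G) euclidean (complex_of_real \<circ> (\<lambda>u. \<integral>\<gamma>. \<phi> j \<gamma> \<partial>fibre_measure u))"
      by (rule continuous_map_compose[OF bump_integral_continuous[OF J(2)[OF that]]]) (simp add: continuous_on_of_real)
    moreover have "t j = complex_of_real \<circ> (\<lambda>u. \<integral>\<gamma>. \<phi> j \<gamma> \<partial>fibre_measure u)" by (auto simp: t_def)
    ultimately show ?thesis by (simp only:)
  qed
  have H: "pullback_section (H j)" if "j \<in> J" for j
    unfolding H_def by (rule pullback_section_smult_units[OF F tc[OF that]])
  have Hsum: "(\<Oplus>\<^bsub>fib B u\<^esub>j\<in>J. H j (g j)) = (\<Oplus>\<^bsub>fib B u\<^esub>j\<in>J. t j u \<odot>\<^bsub>fib B u\<^esub> orbit_section (g j)) \<and>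
      (\<Oplus>\<^bsub>fib B u\<^esub>j\<in>J. H j (g j)) \<in> carrier (fib B u)"
    if "u \<in> units G" "\<And>j. j \<in> J \<Longrightarrow> g j \<in> range_fibre G u" for u g
  proof -
    interpret A: cstar_algebra "fib B u" using fib_cstar[OF that(1)] .
    have c: "(\<lambda>j. t j u \<odot>\<^bsub>fib B u\<^esub> orbit_section (g j)) \<in> J \<rightarrow> carrier (fib B u)"
      using pullback_sectionD(4)[OF F that(2)] by (auto intro: A.smult_closed)
    have "(\<Oplus>\<^bsub>fib B u\<^esub>j\<in>J. H j (g j)) = (\<Oplus>\<^bsub>fib B u\<^esub>j\<in>J. t j u \<odot>\<^bsub>fib B u\<^esub> orbit_section (g j))"
      using c by (intro A.finsum_cong' refl) (use range_fibreD[OF that(2)] in \<open>auto simp: H_def\<close>)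
    then show ?thesis using A.finsum_closed[OF c] by simp
  qed
  have err: "cnorm (fib B u) (average m u \<ominus>\<^bsub>fib B u\<^esub> (\<Oplus>\<^bsub>fib B u\<^esub>j\<in>J. H j (g j))) < \<epsilon>"
    if u: "u \<in> U0 \<inter> U1" and g: "\<And>j. j \<in> J \<Longrightarrow> g j \<in> N j \<and> g j \<in> range_fibre G u" for u g
  proof -
    have uX: "u \<in> units G" using u by (simp add: U1_def)
    have "cnorm (fib B u) (average m u \<ominus>\<^bsub>fib B u\<^esub> (\<Oplus>\<^bsub>fib B u\<^esub>j\<in>J. t j u \<odot>\<^bsub>fib B u\<^esub> orbit_section (g j)))
        \<le> \<delta> * (\<integral>\<gamma>. \<psi> \<gamma> \<partial>fibre_measure u)"
      unfolding t_def by (rule riemann_sum_error[OF F R(1) uX g one[OF u] \<delta> \<psi> average_integral[OF uX]])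
    then show ?thesis using small[OF uX] Hsum[OF uX, of g] g by simp
  qed
  have tag0: "j \<in> N j \<and> j \<in> range_fibre G u0" if "j \<in> J" for j using J(3)[OF that] R(2) that by blast
  let ?e0 = "\<Oplus>\<^bsub>fib B u0\<^esub>j\<in>J. H j j"
  show "\<exists>e0\<in>carrier (fib B u0). cnorm (fib B u0) (average m u0 \<ominus>\<^bsub>fib B u0\<^esub> e0) < \<epsilon> \<and>
      (\<forall>V. openin (total B) V \<and> e0 \<in> V \<longrightarrow> (\<exists>U. openin (unit_space G) U \<and> u0 \<in> U \<and>
        (\<forall>u\<in>U. \<exists>e\<in>V. proj B e = u \<and> cnorm (fib B u) (average m u \<ominus>\<^bsub>fib B u\<^esub> e) < \<epsilon>)))"
  proof (intro bexI conjI allI impI)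
    show "?e0 \<in> carrier (fib B u0)" using Hsum[OF u0, of "\<lambda>j. j"] R(2) by blast
    show "cnorm (fib B u0) (average m u0 \<ominus>\<^bsub>fib B u0\<^esub> ?e0) < \<epsilon>" by (rule err[OF u0U tag0])
    fix V assume V: "openin (total B) V \<and> ?e0 \<in> V"
    have "\<exists>U N. openin (unit_space G) U \<and> u0 \<in> U \<and> (\<forall>j\<in>J. openin (gtop G) (N j) \<and> j \<in> N j) \<and>
      (\<forall>u\<in>U. \<forall>g. (\<forall>j\<in>J. g j \<in> N j \<and> g j \<in> range_fibre G u) \<longrightarrow> (\<Oplus>\<^bsub>fib B u\<^esub>j\<in>J. H j (g j)) \<in> V)"
      by (rule riemann_sum_neighbourhood[OF J(1) R(2) u0 H]) (use V in auto)
    then obtain U2 N2 where U2: "openin (unit_space G) U2" "u0 \<in> U2" "\<forall>j\<in>J. openin (gtop G) (N2 j) \<and> j \<in> N2 j"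
      "\<forall>u\<in>U2. \<forall>g. (\<forall>j\<in>J. g j \<in> N2 j \<and> g j \<in> range_fibre G u) \<longrightarrow> (\<Oplus>\<^bsub>fib B u\<^esub>j\<in>J. H j (g j)) \<in> V" by blast
    \<comment> \<open>\<open>N j\<close> controls the error and \<open>N2 j\<close> the position of
      the sum in \<open>V\<close>. Openness of the range map supplies tags lying in both for every
      unit near \<open>u0\<close>.\<close>
    have "\<exists>U. openin (unit_space G) U \<and> u0 \<in> U \<and> U \<subseteq> rng G ` (N j \<inter> N2 j)" if j: "j \<in> J" for j
    proof -
      have o: "openin (gtop G) (N j \<inter> N2 j)" "j \<in> N j \<inter> N2 j" using J(3)[OF j] U2(3) j by auto
      obtain U where "openin (unit_space G) U" "rng G j \<in> U" "U \<subseteq> rng G ` (N j \<inter> N2 j)"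
        by (rule rng_open[OF o]) (rule that)
      then show ?thesis using R(2) j range_fibreD[of j G u0] by blast
    qed
    then have "\<forall>j\<in>J. \<exists>U. openin (unit_space G) U \<and> u0 \<in> U \<and> U \<subseteq> rng G ` (N j \<inter> N2 j)" by (intro ballI)
    from bchoice[OF this] obtain U3
      where U3: "\<forall>j\<in>J. openin (unit_space G) (U3 j) \<and> u0 \<in> U3 j \<and> U3 j \<subseteq> rng G ` (N j \<inter> N2 j)" ..
    let ?U = "topspace (unit_space G) \<inter> \<Inter>(U3 ` J) \<inter> (U0 \<inter> U1 \<inter> U2)"
    show "\<exists>U. openin (unit_space G) U \<and> u0 \<in> U \<and>
        (\<forall>u\<in>U. \<exists>e\<in>V. proj B e = u \<and> cnorm (fib B u) (average m u \<ominus>\<^bsub>fib B u\<^esub> e) < \<epsilon>)"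
    proof (intro exI[of _ ?U] conjI ballI)
      show "openin (unit_space G) ?U"
        using U3 J(1) by (intro openin_Int U0(1) U1 U2(1) openin_Int_Inter openin_topspace) auto
      show "u0 \<in> ?U" using u0 U3 u0U U2(2) by blast
      fix u assume u: "u \<in> ?U"
      have "\<forall>j\<in>J. \<exists>\<gamma>. \<gamma> \<in> N j \<inter> N2 j \<and> \<gamma> \<in> range_fibre G u"
      proof
        fix j assume j: "j \<in> J"
        then have "u \<in> rng G ` (N j \<inter> N2 j)" using u U3 by blast
        then obtain \<gamma> where "\<gamma> \<in> N j \<inter> N2 j" "u = rng G \<gamma>" by blast
        moreover have "\<gamma> \<in> arrows G" using openin_subset[of "gtop G" "N j"] J(3)[OF j] calculation(1) by blast
        ultimately show "\<exists>\<gamma>. \<gamma> \<in> N j \<inter> N2 j \<and> \<gamma> \<in> range_fibre G u" by (auto simp: range_fibre_def)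
      qed
      from bchoice[OF this] obtain g where g: "\<forall>j\<in>J. g j \<in> N j \<inter> N2 j \<and> g j \<in> range_fibre G u" ..
      have uX: "u \<in> units G" using u by blast
      show "\<exists>e\<in>V. proj B e = u \<and> cnorm (fib B u) (average m u \<ominus>\<^bsub>fib B u\<^esub> e) < \<epsilon>"
      proof (intro bexI conjI)
        show "cnorm (fib B u) (average m u \<ominus>\<^bsub>fib B u\<^esub> (\<Oplus>\<^bsub>fib B u\<^esub>j\<in>J. H j (g j))) < \<epsilon>"
          by (rule err) (use u g in auto)
        show "proj B (\<Oplus>\<^bsub>fib B u\<^esub>j\<in>J. H j (g j)) = u"
          using Hsum[OF uX, of g] g carrier_fib[OF uX] by blast
        show "(\<Oplus>\<^bsub>fib B u\<^esub>j\<in>J. H j (g j)) \<in> V" using U2(4) u g by blast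
      qed
    qed
  qed
qed

end

end

section \<open>Multipliers of the section algebra\<close>

lemma mult_multiplier:
  assumes A: "cstar_algebra A" and z: "z \<in> carrier A"
  shows "((\<lambda>a\<in>carrier A. z \<otimes>\<^bsub>A\<^esub> a), (\<lambda>a\<in>carrier A. a \<otimes>\<^bsub>A\<^esub> z)) \<in> multipliers A"
proof -
  interpret A: cstar_algebra A by fact
  have "bounded_operator A (\<lambda>a\<in>carrier A. z \<otimes>\<^bsub>A\<^esub> a)"
    unfolding bounded_operator_def using z A.cnorm_mult[OF z]
    by (auto simp: A.mult_closed A.smult_closed A.distrib_left A.smult_mult_right intro!: exI[of _ "cnorm A z"])
  moreover have "bounded_operator A (\<lambda>a\<in>carrier A. a \<otimes>\<^bsub>A\<^esub> z)"
    unfolding bounded_operator_def using z A.cnorm_mult[OF _ z]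
    by (auto simp: A.mult_closed A.smult_closed A.distrib_right A.smult_mult_left mult.commute[of "cnorm A z"]
        intro!: exI[of _ "cnorm A z"])
  ultimately show ?thesis
    using z by (auto simp: multipliers_def A.mult_closed A.mult_assoc)
qed

text \<open>By multiplicativity the inverse of \<open>\<phi>\<close> cancels against the outer
  \<open>\<phi>\<close>, leaving only \<open>\<phi> z\<close>.\<close>

lemma mlt_ext_mult:
  assumes A: "cstar_algebra A" and iso: "star_iso A B \<phi>" and z: "z \<in> carrier A"
  shows "mlt_ext A B \<phi> ((\<lambda>a\<in>carrier A. z \<otimes>\<^bsub>A\<^esub> a), (\<lambda>a\<in>carrier A. a \<otimes>\<^bsub>A\<^esub> z)) =
    ((\<lambda>b\<in>carrier B. \<phi> z \<otimes>\<^bsub>B\<^esub> b), (\<lambda>b\<in>carrier B. b \<otimes>\<^bsub>B\<^esub> \<phi> z))"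
proof -
  have im: "\<phi> ` carrier A = carrier B" using iso by (auto simp: star_iso_def bij_betw_def)
  have i: "inv_into (carrier A) \<phi> b \<in> carrier A" "\<phi> (inv_into (carrier A) \<phi> b) = b" if "b \<in> carrier B" for b
    using that by (simp_all add: inv_into_into f_inv_into_f im[symmetric])
  have m: "\<phi> (x \<otimes>\<^bsub>A\<^esub> y) = \<phi> x \<otimes>\<^bsub>B\<^esub> \<phi> y" if "x \<in> carrier A" "y \<in> carrier A" for x y
    using iso that by (simp add: star_iso_def)
  show ?thesis unfolding mlt_ext_def using i m z by (auto intro!: restrict_ext)
qed

context usc_cstar_bundle
begin

lemma bounded_section_multiplier:
  assumes \<sigma>: "continuous_map X (total B) \<sigma>" "\<And>x. x \<in> topspace X \<Longrightarrow> proj B (\<sigma> x) = x"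
    and bd: "\<And>x. x \<in> topspace X \<Longrightarrow> cnorm (fib B x) (\<sigma> x) \<le> C"
  shows "((\<lambda>c\<in>Gamma0 X B. \<lambda>x\<in>topspace X. \<sigma> x \<otimes>\<^bsub>fib B x\<^esub> c x),
      (\<lambda>c\<in>Gamma0 X B. \<lambda>x\<in>topspace X. c x \<otimes>\<^bsub>fib B x\<^esub> \<sigma> x)) \<in> multipliers (section_algebra X B)"
    (is "(?L, ?R) \<in> _")
proof -
  let ?A = "section_algebra X B"
  have \<sigma>c: "\<sigma> x \<in> carrier (fib B x)" if "x \<in> topspace X" for x
    using continuous_map_funspace[OF \<sigma>(1)] \<sigma>(2)[OF that] that carrier_fib by auto
  \<comment> \<open>Over an empty base nothing prevents \<open>C\<close> from being
    negative.\<close>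
  define D where "D = max C 0"
  have D: "0 \<le> D" "\<And>x. x \<in> topspace X \<Longrightarrow> cnorm (fib B x) (\<sigma> x) \<le> D"
    using bd by (auto simp: D_def le_max_iff_disj)
  note GL = Gamma0_mult_left[OF \<sigma> bd] and GR = Gamma0_mult_right[OF \<sigma> bd]
  note ops = Gamma0_add Gamma0_mult Gamma0_smult[of "\<lambda>_. k" _ "cmod k" for k, simplified]
  have bL: "cnorm ?A (?L c) \<le> D * cnorm ?A c" and bR: "cnorm ?A (?R c) \<le> D * cnorm ?A c" if c: "c \<in> Gamma0 X B" for c
  proof -
    have *: "cnorm (fib B x) (\<sigma> x) * cnorm (fib B x) (c x) \<le> D * cnorm ?A c" if x: "x \<in> topspace X" for x
      using D x cnorm_section_upper[OF c x] cstar_algebra.cnorm_nonneg[OF fib_cstar[OF x] Gamma0D(4)[OF c x]]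
      by (intro mult_mono) auto
    have "0 \<le> D * cnorm ?A c" using D cnorm_section_nonneg[OF c] by simp
    moreover have "cnorm (fib B x) (?L c x) \<le> D * cnorm ?A c" "cnorm (fib B x) (?R c x) \<le> D * cnorm ?A c"
      if x: "x \<in> topspace X" for x
      using cstar_algebra.cnorm_mult[OF fib_cstar[OF x] \<sigma>c[OF x] Gamma0D(4)[OF c x]]
        cstar_algebra.cnorm_mult[OF fib_cstar[OF x] Gamma0D(4)[OF c x] \<sigma>c[OF x]] *[OF x] c x
      by (simp_all add: mult.commute[of "cnorm (fib B x) (\<sigma> x)"])
    ultimately show "cnorm ?A (?L c) \<le> D * cnorm ?A c" "cnorm ?A (?R c) \<le> D * cnorm ?A c"
      by (auto intro!: cnorm_section_least)
  qed
  have "bounded_operator ?A ?L"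
    unfolding bounded_operator_def carrier_section_algebra
  proof (intro conjI ballI allI exI[of _ D])
    show "?L \<in> Gamma0 X B \<rightarrow>\<^sub>E Gamma0 X B" using GL by auto
    fix a assume a: "a \<in> Gamma0 X B"
    show "cnorm ?A (?L a) \<le> D * cnorm ?A a" by (rule bL[OF a])
    show "?L (k \<odot>\<^bsub>?A\<^esub> a) = k \<odot>\<^bsub>?A\<^esub> ?L a" for k
      using a ops(3)[OF a] \<sigma>c Gamma0D(4)[OF a]
      by (auto simp: section_algebra_simps cstar_algebra.smult_mult_right[OF fib_cstar] intro!: restrict_ext)
    fix b assume b: "b \<in> Gamma0 X B"
    show "?L (a \<oplus>\<^bsub>?A\<^esub> b) = ?L a \<oplus>\<^bsub>?A\<^esub> ?L b"
      using a b ops(1)[OF a b] \<sigma>c Gamma0D(4)[OF a] Gamma0D(4)[OF b]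
      by (auto simp: section_algebra_simps cstar_algebra.distrib_left[OF fib_cstar] intro!: restrict_ext)
  qed
  moreover have "bounded_operator ?A ?R"
    unfolding bounded_operator_def carrier_section_algebra
  proof (intro conjI ballI allI exI[of _ D])
    show "?R \<in> Gamma0 X B \<rightarrow>\<^sub>E Gamma0 X B" using GR by auto
    fix a assume a: "a \<in> Gamma0 X B"
    show "cnorm ?A (?R a) \<le> D * cnorm ?A a" by (rule bR[OF a])
    show "?R (k \<odot>\<^bsub>?A\<^esub> a) = k \<odot>\<^bsub>?A\<^esub> ?R a" for k
      using a ops(3)[OF a] \<sigma>c Gamma0D(4)[OF a]
      by (auto simp: section_algebra_simps cstar_algebra.smult_mult_left[OF fib_cstar] intro!: restrict_ext)
    fix b assume b: "b \<in> Gamma0 X B"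
    show "?R (a \<oplus>\<^bsub>?A\<^esub> b) = ?R a \<oplus>\<^bsub>?A\<^esub> ?R b"
      using a b ops(1)[OF a b] \<sigma>c Gamma0D(4)[OF a] Gamma0D(4)[OF b]
      by (auto simp: section_algebra_simps cstar_algebra.distrib_right[OF fib_cstar] intro!: restrict_ext)
  qed
  moreover have "?L (a \<otimes>\<^bsub>?A\<^esub> b) = ?L a \<otimes>\<^bsub>?A\<^esub> b \<and> ?R (a \<otimes>\<^bsub>?A\<^esub> b) = a \<otimes>\<^bsub>?A\<^esub> ?R b \<and> a \<otimes>\<^bsub>?A\<^esub> ?L b = ?R a \<otimes>\<^bsub>?A\<^esub> b"
    if a: "a \<in> Gamma0 X B" and b: "b \<in> Gamma0 X B" for a b
    using a b ops(2)[OF a b] \<sigma>c Gamma0D(4)[OF a] Gamma0D(4)[OF b]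
    by (auto simp: section_algebra_simps cstar_algebra.mult_assoc[OF fib_cstar] intro!: restrict_ext)
  ultimately show ?thesis unfolding multipliers_def by simp
qed

text \<open>The centralizer identity passes information from one side to the other: equal right
  actions on \<open>Cc_sections\<close> force equal left actions on all sections, and these force
  equal right actions on all sections. Each passage tests a difference against its own
  adjoint.\<close>

lemma multiplier_eqI:
  assumes d: "d \<in> multipliers (section_algebra X B)" and d': "d' \<in> multipliers (section_algebra X B)"
    and eq: "\<And>c x. \<lbrakk>c \<in> Cc_sections X B; x \<in> topspace X\<rbrakk> \<Longrightarrow> mlt_right c d x = mlt_right c d' x"
  shows "d = d'"
proof -
  let ?A = "section_algebra X B"
  have props: "fst d \<in> Gamma0 X B \<rightarrow>\<^sub>E Gamma0 X B" "snd d \<in> Gamma0 X B \<rightarrow>\<^sub>E Gamma0 X B"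
    "\<lbrakk>a \<in> Gamma0 X B; b \<in> Gamma0 X B; x \<in> topspace X\<rbrakk> \<Longrightarrow> a x \<otimes>\<^bsub>fib B x\<^esub> fst d b x = snd d a x \<otimes>\<^bsub>fib B x\<^esub> b x"
    if "d \<in> multipliers ?A" for d :: "('x \<Rightarrow> 'e) multiplier" and a b x
  proof -
    show "fst d \<in> Gamma0 X B \<rightarrow>\<^sub>E Gamma0 X B" "snd d \<in> Gamma0 X B \<rightarrow>\<^sub>E Gamma0 X B"
      using that by (auto simp: multipliers_def bounded_operator_def split_beta)
    assume "a \<in> Gamma0 X B" "b \<in> Gamma0 X B" and x: "x \<in> topspace X"
    then have "a \<otimes>\<^bsub>?A\<^esub> fst d b = snd d a \<otimes>\<^bsub>?A\<^esub> b"
      using that by (auto simp: multipliers_def split_beta)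
    from fun_cong[OF this, of x] show "a x \<otimes>\<^bsub>fib B x\<^esub> fst d b x = snd d a x \<otimes>\<^bsub>fib B x\<^esub> b x"
      using x by (simp add: section_algebra_simps)
  qed
  note p = props[OF d] and p' = props[OF d']
  have L: "fst d b = fst d' b" if b: "b \<in> Gamma0 X B" for b
  proof -
    have m: "fst d b \<in> Gamma0 X B" "fst d' b \<in> Gamma0 X B" using p(1) p'(1) b by auto
    show ?thesis
    proof (rule Gamma0_ext[OF m])
      fix x assume x: "x \<in> topspace X"
      interpret F: cstar_algebra "fib B x" using fib_cstar[OF x] .
      note e = Gamma0_diff[OF m]
      let ?e = "\<lambda>x\<in>topspace X. fst d b x \<ominus>\<^bsub>fib B x\<^esub> fst d' b x"
      let ?s = "\<lambda>x\<in>topspace X. star (fib B x) (?e x)"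
      have K: "compactin X {x}" using x by simp
      obtain h where h: "bump X h" "\<And>y. y \<in> {x} \<Longrightarrow> h y = 1" by (rule base_bump[OF K]) (rule that)
      \<comment> \<open>A bump function with value 1 at \<open>x\<close> cuts the adjoint of the
        difference down to an element of \<open>Cc_sections\<close> without changing it at
        \<open>x\<close>.\<close>
      let ?c = "\<lambda>x\<in>topspace X. complex_of_real (h x) \<odot>\<^bsub>fib B x\<^esub> ?s x"
      have c: "?c \<in> Cc_sections X B"
        using bump_Cc[OF h(1)] Gamma0_star[OF e] unfolding Cc_sections_def carrier_section_algebra
        by (intro CollectI exI conjI) (rule refl)
      then have c0: "?c \<in> Gamma0 X B" by (simp add: Cc_sections_iff)
      have mx: "fst d b x \<in> carrier (fib B x)" "fst d' b x \<in> carrier (fib B x)"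
        using Gamma0D(4)[OF m(1) x] Gamma0D(4)[OF m(2) x] .
      have cx: "?c x = star (fib B x) (fst d b x \<ominus>\<^bsub>fib B x\<^esub> fst d' b x)"
        using x h(2)[of x] mx by (simp add: F.smult_one F.star_closed)
      have "?c x \<otimes>\<^bsub>fib B x\<^esub> fst d b x = ?c x \<otimes>\<^bsub>fib B x\<^esub> fst d' b x"
        using p(3)[OF c0 b x] p'(3)[OF c0 b x] eq[OF c x] by simp
      then have z: "?c x \<otimes>\<^bsub>fib B x\<^esub> (fst d b x \<ominus>\<^bsub>fib B x\<^esub> fst d' b x) = \<zero>\<^bsub>fib B x\<^esub>"
        using F.mult_diff_right[OF Gamma0D(4)[OF c0 x] mx] F.mult_closed[OF Gamma0D(4)[OF c0 x] mx(2)] F.diff_self by simp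
      have "fst d b x \<ominus>\<^bsub>fib B x\<^esub> fst d' b x = \<zero>\<^bsub>fib B x\<^esub>"
        by (rule F.star_mult_self_eq_zero[OF F.minus_closed[OF mx] z[unfolded cx]])
      then show "fst d b x = fst d' b x" using F.diff_eq_zero mx by blast
    qed
  qed
  \<comment> \<open>The left actions already agree on all sections, so the adjoint of the difference
    serves as test element without a cut-off.\<close>
  have R: "snd d a = snd d' a" if a: "a \<in> Gamma0 X B" for a
  proof -
    have m: "snd d a \<in> Gamma0 X B" "snd d' a \<in> Gamma0 X B" using p(2) p'(2) a by auto
    note e = Gamma0_diff[OF m]
    let ?e = "\<lambda>x\<in>topspace X. snd d a x \<ominus>\<^bsub>fib B x\<^esub> snd d' a x"
    let ?s = "\<lambda>x\<in>topspace X. star (fib B x) (?e x)"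
    note s = Gamma0_star[OF e]
    show ?thesis
    proof (rule Gamma0_ext[OF m])
      fix x assume x: "x \<in> topspace X"
      interpret F: cstar_algebra "fib B x" using fib_cstar[OF x] .
      have mx: "snd d a x \<in> carrier (fib B x)" "snd d' a x \<in> carrier (fib B x)"
        using Gamma0D(4)[OF m(1) x] Gamma0D(4)[OF m(2) x] .
      have sx: "?s x = star (fib B x) (snd d a x \<ominus>\<^bsub>fib B x\<^esub> snd d' a x)" using x by simp
      have "snd d a x \<otimes>\<^bsub>fib B x\<^esub> ?s x = snd d' a x \<otimes>\<^bsub>fib B x\<^esub> ?s x"
        using p(3)[OF a s x] p'(3)[OF a s x] L[OF s] by simp
      then have z: "(snd d a x \<ominus>\<^bsub>fib B x\<^esub> snd d' a x) \<otimes>\<^bsub>fib B x\<^esub> ?s x = \<zero>\<^bsub>fib B x\<^esub>"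
        using F.mult_diff_left[OF Gamma0D(4)[OF s x] mx] F.mult_closed[OF mx(2) Gamma0D(4)[OF s x]] F.diff_self by simp
      have "snd d a x \<ominus>\<^bsub>fib B x\<^esub> snd d' a x = \<zero>\<^bsub>fib B x\<^esub>"
        by (rule F.mult_star_self_eq_zero[OF F.minus_closed[OF mx] z[unfolded sx]])
      then show "snd d a x = snd d' a x" using F.diff_eq_zero mx by blast
    qed
  qed
  show ?thesis
  proof (rule prod_eqI)
    show "fst d = fst d'" using L by (rule PiE_ext[OF p(1) p'(1)])
    show "snd d = snd d'" using R by (rule PiE_ext[OF p(2) p'(2)])
  qed
qed

end

section \<open>The two inner products\<close>

context haar_groupoid
begin

text \<open>A nonnegative multiple of a bump function equal to 1 on \<open>K\<close> dominates
  \<open>n\<close>, and the fibre integrals of that bump are uniformly bounded. Off \<open>K\<close>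
  the majorant is nonnegative, so \<open>n \<gamma> \<le> 0\<close> is all that is asked
  there.\<close>

lemma nn_integral_compact_support_bounded:
  assumes K: "compactin (gtop G) K" and le: "\<And>\<gamma>. \<gamma> \<in> K \<Longrightarrow> n \<gamma> \<le> C"
    and z: "\<And>\<gamma>. \<lbrakk>\<gamma> \<in> arrows G; \<gamma> \<notin> K\<rbrakk> \<Longrightarrow> n \<gamma> \<le> (0::real)"
  shows "(SUP u\<in>units G. \<integral>\<^sup>+ \<gamma>. ennreal (n \<gamma>) \<partial>lam u) < \<infinity>"
proof -
  define D where "D = max C 0"
  have D: "0 \<le> D" "\<And>\<gamma>. \<gamma> \<in> K \<Longrightarrow> n \<gamma> \<le> D" using le by (auto simp: D_def le_max_iff_disj)
  obtain \<psi> V where \<psi>: "bump (gtop G) \<psi>" and "openin (gtop G) V" "K \<subseteq> V" "\<And>x. x \<in> V \<Longrightarrow> \<psi> x = 1"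
    by (rule bump_neighbourhood[OF locally_compact Hausdorff K openin_topspace compactin_subset_topspace[OF K]])
      (rule that)
  then have one: "\<psi> \<gamma> = 1" if "\<gamma> \<in> K" for \<gamma> using that by blast
  obtain E where E: "0 < E" "\<And>u. u \<in> units G \<Longrightarrow> (\<integral>\<gamma>. \<psi> \<gamma> \<partial>fibre_measure u) \<le> E"
    by (rule bump_integral_bounded[OF \<psi>]) (rule that)
  have c: "continuous_map (gtop G) euclidean \<psi>" and p: "\<And>\<gamma>. \<gamma> \<in> arrows G \<Longrightarrow> 0 \<le> \<psi> \<gamma> \<and> \<psi> \<gamma> \<le> 1"
    using \<psi> by (auto simp: bump_def)
  have "(\<integral>\<^sup>+ \<gamma>. ennreal (n \<gamma>) \<partial>lam u) \<le> ennreal (D * E)" if u: "u \<in> units G" for u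
  proof -
    obtain K1 where K1: "compactin (gtop G) K1" "\<And>x. \<lbrakk>x \<in> arrows G; x \<notin> K1\<rbrakk> \<Longrightarrow> \<psi> x = 0"
      by (rule bump_compact_support[OF \<psi>]) (rule that)
    have m: "\<psi> \<in> borel_measurable (lam u)" by (rule continuous_map_lam_borel_measurable[OF u c])
    have int: "integrable (lam u) \<psi>"
      using p K1(2)
      by (intro integrableI_bounded_set[OF closedin_sets_lam[OF u compactin_closedin[OF K1(1)]] m lam_compact[OF u K1(1)], of 1] AE_I2)
        (auto simp: space_lam[OF u])
    have "(\<integral>\<^sup>+ \<gamma>. ennreal (n \<gamma>) \<partial>lam u) \<le> (\<integral>\<^sup>+ \<gamma>. ennreal (D * \<psi> \<gamma>) \<partial>lam u)"
    proof (intro nn_integral_mono ennreal_leI)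
      fix \<gamma> assume "\<gamma> \<in> space (lam u)"
      then have g: "\<gamma> \<in> arrows G" by (simp add: space_lam[OF u])
      show "n \<gamma> \<le> D * \<psi> \<gamma>"
      proof (cases "\<gamma> \<in> K")
        case True
        then show ?thesis using one D by simp
      next
        case False
        have "0 \<le> D * \<psi> \<gamma>" using D(1) p[OF g] by simp
        then show ?thesis using z[OF g False] by linarith
      qed
    qed
    also have "\<dots> = ennreal (\<integral>\<gamma>. D * \<psi> \<gamma> \<partial>lam u)"
      using D(1) p by (intro nn_integral_eq_integral integrable_mult_right int AE_I2) (simp add: space_lam[OF u])
    also have "\<dots> \<le> ennreal (D * E)"
      using integral_lam_eq[OF u m] E(2)[OF u] D(1) by (intro ennreal_leI) (simp add: mult_left_mono)
    finally show ?thesis .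
  qed
  then have "(SUP u\<in>units G. \<integral>\<^sup>+ \<gamma>. ennreal (n \<gamma>) \<partial>lam u) \<le> ennreal (D * E)" by (rule SUP_least)
  then show ?thesis by (rule le_less_trans) simp
qed

end

context proper_system
begin

text \<open>The first factor confines the range and the second the source to compact sets, so by
  properness the function lives on a compact set of arrows. Measurability comes from upper
  semicontinuity of the norm.\<close>

lemma E_inner_I_integrable:
  assumes a: "a \<in> Cc_sections (unit_space G) B" and b: "b \<in> Cc_sections (unit_space G) B"
  shows "I_integrable G lam (\<lambda>\<gamma>. cnorm (fib B (rng G \<gamma>)) (E_inner G B \<alpha> a b \<gamma>))"
proof -
  let ?X = "unit_space G"
  define n where "n \<gamma> = cnorm (fib B (rng G \<gamma>)) (E_inner G B \<alpha> a b \<gamma>)" for \<gamma>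
  obtain Ka where a': "a \<in> Gamma0 ?X B" and Ka: "compactin ?X Ka" "\<forall>u\<in>units G - Ka. a u = \<zero>\<^bsub>fib B u\<^esub>"
    using a unfolding Cc_sections_iff by blast
  obtain Kb where b': "b \<in> Gamma0 ?X B" and Kb: "compactin ?X Kb" "\<forall>u\<in>units G - Kb. b u = \<zero>\<^bsub>fib B u\<^esub>"
    using b unfolding Cc_sections_iff by blast
  \<comment> \<open>Taking the adjoint as a section of its own makes
    \<open>action_pullback_section\<close> applicable to the second factor of
    \<open>E_inner\<close>.\<close>
  let ?bs = "\<lambda>u\<in>units G. star (fib B u) (b u)"
  have bs: "?bs \<in> Gamma0 ?X B" by (rule Gamma0_star[OF b'])
  let ?F = "\<lambda>\<gamma>. a (rng G \<gamma>) \<otimes>\<^bsub>fib B (rng G \<gamma>)\<^esub> \<alpha> \<gamma> (?bs (src G \<gamma>))"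
  have F: "pullback_section ?F"
    by (rule pullback_section_mult[OF pullback_section_rng[OF a'] action_pullback_section[OF bs]])
  note F' = pullback_sectionD[OF F]
  have n: "n \<gamma> = bnorm (?F \<gamma>)" if "\<gamma> \<in> arrows G" for \<gamma>
    using F'(2)[OF that] src_unit[OF that] by (simp add: n_def E_inner_def)
  let ?K = "\<lambda>P Q. {\<gamma> \<in> arrows G. rng G \<gamma> \<in> P \<and> src G \<gamma> \<in> Q}"
  have zero: "n \<gamma> = 0" if g: "\<gamma> \<in> arrows G" and nK: "\<gamma> \<notin> ?K Ka Kb" for \<gamma>
  proof -
    interpret R: cstar_algebra "fib B (rng G \<gamma>)" using fib_cstar[OF rng_unit[OF g]] .
    interpret S: cstar_algebra "fib B (src G \<gamma>)" using fib_cstar[OF src_unit[OF g]] .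
    have ac: "a (rng G \<gamma>) \<in> carrier (fib B (rng G \<gamma>))" by (rule Gamma0D(4)[OF a' rng_unit[OF g]])
    have bc: "\<alpha> \<gamma> (star (fib B (src G \<gamma>)) (b (src G \<gamma>))) \<in> carrier (fib B (rng G \<gamma>))"
      by (rule action_closed[OF g S.star_closed[OF Gamma0D(4)[OF b' src_unit[OF g]]]])
    have z: "\<alpha> \<gamma> \<zero>\<^bsub>fib B (src G \<gamma>)\<^esub> = \<zero>\<^bsub>fib B (rng G \<gamma>)\<^esub>"
      by (rule cstar_linear_zero[OF S.cstar_algebra_axioms R.cstar_algebra_axioms action_linear[OF g]])
    consider "rng G \<gamma> \<notin> Ka" | "src G \<gamma> \<notin> Kb" using g nK by blast
    then show ?thesis
    proof cases
      case 1
      then show ?thesis using Ka(2) rng_unit[OF g] R.mult_zero_left[OF bc] by (simp add: n_def E_inner_def)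
    next
      case 2
      then show ?thesis using Kb(2) src_unit[OF g] R.mult_zero_right[OF ac] z by (simp add: n_def E_inner_def)
    qed
  qed
  \<comment> \<open>Inversion exchanges range and source, so the integrals against
    \<open>lam_inv\<close> use the compact set with the two roles exchanged.\<close>
  note K = proper_preimage_compactin[OF proper Ka(1) Kb(1)] and K' = proper_preimage_compactin[OF proper Kb(1) Ka(1)]
  obtain C where C: "\<And>\<gamma>. \<gamma> \<in> ?K Ka Kb \<Longrightarrow> bnorm (?F \<gamma>) \<le> C"
    by (rule bnorm_bounded_on_compact[OF F'(1) K]) (rule that)
  have nC: "n \<gamma> \<le> C" if "\<gamma> \<in> ?K Ka Kb" for \<gamma> using C[OF that] n that by simp
  have meas: "n \<in> borel_measurable (borel_of (gtop G))"
    unfolding borel_measurable_iff_less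
  proof
    fix c
    have "{\<gamma> \<in> arrows G. n \<gamma> < c} = {\<gamma> \<in> arrows G. bnorm (?F \<gamma>) < c}" using n by auto
    then show "{\<gamma> \<in> space (borel_of (gtop G)). n \<gamma> < c} \<in> sets (borel_of (gtop G))"
      using openin_bnorm_less[OF F'(1), of c] by (simp add: sets_borel_of_openin)
  qed
  have 1: "(SUP u\<in>units G. \<integral>\<^sup>+ \<gamma>. ennreal (n \<gamma>) \<partial>lam u) < \<infinity>"
    using zero by (intro nn_integral_compact_support_bounded[OF K nC]) auto
  have inv_eq: "(\<integral>\<^sup>+ \<gamma>. ennreal (n \<gamma>) \<partial>lam_inv G lam u) = (\<integral>\<^sup>+ \<gamma>. ennreal (n (ginv G \<gamma>)) \<partial>lam u)" if u: "u \<in> units G" for u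
  proof -
    have "ginv G \<in> measurable (lam u) (borel_of (gtop G))"
    proof (rule measurable_sigma_sets[OF sets_borel_of])
      show "ginv G \<in> space (lam u) \<rightarrow> arrows G" using inv_closed by (auto simp: space_lam[OF u])
      show "ginv G -` U \<inter> space (lam u) \<in> sets (lam u)" if "U \<in> {U. openin (gtop G) U}" for U
      proof (rule openin_sets_lam[OF u])
        have "ginv G -` U \<inter> space (lam u) = {x \<in> arrows G. ginv G x \<in> U}" by (auto simp: space_lam[OF u])
        then show "openin (gtop G) (ginv G -` U \<inter> space (lam u))"
          using openin_continuous_map_preimage[OF inv_continuous, of U] that by simp
      qed
    qed (auto dest: openin_subset)
    then show ?thesis unfolding lam_inv_def using meas by (intro nn_integral_distr) auto
  qed
  have "(SUP u\<in>units G. \<integral>\<^sup>+ \<gamma>. ennreal (n (ginv G \<gamma>)) \<partial>lam u) < \<infinity>"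
  proof (rule nn_integral_compact_support_bounded[OF K'])
    fix \<gamma>
    show "n (ginv G \<gamma>) \<le> C" if "\<gamma> \<in> ?K Kb Ka" using that by (intro nC) (simp add: inv_closed inv_ends)
    show "n (ginv G \<gamma>) \<le> 0" if "\<gamma> \<in> arrows G" "\<gamma> \<notin> ?K Kb Ka"
    proof -
      have "ginv G \<gamma> \<notin> ?K Ka Kb" using that by (auto simp: inv_ends)
      then show ?thesis using zero[OF inv_closed[OF that(1)]] by simp
    qed
  qed
  then have 2: "(SUP u\<in>units G. \<integral>\<^sup>+ \<gamma>. ennreal (n \<gamma>) \<partial>lam_inv G lam u) < \<infinity>"
    by (simp add: inv_eq cong: SUP_cong)
  show ?thesis using meas 1 2 by (simp add: I_integrable_def I_norm_def n_def[abs_def])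
qed

lemma average_D_inner:
  assumes a: "a \<in> Cc_sections (unit_space G) B" and b: "b \<in> Cc_sections (unit_space G) B"
  shows "\<exists>d. d \<in> invariant_multipliers G B \<alpha> (Cc_sections (unit_space G) B) \<and>
    is_D_inner G lam B \<alpha> (Cc_sections (unit_space G) B) a b d"
proof -
  let ?X = "unit_space G" and ?A = "section_algebra (unit_space G) B"
  define m where "m = star ?A a \<otimes>\<^bsub>?A\<^esub> b"
  have "m \<in> Cc_sections ?X B"
    using star_subalgebra_Cc_sections a b by (auto simp: star_subalgebra_def m_def)
  then obtain L where m: "m \<in> Gamma0 ?X B" and L: "compactin ?X L" and mL: "\<forall>u\<in>units G - L. m u = \<zero>\<^bsub>fib B u\<^esub>"
    unfolding Cc_sections_iff by blast
  define I where "I = average m"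
  note I_cont = average_continuous[OF m L mL, folded I_def] and I_closed = average_closed[OF m L mL, folded I_def]
    and I_inv = average_invariant[OF m L mL, folded I_def] and I_int = average_integral[OF m L mL, folded I_def]
  have I_proj: "proj B (I u) = u" if "u \<in> units G" for u using I_closed[OF that] carrier_fib[OF that] by simp
  obtain C where "\<And>u. u \<in> units G \<Longrightarrow> cnorm (fib B u) (average m u) \<le> C"
    by (rule average_bounded[OF m L mL]) (rule that)
  note C = this[folded I_def]
  define d where "d = ((\<lambda>c\<in>Gamma0 ?X B. \<lambda>x\<in>units G. I x \<otimes>\<^bsub>fib B x\<^esub> c x),
      (\<lambda>c\<in>Gamma0 ?X B. \<lambda>x\<in>units G. c x \<otimes>\<^bsub>fib B x\<^esub> I x))"
  \<comment> \<open>The explicit fibres of \<open>d\<close>: multiplication by the values of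
    \<open>I\<close>, so that invariance of \<open>D\<close> under the extended action becomes
    invariance of \<open>I\<close>.\<close>
  define D where "D x = ((\<lambda>e\<in>carrier (fib B x). I x \<otimes>\<^bsub>fib B x\<^esub> e), (\<lambda>e\<in>carrier (fib B x). e \<otimes>\<^bsub>fib B x\<^esub> I x))" for x
  have dR: "mlt_right c d = (\<lambda>x\<in>units G. c x \<otimes>\<^bsub>fib B x\<^esub> I x)" if "c \<in> Cc_sections ?X B" for c
    using that by (simp add: d_def Cc_sections_iff)
  have "d \<in> invariant_multipliers G B \<alpha> (Cc_sections ?X B)"
    unfolding invariant_multipliers_def
  proof (intro CollectI conjI ballI exI[of _ D])
    show "d \<in> multipliers ?A" unfolding d_def by (rule bounded_section_multiplier[OF I_cont I_proj C])
    show "mlt_right c d \<in> Cc_sections ?X B" if c: "c \<in> Cc_sections ?X B" for c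
    proof -
      obtain K where K: "c \<in> Gamma0 ?X B" "compactin ?X K" "\<forall>u\<in>units G - K. c u = \<zero>\<^bsub>fib B u\<^esub>"
        using c unfolding Cc_sections_iff by blast
      then show ?thesis
        unfolding dR[OF c] Cc_sections_iff
        using Gamma0_mult_right[OF I_cont I_proj C K(1)] cstar_algebra.mult_zero_left[OF fib_cstar I_closed]
        by (intro conjI exI[of _ K]) auto
    qed
    show "fibres_of_multiplier ?X B d D"
      unfolding fibres_of_multiplier_def
    proof (intro ballI conjI)
      fix x assume x: "x \<in> units G"
      show "D x \<in> multipliers (fib B x)" unfolding D_def by (rule mult_multiplier[OF fib_cstar[OF x] I_closed[OF x]])
      show "mlt_left d c x = mlt_left (D x) (c x)" if "c \<in> carrier ?A" for c
        using that x Gamma0D(4)[of c x] by (simp add: d_def D_def)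
    qed
    show "mlt_ext (fib B (src G \<gamma>)) (fib B (rng G \<gamma>)) (\<alpha> \<gamma>) (D (src G \<gamma>)) = D (rng G \<gamma>)" if g: "\<gamma> \<in> arrows G" for \<gamma>
      unfolding D_def mlt_ext_mult[OF fib_cstar[OF src_unit[OF g]] action_iso[OF g] I_closed[OF src_unit[OF g]]]
        I_inv[OF g] ..
  qed
  moreover have "is_D_inner G lam B \<alpha> (Cc_sections ?X B) a b d"
    unfolding is_D_inner_def Let_def m_def[symmetric]
  proof (intro ballI)
    fix c u assume c: "c \<in> Cc_sections ?X B" and u: "u \<in> units G"
    interpret U: cstar_algebra "fib B u" using fib_cstar[OF u] .
    have c': "c \<in> Gamma0 ?X B" using c by (simp add: Cc_sections_iff)
    have cu: "c u \<in> carrier (fib B u)" by (rule Gamma0D(4)[OF c' u])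
    have T: "cstar_linear (fib B u) (fib B u) (\<lambda>e. c u \<otimes>\<^bsub>fib B u\<^esub> e)"
      using cu by (auto simp: cstar_linear_def U.mult_closed U.distrib_left U.smult_mult_right)
    \<comment> \<open>On the fibre over \<open>u\<close> the factor
      \<open>c (rng G \<gamma>)\<close> is the constant \<open>c u\<close>; left multiplication by
      it is bounded and linear, hence commutes with the integral.\<close>
    have "has_dominated_integral (fib B u) (fibre_measure u) (\<lambda>\<gamma>. c u \<otimes>\<^bsub>fib B u\<^esub> \<alpha> \<gamma> (m (src G \<gamma>))) (c u \<otimes>\<^bsub>fib B u\<^esub> I u)"
      by (rule has_dominated_integral_linear[OF U.cstar_algebra_axioms U.cstar_algebra_axioms T U.cnorm_mult[OF cu] I_int[OF u]])
    moreover have "c u \<otimes>\<^bsub>fib B u\<^esub> \<alpha> \<gamma> (m (src G \<gamma>)) = c (rng G \<gamma>) \<otimes>\<^bsub>fib B (rng G \<gamma>)\<^esub> \<alpha> \<gamma> (m (src G \<gamma>))"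
      if "\<gamma> \<in> space (fibre_measure u)" for \<gamma>
      using that range_fibreD[of \<gamma> G u] by (simp only: space_fibre_measure[OF u])
    ultimately have "has_dominated_integral (fib B u) (fibre_measure u)
        (\<lambda>\<gamma>. c (rng G \<gamma>) \<otimes>\<^bsub>fib B (rng G \<gamma>)\<^esub> \<alpha> \<gamma> (m (src G \<gamma>))) (c u \<otimes>\<^bsub>fib B u\<^esub> I u)"
      by (subst (asm) has_dominated_integral_cong) assumption+
    moreover have "mlt_right c d u = c u \<otimes>\<^bsub>fib B u\<^esub> I u" using u by (simp add: dR[OF c])
    ultimately show "has_cstar_integral (fib B u) (fibre_measure u)
        (\<lambda>\<gamma>. c (rng G \<gamma>) \<otimes>\<^bsub>fib B (rng G \<gamma>)\<^esub> \<alpha> \<gamma> (m (src G \<gamma>))) (mlt_right c d u)"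
      by (simp only:) (rule U.has_dominated_integral_imp_has_cstar_integral[OF _ pullback_section_measurable[OF
          pullback_section_mult[OF pullback_section_rng[OF c'] action_pullback_section[OF m]] u]])
  qed
  ultimately show ?thesis by blast
qed

text \<open>Both right actions are integrals of the same function. Uniqueness of values of
  \<open>has_dominated_integral\<close> equates them on \<open>Cc_sections\<close>, and
  \<open>multiplier_eqI\<close> extends this to the multipliers.\<close>

lemma D_inner_unique:
  assumes "d \<in> invariant_multipliers G B \<alpha> (Cc_sections (unit_space G) B)"
    "is_D_inner G lam B \<alpha> (Cc_sections (unit_space G) B) a b d"
    and "d' \<in> invariant_multipliers G B \<alpha> (Cc_sections (unit_space G) B)"
    "is_D_inner G lam B \<alpha> (Cc_sections (unit_space G) B) a b d'"
  shows "d = d'"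
proof (rule multiplier_eqI)
  show "d \<in> multipliers (section_algebra (unit_space G) B)" "d' \<in> multipliers (section_algebra (unit_space G) B)"
    using assms(1,3) by (simp_all add: invariant_multipliers_def)
  fix c u assume c: "c \<in> Cc_sections (unit_space G) B" and u: "u \<in> units G"
  interpret U: cstar_algebra "fib B u" using fib_cstar[OF u] .
  show "mlt_right c d u = mlt_right c d' u"
    using assms(2,4) c u unfolding is_D_inner_def Let_def
    by (intro U.has_dominated_integral_unique[OF U.has_cstar_integral_imp_has_dominated_integral
          U.has_cstar_integral_imp_has_dominated_integral]) blast+
qed

end

theorem proposition4p4:
  fixes G :: "'g groupoid" and lam :: "'g \<Rightarrow> 'g measure"
    and B :: "('g, 'e) cbundle" and \<alpha> :: "'g \<Rightarrow> 'e \<Rightarrow> 'e"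
  assumes "lch_groupoid G"
    and "haar_system G lam"
    and "proper_groupoid G"
    and "groupoid_dynamical_system G B \<alpha>"
  shows "proper_dynamical_system G lam B \<alpha> (Cc_sections (unit_space G) B)"
proof -
  interpret lch_groupoid G by fact
  interpret haar_system G lam by fact
  interpret groupoid_dynamical_system G B \<alpha> by fact
  interpret proper_system G lam B \<alpha> by unfold_locales fact
  show ?thesis
    unfolding proper_dynamical_system_def
  proof (intro conjI ballI)
    show "groupoid_dynamical_system G B \<alpha>" by fact
    show "star_subalgebra (section_algebra (unit_space G) B) (Cc_sections (unit_space G) B)"
      by (rule star_subalgebra_Cc_sections)
    show "dense_in_cstar (section_algebra (unit_space G) B) (Cc_sections (unit_space G) B)"
      by (rule dense_Cc_sections)
    fix a b assume ab: "a \<in> Cc_sections (unit_space G) B" "b \<in> Cc_sections (unit_space G) B"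
    show "I_integrable G lam (\<lambda>\<gamma>. cnorm (fib B (rng G \<gamma>)) (E_inner G B \<alpha> a b \<gamma>))"
      by (rule E_inner_I_integrable[OF ab])
    show "\<exists>!d. d \<in> invariant_multipliers G B \<alpha> (Cc_sections (unit_space G) B) \<and>
        is_D_inner G lam B \<alpha> (Cc_sections (unit_space G) B) a b d"
      by (rule ex_ex1I[OF average_D_inner[OF ab]]) (elim conjE, rule D_inner_unique)
  qed
qed

end
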